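(* Let $B\subset\mathbb{C}^2$ be a ball of radius $R\geq 2$ in $\mathbb{C}^2$ and let $T=\{(z,w)\in\mathbb{C}^2 : |z|<|w|<1\}$ be the Hartogs triangle, where $T\subset\subset B$ (that is, $T$ is relatively compact in $B$). Then both cohomology groups $H^{0,2}_c(B\setminus\overline T)$ and $H^{2,1}(B\setminus\overline T)$ are not Hausdorff.
   Context: For a complex manifold $\Omega$, $H^{p,q}(\Omega)$ is the Dolbeault cohomology group $\{f \text{ a } C^\infty\text{-smooth } (p,q)\text{-form on }\Omega: \overline\partial f=0\}/\{\overline\partial u: u \text{ a } C^\infty\text{-smooth } (p,q-1)\text{-form on }\Omega\}$, with the quotient topology coming from the usual Fréchet topology on smooth forms. $H^{p,q}_c(\Omega)$ is the analogous group built from the $C^\infty$-smooth forms with compact support in $\Omega$, with the quotient topology coming from the usual inductive limit topology on compactly supported smooth forms. Such a group is Hausdorff if and only if the image of $\overline\partial$ is closed. *)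

theory Defs
  imports "HOL-Analysis.Analysis" "HOL-Library.Function_Algebras"
begin

section \<open>Smooth functions\<close>

text \<open>Iterated real directional derivatives of a function on a real normed space.\<close>

fun iter_deriv ::
    "'a::real_normed_vector list \<Rightarrow> ('a \<Rightarrow> 'b::real_normed_vector) \<Rightarrow> 'a \<Rightarrow> 'b" where
  "iter_deriv [] f = f"
| "iter_deriv (v # vs) f = (\<lambda>x. frechet_derivative (iter_deriv vs f) (at x) v)"

text \<open>Meant for open \<open>U\<close> in a finite-dimensional space, where it says that \<open>f\<close> is
  \<open>C\<^sup>\<infinity>\<close> on \<open>U\<close> in the real sense.\<close>

definition smooth_on ::
    "'a::real_normed_vector set \<Rightarrow> ('a \<Rightarrow> 'b::real_normed_vector) \<Rightarrow> bool" where
  "smooth_on U f \<longleftrightarrow> (\<forall>vs. \<forall>x\<in>U. iter_deriv vs f differentiable (at x))"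


section \<open>Differential forms and the Cauchy-Riemann operator\<close>

text \<open>A form on an open \<open>\<Omega> \<subseteq> \<complex>\<^sup>n\<close> is given by its coefficients.
  With \<open>w\<^sub>j\<close> denoting the complex conjugate of \<open>z\<^sub>j\<close>, \<open>f I J\<close> is the coefficient of
  \<open>dz\<^sub>I \<and> dw\<^sub>J\<close>, both wedge products being taken in increasing order of the indices.
  So that equality of forms is equality in HOL, the coefficients are \<open>0\<close> outside \<open>\<Omega>\<close>,
  and the coefficients of a \<open>(p,q)\<close>-form are \<open>0\<close> unless \<open>card I = p\<close> and \<open>card J = q\<close>.\<close>

type_synonym 'n form = "'n set \<Rightarrow> 'n set \<Rightarrow> complex ^ 'n \<Rightarrow> complex"

definition smooth_forms :: "(complex ^ 'n::finite) set \<Rightarrow> nat \<Rightarrow> nat \<Rightarrow> 'n form set" where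
  "smooth_forms \<Omega> p q =
    {f. (\<forall>I J. smooth_on \<Omega> (f I J)) \<and>
        (\<forall>I J z. z \<notin> \<Omega> \<longrightarrow> f I J z = 0) \<and>
        (\<forall>I J z. card I \<noteq> p \<or> card J \<noteq> q \<longrightarrow> f I J z = 0)}"

definition forms_vanishing_off :: "(complex ^ 'n) set \<Rightarrow> 'n form set" where
  "forms_vanishing_off K = {f. \<forall>I J z. z \<notin> K \<longrightarrow> f I J z = 0}"

definition test_forms :: "(complex ^ 'n::finite) set \<Rightarrow> nat \<Rightarrow> nat \<Rightarrow> 'n form set" where
  "test_forms \<Omega> p q =
    {f \<in> smooth_forms \<Omega> p q. \<exists>K. compact K \<and> K \<subseteq> \<Omega> \<and> f \<in> forms_vanishing_off K}"

text \<open>\<open>\<partial>g/\<partial>w\<^sub>j = (\<partial>g/\<partial>x\<^sub>j + i \<partial>g/\<partial>y\<^sub>j) / 2\<close>, where \<open>z\<^sub>j = x\<^sub>j + i y\<^sub>j\<close> and \<open>w\<^sub>j\<close> is its conjugate.\<close>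

definition d_zbar :: "'n::finite \<Rightarrow> (complex ^ 'n \<Rightarrow> complex) \<Rightarrow> complex ^ 'n \<Rightarrow> complex" where
  "d_zbar j g z =
    (frechet_derivative g (at z) (axis j 1) + \<i> * frechet_derivative g (at z) (axis j \<i>)) / 2"

text \<open>The sign comes from
  \<open>dw\<^sub>j \<and> dz\<^sub>I \<and> dw\<^bsub>J - {j}\<^esub> = (-1)\<^bsup>card I + card {k \<in> J. k < j}\<^esup> dz\<^sub>I \<and> dw\<^sub>J\<close>.\<close>

definition dbar :: "(complex ^ 'n::{finite,linorder}) set \<Rightarrow> 'n form \<Rightarrow> 'n form" where
  "dbar \<Omega> f = (\<lambda>I J z. if z \<in> \<Omega>
      then \<Sum>j\<in>J. (-1) ^ (card I + card {k \<in> J. k < j}) * d_zbar j (f I (J - {j})) z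
      else 0)"


section \<open>Topologies on spaces of forms\<close>

text \<open>The Frechet topology: uniform convergence on compact subsets of \<open>\<Omega>\<close> of all derivatives
  of all coefficients.\<close>

definition smooth_forms_topology ::
    "(complex ^ 'n::finite) set \<Rightarrow> nat \<Rightarrow> nat \<Rightarrow> 'n form topology" where
  "smooth_forms_topology \<Omega> p q = topology_generated_by
    {{g \<in> smooth_forms \<Omega> p q.
        \<forall>z\<in>K. norm (iter_deriv vs (g I J) z - iter_deriv vs (f I J) z) < \<epsilon>}
      | f I J vs K \<epsilon>. f \<in> smooth_forms \<Omega> p q \<and> compact K \<and> K \<subseteq> \<Omega> \<and> \<epsilon> > 0}"

definition absolutely_convex :: "'n form set \<Rightarrow> bool" where
  "absolutely_convex W \<longleftrightarrow>
    (\<forall>f\<in>W. \<forall>g\<in>W. \<forall>a b. norm a + norm b \<le> 1 \<longrightarrow> (\<lambda>I J z. a * f I J z + b * g I J z) \<in> W)"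

text \<open>The inductive limit topology (in the category of locally convex spaces) of the Frechet
  spaces of forms supported in a fixed compact \<open>K \<subseteq> \<Omega>\<close>: a basis consists of the translates
  of those absolutely convex sets whose trace on each of these spaces is open.\<close>

definition test_forms_topology ::
    "(complex ^ 'n::finite) set \<Rightarrow> nat \<Rightarrow> nat \<Rightarrow> 'n form topology" where
  "test_forms_topology \<Omega> p q = topology_generated_by
    {(\<lambda>g. f + g) ` W | f W. f \<in> test_forms \<Omega> p q \<and> W \<subseteq> test_forms \<Omega> p q \<and> absolutely_convex W \<and>
      (\<forall>K. compact K \<and> K \<subseteq> \<Omega> \<longrightarrow>
        openin (subtopology (smooth_forms_topology \<Omega> p q) (forms_vanishing_off K))
               (W \<inter> forms_vanishing_off K))}"

definition quotient_topology :: "'a topology \<Rightarrow> ('a \<times> 'a) set \<Rightarrow> 'a set topology" where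
  "quotient_topology X r = topology (\<lambda>\<U>. \<U> \<subseteq> topspace X // r \<and> openin X (\<Union>\<U>))"


section \<open>Dolbeault cohomology\<close>

text \<open>For a topological space \<open>X\<close> of forms and a set \<open>B\<close> of forms, the quotient of
  the space of closed forms in \<open>X\<close> by \<open>B\<close>.\<close>

definition cohomology_space ::
    "(complex ^ 'n::{finite,linorder}) set \<Rightarrow> 'n form topology \<Rightarrow> 'n form set
      \<Rightarrow> 'n form set topology" where
  "cohomology_space \<Omega> X B =
    (let Z = {f \<in> topspace X. dbar \<Omega> f = 0}
     in quotient_topology (subtopology X Z) {(f, g). f \<in> Z \<and> g \<in> Z \<and> f - g \<in> B})"

definition dolbeault ::
    "(complex ^ 'n::{finite,linorder}) set \<Rightarrow> nat \<Rightarrow> nat \<Rightarrow> 'n form set topology" where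
  "dolbeault \<Omega> p q = cohomology_space \<Omega> (smooth_forms_topology \<Omega> p q)
     (case q of 0 \<Rightarrow> {0} | Suc r \<Rightarrow> dbar \<Omega> ` smooth_forms \<Omega> p r)"

definition dolbeault_c ::
    "(complex ^ 'n::{finite,linorder}) set \<Rightarrow> nat \<Rightarrow> nat \<Rightarrow> 'n form set topology" where
  "dolbeault_c \<Omega> p q = cohomology_space \<Omega> (test_forms_topology \<Omega> p q)
     (case q of 0 \<Rightarrow> {0} | Suc r \<Rightarrow> dbar \<Omega> ` test_forms \<Omega> p r)"


definition hartogs_triangle :: "(complex ^ 2) set" where
  "hartogs_triangle = {x. norm (x $ 1) < norm (x $ 2) \<and> norm (x $ 2) < 1}"


section \<open>Basic facts\<close>

lemma openin_quotient_topology: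
  assumes "equiv (topspace X) r"
  shows "openin (quotient_topology X r) \<U> \<longleftrightarrow> \<U> \<subseteq> topspace X // r \<and> openin X (\<Union>\<U>)"
proof -
  have "istopology (\<lambda>\<U>. \<U> \<subseteq> topspace X // r \<and> openin X (\<Union>\<U>))"
    unfolding istopology_def
  proof (intro conjI allI impI)
    fix S T assume S: "S \<subseteq> topspace X // r \<and> openin X (\<Union>S)"
      and T: "T \<subseteq> topspace X // r \<and> openin X (\<Union>T)"
    have "\<Union>(S \<inter> T) = \<Union>S \<inter> \<Union>T"
    proof
      show "\<Union>S \<inter> \<Union>T \<subseteq> \<Union>(S \<inter> T)"
      proof
        fix x assume "x \<in> \<Union>S \<inter> \<Union>T"
        then obtain A B where "A \<in> S" "B \<in> T" "x \<in> A" "x \<in> B" by blast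
        moreover from this have "A = B"
          using S T quotient_disj[OF assms] by blast
        ultimately show "x \<in> \<Union>(S \<inter> T)" by blast
      qed
    qed blast
    with S T show "openin X (\<Union>(S \<inter> T))" by (simp add: openin_Int)
    from S show "S \<inter> T \<subseteq> topspace X // r" by blast
  next
    fix \<K> assume K: "\<forall>K\<in>\<K>. K \<subseteq> topspace X // r \<and> openin X (\<Union>K)"
    then show "\<Union>\<K> \<subseteq> topspace X // r" by blast
    have "\<Union>(\<Union>\<K>) = \<Union>(Union ` \<K>)" by blast
    with K show "openin X (\<Union>(\<Union>\<K>))" by (metis (no_types, lifting) imageE openin_Union)
  qed
  then show ?thesis by (simp add: quotient_topology_def)
qed

lemma topspace_quotient_topology:
  assumes "equiv (topspace X) r"
  shows "topspace (quotient_topology X r) = topspace X // r"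
proof
  show "topspace (quotient_topology X r) \<subseteq> topspace X // r"
    using openin_quotient_topology[OF assms] openin_topspace by blast
  have "openin (quotient_topology X r) (topspace X // r)"
    by (simp add: openin_quotient_topology[OF assms] Union_quotient[OF assms])
  then show "topspace X // r \<subseteq> topspace (quotient_topology X r)" by (rule openin_subset)
qed

lemma quotient_map_quotient_topology:
  assumes "equiv (topspace X) r"
  shows "quotient_map X (quotient_topology X r) (\<lambda>x. r `` {x})"
proof -
  have eq: "{x \<in> topspace X. r `` {x} \<in> U} = \<Union>U" if U: "U \<subseteq> topspace X // r" for U
  proof
    show "{x \<in> topspace X. r `` {x} \<in> U} \<subseteq> \<Union>U"
      using equiv_class_self[OF assms] by blast
    show "\<Union>U \<subseteq> {x \<in> topspace X. r `` {x} \<in> U}"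
    proof
      fix x assume "x \<in> \<Union>U"
      then obtain A where A: "A \<in> U" "x \<in> A" by blast
      with U obtain y where "y \<in> topspace X" "A = r `` {y}" by (auto elim!: quotientE)
      with A have "r `` {x} = A" using equiv_class_eq[OF assms] by blast
      moreover have "x \<in> topspace X" using U A Union_quotient[OF assms] by blast
      ultimately show "x \<in> {x \<in> topspace X. r `` {x} \<in> U}" using A by simp
    qed
  qed
  have im: "(\<lambda>x. r `` {x}) ` topspace X = topspace X // r"
    by (auto simp: quotient_def)
  show ?thesis
    unfolding quotient_map_def topspace_quotient_topology[OF assms]
    using im by (auto simp: openin_quotient_topology[OF assms] eq)
qed

lemma topspace_smooth_forms_topology:
  "topspace (smooth_forms_topology \<Omega> p q) = smooth_forms \<Omega> p q" (is "?L = ?R")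
proof
  show "?L \<subseteq> ?R"
    unfolding smooth_forms_topology_def topology_generated_by_topspace by auto
  show "?R \<subseteq> ?L"
  proof
    fix f assume f: "f \<in> ?R"
    have "openin (smooth_forms_topology \<Omega> p q)
      {g \<in> ?R. \<forall>z\<in>{}. norm (iter_deriv [] (g {} {}) z - iter_deriv [] (f {} {}) z) < 1}"
      unfolding smooth_forms_topology_def
      by (rule topology_generated_by_Basis) (use f in \<open>blast intro: compact_empty zero_less_one\<close>)
    then show "f \<in> ?L" using f openin_subset by fastforce
  qed
qed

end

theory Submission
  imports Defs "HOL-Real_Asymp.Real_Asymp"
begin

text \<open>Write \<open>(z, w)\<close> for the coordinates and \<open>\<Omega>\<close> for the complement. Two families are biorthogonal.
  First, \<open>H\<^sub>k = z\<^bsup>-k-1\<^esup> \<kappa>(|w|\<^sup>2)\<close> with a cutoff \<open>\<kappa>\<close> is smooth on \<open>\<Omega>\<close>, because \<open>z \<noteq> 0\<close> there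
  when \<open>|w| \<le> 1\<close>; its \<open>\<partial>\<close>-bar derivative lives on \<open>3/4 < |w| < 1\<close>, where \<open>|z| > 3/4\<close> on \<open>\<Omega>\<close>.
  Second, there are compactly supported \<open>(0,1)\<close>-forms \<open>v\<^sub>j\<close> on \<open>\<Omega>\<close> whose \<open>\<partial>\<close>-bar derivative has the coefficient
  \<open>- z\<^bsup>j+1\<^esup> a(|z|\<^sup>2) b(|w|\<^sup>2)\<close>, supported where \<open>1/8 \<le> |w| \<le> 1/4\<close> and \<open>1/3 \<le> |z| \<le> 1/2\<close>.
  By rotation invariance, the pairing of the derivative of \<open>v\<^sub>j\<close> with \<open>H\<^sub>k\<close> is a nonzero constant times the
  Kronecker symbol.

  The derivatives of \<open>\<Sum>\<^sub>j (8/5)\<^sup>j v\<^sub>j\<close> converge. If the limit were the derivative of a test form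
  \<open>v\<close>, then Stokes' formula would bound its pairing with \<open>H\<^sub>k\<close>, a multiple of \<open>(8/5)\<^sup>k\<close>, by the integral of
  \<open>v\<close> against the derivative of \<open>H\<^sub>k\<close>, which is \<open>O((4/3)\<^sup>k)\<close>.
  Dually, the derivatives of \<open>\<Sum>\<^sub>k (3/4)\<^sup>k H\<^sub>k\<close> converge. If the limit were the derivative of a
  smooth function \<open>\<phi>\<close>, then pairing \<open>\<phi>\<close> with the derivative of \<open>v\<^sub>j\<close> would give a multiple of \<open>(3/4)\<^sup>j\<close>
  that is \<open>O((1/2)\<^sup>j)\<close>. So neither image is closed.\<close>


section \<open>Smooth functions\<close>

text \<open>The argument lives in the gap between the radii 1/2 and 3/4. Near the origin
  \<open>\<Omega>\<close> reaches down to small |z|, so the sources can sit where |z| <= 1/2,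
  whereas the cutoff of a pole can be pushed towards |w| = 1, where \<open>\<Omega>\<close> forces
  |z| > |w| > 3/4. In both directions the derivatives converge although the primitives diverge: v_j
  has size |z|^(j+1) on a set with |z| > 1, and H_k is too large on the shell. A ratio s for the v_j
  needs s < 2 for convergence on |z| <= 1/2 and s > 4/3 to beat the bound on |z| > 3/4. A ratio t
  for the H_k needs t <= 3/4 for convergence on compact subsets of |z| > 3/4 and t > 1/2 to beat the
  bound on |z| <= 1/2. The obstacle is the compact support of v_j. The obvious primitive of the
  source extends into the triangle, at small |z|. There it is exact, with a potential that is smooth
  across w = 0. Subtracting this exact form, cut off on a larger polydisc, moves the support off the
  triangle at the price of a component on |z| > 1.\<close>

lemma frechet_derivative_cong_open:
  assumes "open U" "x \<in> U" "\<And>y. y \<in> U \<Longrightarrow> f y = g y"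
  shows "frechet_derivative f (at x) = frechet_derivative g (at x)"
proof -
  have "(f has_derivative f') (at x) \<longleftrightarrow> (g has_derivative f') (at x)" for f'
    using has_derivative_transform_within_open[of f f' x UNIV U g]
      has_derivative_transform_within_open[of g f' x UNIV U f] assms by auto
  then show ?thesis by (simp add: frechet_derivative_def)
qed

lemma differentiable_cong_open:
  assumes "open U" "x \<in> U" "\<And>y. y \<in> U \<Longrightarrow> f y = g y" "f differentiable (at x)"
  shows "g differentiable (at x)"
  using assms has_derivative_transform_within_open[of f _ x UNIV U g]
  unfolding differentiable_def by blast

text \<open>\<open>frechet_derivative\<close> is a choice among the derivatives at a point, and the
  set of candidates depends only on the germ; so the values agree even where no derivative
  exists.\<close>

lemma iter_deriv_cong_open:
  assumes "open U" "\<And>y. y \<in> U \<Longrightarrow> f y = g y" "x \<in> U"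
  shows "iter_deriv vs f x = iter_deriv vs g x"
  using assms(3)
proof (induction vs arbitrary: x)
  case (Cons v vs)
  then show ?case
    using frechet_derivative_cong_open[OF assms(1), of x "iter_deriv vs f" "iter_deriv vs g"]
    by simp
qed (use assms in auto)

lemma iter_deriv_append: "iter_deriv ws (iter_deriv vs f) = iter_deriv (ws @ vs) f"
  by (induction ws) auto

lemma smooth_on_cong:
  assumes "open U" "\<And>y. y \<in> U \<Longrightarrow> f y = g y" "smooth_on U f"
  shows "smooth_on U g"
  unfolding smooth_on_def
proof (intro allI ballI)
  fix vs x assume x: "x \<in> U"
  then have "iter_deriv vs f differentiable (at x)" using assms(3) by (simp add: smooth_on_def)
  then show "iter_deriv vs g differentiable (at x)"
    by (rule differentiable_cong_open[OF assms(1) x, rotated]) (rule iter_deriv_cong_open[OF assms(1,2)])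
qed

lemma smooth_on_subset: "smooth_on U f \<Longrightarrow> V \<subseteq> U \<Longrightarrow> smooth_on V f"
  by (auto simp: smooth_on_def)

lemma smooth_on_Un: "smooth_on U f \<Longrightarrow> smooth_on V f \<Longrightarrow> smooth_on (U \<union> V) f"
  by (auto simp: smooth_on_def)

lemma smooth_on_iter_deriv: "smooth_on U f \<Longrightarrow> smooth_on U (iter_deriv vs f)"
  by (auto simp: smooth_on_def iter_deriv_append)

lemma smooth_on_frechet_derivative:
  "smooth_on U f \<Longrightarrow> smooth_on U (\<lambda>x. frechet_derivative f (at x) v)"
  using smooth_on_iter_deriv[of U f "[v]"] by simp

lemma smooth_on_imp_differentiable: "smooth_on U f \<Longrightarrow> x \<in> U \<Longrightarrow> f differentiable (at x)"
  unfolding smooth_on_def using iter_deriv.simps(1) by metis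

lemma smooth_on_has_derivative:
  "smooth_on U f \<Longrightarrow> x \<in> U \<Longrightarrow> (f has_derivative frechet_derivative f (at x)) (at x)"
  using smooth_on_imp_differentiable frechet_derivative_works by blast

lemma smooth_on_imp_continuous_on: "smooth_on U f \<Longrightarrow> continuous_on U f"
  by (meson continuous_at_imp_continuous_on differentiable_imp_continuous_within
      smooth_on_imp_differentiable)

text \<open>Derivatives have to return to \<open>S\<close> only up to equality on \<open>U\<close>:
  since \<open>U\<close> is open, iterated derivatives at its points see only germs.\<close>

lemma smooth_on_coinduct:
  assumes "open U" "f \<in> S"
    and diff: "\<And>f x. f \<in> S \<Longrightarrow> x \<in> U \<Longrightarrow> f differentiable (at x)"
    and step: "\<And>f v. f \<in> S \<Longrightarrow> \<exists>g\<in>S. \<forall>x\<in>U. frechet_derivative f (at x) v = g x"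
  shows "smooth_on U f"
proof -
  have ex: "\<exists>g\<in>S. \<forall>x\<in>U. iter_deriv vs f x = g x" for vs
  proof (induction vs)
    case (Cons v vs)
    then obtain g where g: "g \<in> S" "\<forall>x\<in>U. iter_deriv vs f x = g x" by blast
    obtain g' where g': "g' \<in> S" "\<forall>x\<in>U. frechet_derivative g (at x) v = g' x"
      using step[OF g(1)] by blast
    have "iter_deriv (v # vs) f x = g' x" if "x \<in> U" for x
      using frechet_derivative_cong_open[OF assms(1) that, of "iter_deriv vs f" g] g g' that by simp
    with g' show ?case by blast
  qed (use assms in auto)
  show ?thesis unfolding smooth_on_def
  proof (intro allI ballI)
    fix vs x assume x: "x \<in> U"
    obtain g where g: "g \<in> S" "\<forall>x\<in>U. iter_deriv vs f x = g x" using ex by blast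
    then show "iter_deriv vs f differentiable (at x)"
      using differentiable_cong_open[OF assms(1) x, of g] diff[OF g(1) x] by auto
  qed
qed

text \<open>The generators to which this is applied, such as an inverse or a composition, are not
  closed under derivatives. Their polynomials with smooth coefficients are, by the product
  rule.\<close>

inductive_set smooth_algebra ::
    "'a::real_normed_vector set \<Rightarrow> ('a \<Rightarrow> 'b::real_normed_algebra) set \<Rightarrow> ('a \<Rightarrow> 'b) set"
  for U S where
  gen: "f \<in> S \<Longrightarrow> f \<in> smooth_algebra U S"
| smooth: "smooth_on U f \<Longrightarrow> f \<in> smooth_algebra U S"
| add: "f \<in> smooth_algebra U S \<Longrightarrow> g \<in> smooth_algebra U S \<Longrightarrow> (\<lambda>x. f x + g x) \<in> smooth_algebra U S"
| mult: "f \<in> smooth_algebra U S \<Longrightarrow> g \<in> smooth_algebra U S \<Longrightarrow> (\<lambda>x. f x * g x) \<in> smooth_algebra U S"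

text \<open>Coinduction up to ring operations and smooth functions.\<close>

lemma smooth_on_algebra:
  assumes "open U" "f \<in> smooth_algebra U S"
    and diff: "\<And>f x. f \<in> S \<Longrightarrow> x \<in> U \<Longrightarrow> f differentiable (at x)"
    and step: "\<And>f v. f \<in> S \<Longrightarrow>
      \<exists>g\<in>smooth_algebra U S. \<forall>x\<in>U. frechet_derivative f (at x) v = g x"
  shows "smooth_on U f"
proof -
  have diff': "f differentiable (at x)" if "f \<in> smooth_algebra U S" "x \<in> U" for f x
    using that by (induction rule: smooth_algebra.induct)
      (auto intro: diff smooth_on_imp_differentiable)
  show ?thesis
  proof (rule smooth_on_coinduct[OF assms(1) assms(2)])
    show "f differentiable (at x)" if "f \<in> smooth_algebra U S" "x \<in> U" for f x
      using diff' that .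
    show "\<exists>g\<in>smooth_algebra U S. \<forall>x\<in>U. frechet_derivative f (at x) v = g x"
      if "f \<in> smooth_algebra U S" for f v
      using that
    proof (induction rule: smooth_algebra.induct)
      case (gen f) then show ?case by (rule step)
    next
      case (smooth f)
      then show ?case
        by (auto intro!: bexI[of _ "\<lambda>x. frechet_derivative f (at x) v"]
            smooth_algebra.smooth smooth_on_frechet_derivative)
    next
      case (add f g)
      then obtain f' g' where fg: "f' \<in> smooth_algebra U S" "g' \<in> smooth_algebra U S"
        "\<forall>x\<in>U. frechet_derivative f (at x) v = f' x" "\<forall>x\<in>U. frechet_derivative g (at x) v = g' x"
        by blast
      have "frechet_derivative (\<lambda>x. f x + g x) (at x) v = f' x + g' x" if "x \<in> U" for x
        using fg that frechet_derivative_at[OF has_derivative_add[OF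
          iffD1[OF frechet_derivative_works diff'[OF add(1) that]] iffD1[OF frechet_derivative_works diff'[OF add(2) that]]]]
        by (metis (mono_tags))
      with fg show ?case by (intro bexI[of _ "\<lambda>x. f' x + g' x"]) (auto intro: smooth_algebra.add)
    next
      case (mult f g)
      then obtain f' g' where fg: "f' \<in> smooth_algebra U S" "g' \<in> smooth_algebra U S"
        "\<forall>x\<in>U. frechet_derivative f (at x) v = f' x" "\<forall>x\<in>U. frechet_derivative g (at x) v = g' x"
        by blast
      have "frechet_derivative (\<lambda>x. f x * g x) (at x) v = f x * g' x + f' x * g x" if "x \<in> U" for x
        using fg that frechet_derivative_at[OF has_derivative_mult[OF
          iffD1[OF frechet_derivative_works diff'[OF mult(1) that]] iffD1[OF frechet_derivative_works diff'[OF mult(2) that]]]]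
        by (metis (mono_tags))
      with fg mult show ?case
        by (intro bexI[of _ "\<lambda>x. f x * g' x + f' x * g x"]) (auto intro!: smooth_algebra.add smooth_algebra.mult)
    qed
  qed
qed

section \<open>Operations that preserve smoothness\<close>

context
  fixes U :: "'a::real_normed_vector set"
  assumes U: "open U"
begin

lemma smooth_on_bounded_linear:
  fixes f :: "'a \<Rightarrow> 'b::real_normed_vector"
  assumes "bounded_linear f"
  shows "smooth_on U f"
proof (rule smooth_on_coinduct[OF U, of _ "insert f (range (\<lambda>c _. c))"])
  fix g v assume "g \<in> insert f (range (\<lambda>c _. c))"
  moreover have "frechet_derivative f (at x) = f" for x
    using frechet_derivative_at[OF bounded_linear_imp_has_derivative[OF assms]] by metis
  ultimately show "\<exists>h\<in>insert f (range (\<lambda>c _. c)). \<forall>x\<in>U. frechet_derivative g (at x) v = h x"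
    by auto
qed (use assms bounded_linear_imp_differentiable in auto)

lemma smooth_on_const [simp, intro]: "smooth_on U (\<lambda>x. c)"
  by (rule smooth_on_coinduct[OF U, of _ "range (\<lambda>c _. c)"]) auto

lemma smooth_on_add [intro]:
  fixes f g :: "'a \<Rightarrow> 'b::real_normed_algebra"
  assumes "smooth_on U f" "smooth_on U g"
  shows "smooth_on U (\<lambda>x. f x + g x)"
  by (rule smooth_on_algebra[OF U smooth_algebra.add[OF smooth_algebra.smooth smooth_algebra.smooth,
        OF assms, of "{}"]]) auto

lemma smooth_on_mult [intro]:
  fixes f g :: "'a \<Rightarrow> 'b::real_normed_algebra"
  assumes "smooth_on U f" "smooth_on U g"
  shows "smooth_on U (\<lambda>x. f x * g x)"
  by (rule smooth_on_algebra[OF U smooth_algebra.mult[OF smooth_algebra.smooth smooth_algebra.smooth,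
        OF assms, of "{}"]]) auto

lemma smooth_on_uminus [intro]:
  fixes f :: "'a \<Rightarrow> 'b::real_normed_algebra_1"
  assumes "smooth_on U f"
  shows "smooth_on U (\<lambda>x. - f x)"
  using smooth_on_mult[OF smooth_on_const[of "-1"] assms] by simp

lemma smooth_on_diff [intro]:
  fixes f g :: "'a \<Rightarrow> 'b::real_normed_algebra_1"
  assumes "smooth_on U f" "smooth_on U g"
  shows "smooth_on U (\<lambda>x. f x - g x)"
  using smooth_on_add[OF assms(1) smooth_on_uminus[OF assms(2)]] by simp

lemma smooth_on_power [intro]:
  fixes f :: "'a \<Rightarrow> 'b::real_normed_algebra_1"
  assumes "smooth_on U f"
  shows "smooth_on U (\<lambda>x. f x ^ n)"
  by (induction n) (auto intro!: assms)

lemma smooth_on_sum [intro]: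
  fixes f :: "'i \<Rightarrow> 'a \<Rightarrow> 'b::real_normed_algebra_1"
  assumes "\<And>i. i \<in> I \<Longrightarrow> smooth_on U (f i)"
  shows "smooth_on U (\<lambda>x. \<Sum>i\<in>I. f i x)"
  using assms by (induction I rule: infinite_finite_induct) auto

text \<open>One generator g = 1/f is enough, since its derivative -f' g^2 is a polynomial in g with
  the smooth coefficient -f'.\<close>

lemma smooth_on_inverse [intro]:
  fixes f :: "'a \<Rightarrow> 'b::real_normed_field"
  assumes "smooth_on U f" "\<And>x. x \<in> U \<Longrightarrow> f x \<noteq> 0"
  shows "smooth_on U (\<lambda>x. inverse (f x))"
proof (rule smooth_on_algebra[OF U, of _ "{\<lambda>x. inverse (f x)}"])
  let ?S = "{\<lambda>x. inverse (f x)}"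
  have D: "((\<lambda>x. inverse (f x)) has_derivative
      (\<lambda>h. - (inverse (f x) * frechet_derivative f (at x) h * inverse (f x)))) (at x)" if "x \<in> U" for x
    using Deriv.has_derivative_inverse[OF assms(2)[OF that] smooth_on_has_derivative[OF assms(1) that]] .
  then show "g differentiable (at x)" if "g \<in> ?S" "x \<in> U" for g x
    using that by (auto simp: differentiable_def)
  fix g v assume g: "g \<in> ?S"
  let ?h = "\<lambda>x. - frechet_derivative f (at x) v * (inverse (f x) * inverse (f x))"
  have h: "frechet_derivative g (at x) v = ?h x" if "x \<in> U" for x
    using g frechet_derivative_at[OF D[OF that], symmetric] by (simp add: mult_ac)
  have "?h \<in> smooth_algebra U ?S"
    by (rule smooth_algebra.mult smooth_algebra.gen smooth_algebra.smooth
        smooth_on_uminus smooth_on_frechet_derivative assms singletonI)+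
  then show "\<exists>h\<in>smooth_algebra U ?S. \<forall>x\<in>U. frechet_derivative g (at x) v = h x"
    by (rule bexI[rotated]) (use h in simp)
qed (auto intro: smooth_algebra.gen)

lemma smooth_on_bounded_linear_compose:
  fixes f :: "'a \<Rightarrow> 'b::real_normed_vector"
  assumes "bounded_linear L" "smooth_on U f"
  shows "smooth_on U (\<lambda>x. L (f x))"
proof (rule smooth_on_coinduct[OF U, of _ "{\<lambda>x. L (f x) | f. smooth_on U f}"])
  let ?S = "{\<lambda>x. L (f x) | f. smooth_on U f}"
  have D: "((\<lambda>x. L (f x)) has_derivative (\<lambda>h. L (frechet_derivative f (at x) h))) (at x)"
    if "smooth_on U f" "x \<in> U" for f :: "'a \<Rightarrow> 'b" and x
    using bounded_linear.has_derivative[OF assms(1) smooth_on_has_derivative[OF that]] .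
  show "g differentiable (at x)" if "g \<in> ?S" "x \<in> U" for g x
    using that D by (auto simp: differentiable_def)
  fix g v assume "g \<in> ?S"
  then obtain f where f: "g = (\<lambda>x. L (f x))" "smooth_on U f" by blast
  show "\<exists>h\<in>?S. \<forall>x\<in>U. frechet_derivative g (at x) v = h x"
    using f frechet_derivative_at[OF D[OF f(2)], symmetric]
    by (intro bexI[of _ "\<lambda>x. L (frechet_derivative f (at x) v)"])
      (auto intro: smooth_on_frechet_derivative)
qed (use assms in auto)

text \<open>The embedding into \<open>'b\<close> allows products of such compositions with complex functions.\<close>

lemma smooth_on_compose_real:
  fixes \<phi> :: "real \<Rightarrow> real" and q :: "'a \<Rightarrow> real"
  assumes \<phi>: "smooth_on UNIV \<phi>" and q: "smooth_on U q"
  shows "smooth_on U (\<lambda>x. of_real (\<phi> (q x)) :: 'b::real_normed_field)"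
proof (rule smooth_on_algebra[OF U, of _ "{\<lambda>x. of_real (\<psi> (q x)) | \<psi>. smooth_on UNIV \<psi>}"])
  let ?S = "{\<lambda>x. of_real (\<psi> (q x)) :: 'b | \<psi>::real \<Rightarrow> real. smooth_on UNIV \<psi>}"
  have D: "((\<lambda>x. of_real (\<psi> (q x)) :: 'b) has_derivative
      (\<lambda>h. of_real (frechet_derivative \<psi> (at (q x)) (frechet_derivative q (at x) h)))) (at x)"
    if "smooth_on UNIV \<psi>" "x \<in> U" for \<psi> x
    using that q by (intro derivative_eq_intros has_derivative_compose[OF smooth_on_has_derivative])
      (auto intro: smooth_on_has_derivative)
  show "g differentiable (at x)" if "g \<in> ?S" "x \<in> U" for g x
    using that D by (fastforce simp: differentiable_def)
  fix g v assume "g \<in> ?S"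
  then obtain \<psi> where g: "g = (\<lambda>x. of_real (\<psi> (q x)))" "smooth_on UNIV \<psi>" by blast
  let ?h = "\<lambda>x. of_real (frechet_derivative \<psi> (at (q x)) 1) * of_real (frechet_derivative q (at x) v) :: 'b"
  have lin: "frechet_derivative \<psi> (at t) y = frechet_derivative \<psi> (at t) 1 * y" for t y
    using linear_scale[OF linear_frechet_derivative[OF smooth_on_imp_differentiable[OF g(2), of t]], of y 1]
    by (simp add: mult.commute)
  have h: "frechet_derivative g (at x) v = ?h x" if "x \<in> U" for x
    using fun_cong[OF frechet_derivative_at[OF D[OF g(2) that], symmetric], of v] g(1) lin
    by (metis of_real_mult)
  have "(\<lambda>x. of_real (frechet_derivative \<psi> (at (q x)) 1)) \<in> ?S"
    using smooth_on_frechet_derivative[OF g(2), of 1]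
    by (intro CollectI exI[of _ "\<lambda>t. frechet_derivative \<psi> (at t) 1"]) simp
  then have "?h \<in> smooth_algebra U ?S"
    by (intro smooth_algebra.mult[OF smooth_algebra.gen smooth_algebra.smooth]
        smooth_on_bounded_linear_compose[OF bounded_linear_of_real] smooth_on_frechet_derivative q)
  then show "\<exists>h\<in>smooth_algebra U ?S. \<forall>x\<in>U. frechet_derivative g (at x) v = h x"
    by (rule bexI[rotated]) (use h in simp)
qed (rule smooth_algebra.gen, use \<phi> in blast)

end


section \<open>Cutoff functions and integration by parts\<close>

lemma frechet_derivative_real:
  assumes "(f has_real_derivative D) (at t)"
  shows "frechet_derivative f (at t) v = v * D"
  using frechet_derivative_at[OF assms[unfolded has_field_derivative_def]] by (metis mult.commute)

text \<open>The functions t^(-n) exp(-1/t), extended by 0. The index is there because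
  differentiating exp(-1/t) brings in powers of 1/t; the span of the family is closed under
  differentiation.\<close>

definition flat :: "nat \<Rightarrow> real \<Rightarrow> real" where
  "flat n t = (if t \<le> 0 then 0 else inverse t ^ n * exp (- inverse t))"

lemma has_real_derivative_flat:
  "(flat n has_real_derivative - real n * flat (Suc n) t + flat (Suc (Suc n)) t) (at t)"
proof -
  consider "t > 0" | "t < 0" | "t = 0" by linarith
  then show ?thesis
  proof cases
    case 1
    have "((\<lambda>t. inverse t ^ n * exp (- inverse t)) has_real_derivative
        - real n * flat (Suc n) t + flat (Suc (Suc n)) t) (at t)"
    proof (cases n)
      case 0
      with 1 show ?thesis
        by (auto intro!: derivative_eq_intros simp: flat_def power2_eq_square algebra_simps)
    next
      case (Suc m)
      have pw: "inverse t ^ i = inverse t * inverse t ^ (i - Suc 0)" if "i \<noteq> 0" for i :: nat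
        using that by (cases i) auto
      from 1 Suc show ?thesis
        by (auto intro!: derivative_eq_intros simp: flat_def power2_eq_square algebra_simps)
          (use pw in blast)
    qed
    then show ?thesis
      by (rule has_field_derivative_transform_within_open[OF _ open_greaterThan[of 0]])
        (use 1 in \<open>auto simp: flat_def\<close>)
  next
    case 2
    have "((\<lambda>t. 0) has_real_derivative - real n * flat (Suc n) t + flat (Suc (Suc n)) t) (at t)"
      using 2 by (simp add: flat_def)
    then show ?thesis
      by (rule has_field_derivative_transform_within_open[OF _ open_lessThan[of 0]])
        (use 2 in \<open>auto simp: flat_def\<close>)
  next
    case 3
    \<comment> \<open>The difference quotient at 0 from the right is \<open>flat (Suc n)\<close>; in
      the variable 1/h it is a power divided by the exponential.\<close>
    have "((\<lambda>h. flat n h / h) \<longlongrightarrow> 0) (at_right 0)"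
    proof (rule Lim_transform_eventually)
      have "((\<lambda>x. inverse x ^ Suc n / exp (inverse x)) \<longlongrightarrow> (0::real)) (at_right 0)"
        by (rule filterlim_compose[OF tendsto_power_div_exp_0 filterlim_inverse_at_top_right])
      then show "((\<lambda>x. inverse x ^ Suc n / exp (inverse x)) \<longlongrightarrow> (0::real)) (at_right 0)" .
      show "\<forall>\<^sub>F x in at_right 0. inverse x ^ Suc n / exp (inverse x) = flat n x / x"
        by (auto simp: eventually_at_right_field flat_def exp_minus divide_simps intro!: exI[of _ 1])
    qed
    moreover have "((\<lambda>h. flat n h / h) \<longlongrightarrow> 0) (at_left 0)"
      by (rule tendsto_eventually) (auto simp: eventually_at_left_field flat_def intro!: exI[of _ "-1"])
    ultimately have "((\<lambda>h. flat n h / h) \<longlongrightarrow> 0) (at 0)"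
      by (rule filterlim_split_at[rotated])
    then show ?thesis
      using 3 by (simp add: has_field_derivative_iff flat_def)
  qed
qed

lemma smooth_on_flat: "smooth_on UNIV (flat 0)"
proof (rule smooth_on_algebra[OF open_UNIV, of _ "range flat"])
  show "f differentiable (at x)" if "f \<in> range flat" for f x
    using that has_real_derivative_flat real_differentiable_def by blast
  fix f v assume "f \<in> range flat"
  then obtain n where n: "f = flat n" by blast
  have "(\<lambda>t. v * (- real n * flat (Suc n) t + flat (Suc (Suc n)) t)) \<in> smooth_algebra UNIV (range flat)"
    by (rule smooth_algebra.mult[OF smooth_algebra.smooth[OF smooth_on_const]]
        smooth_algebra.add smooth_algebra.gen open_UNIV rangeI)+
  then show "\<exists>g\<in>smooth_algebra UNIV (range flat). \<forall>x\<in>UNIV. frechet_derivative f (at x) v = g x"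
    by (rule bexI[rotated]) (use frechet_derivative_real[OF has_real_derivative_flat] n in simp)
qed (auto intro: smooth_algebra.gen)

lemma smooth_on_bump: "smooth_on UNIV (\<lambda>t::real. flat 0 (t - p) * flat 0 (q - t))"
proof -
  have "smooth_on UNIV (\<lambda>t::real. of_real (flat 0 (t - p)) * of_real (flat 0 (q - t)) :: real)"
    by (intro smooth_on_mult smooth_on_compose_real smooth_on_flat open_UNIV smooth_on_diff
        smooth_on_const smooth_on_bounded_linear bounded_linear_ident)
  then show ?thesis by simp
qed

text \<open>The normalised tail integral of a bump on (p, q): 1 to the left of \<open>p\<close>, and
  0 to the right of \<open>q\<close>, where the interval of integration is empty. Its derivative
  \<open>cutoff'\<close> is given in closed form, so that sign and support can be read off.\<close>

definition cutoff :: "real \<Rightarrow> real \<Rightarrow> real \<Rightarrow> real" where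
  "cutoff p q t = integral {t..q} (\<lambda>t. flat 0 (t - p) * flat 0 (q - t)) /
     integral {p..q} (\<lambda>t. flat 0 (t - p) * flat 0 (q - t))"

definition cutoff' :: "real \<Rightarrow> real \<Rightarrow> real \<Rightarrow> real" where
  "cutoff' p q t = - (flat 0 (t - p) * flat 0 (q - t)) /
     integral {p..q} (\<lambda>t. flat 0 (t - p) * flat 0 (q - t))"

lemma bump_integral:
  fixes p q :: real
  assumes "p < q"
  shows "integral {p..q} (\<lambda>t. flat 0 (t - p) * flat 0 (q - t)) > 0"
proof -
  let ?b = "\<lambda>t. flat 0 (t - p) * flat 0 (q - t)"
  have c: "continuous_on {p..q} ?b"
    by (rule continuous_on_subset[OF smooth_on_imp_continuous_on[OF smooth_on_bump]]) auto
  have "integral {p..q} ?b \<noteq> 0"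
  proof
    assume "integral {p..q} ?b = 0"
    then have "\<forall>t\<in>{p..q}. ?b t = 0"
      by (subst (asm) integral_eq_0_iff[OF c assms])
        (auto simp: flat_def)
    then have "?b ((p + q) / 2) = 0"
      by (rule bspec) (use assms in auto)
    with assms show False by (simp add: flat_def field_simps split: if_splits)
  qed
  moreover have "integral {p..q} ?b \<ge> 0"
    by (rule integral_nonneg[OF integrable_continuous_real[OF c]]) (simp add: flat_def)
  ultimately show ?thesis by simp
qed

lemma cutoff_eq_1: "p < q \<Longrightarrow> t \<le> p \<Longrightarrow> cutoff p q t = 1"
proof -
  assume pq: "p < q" "t \<le> p"
  let ?b = "\<lambda>t. flat 0 (t - p) * flat 0 (q - t)"
  have "?b integrable_on {t..q}"
    by (intro integrable_continuous_real continuous_on_subset[OF smooth_on_imp_continuous_on[OF smooth_on_bump]]) auto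
  then have "integral {t..p} ?b + integral {p..q} ?b = integral {t..q} ?b"
    using pq by (intro Henstock_Kurzweil_Integration.integral_combine) auto
  moreover have "integral {t..p} ?b = integral {t..p} (\<lambda>_. 0)"
    by (rule Henstock_Kurzweil_Integration.integral_cong) (auto simp: flat_def)
  ultimately show ?thesis using bump_integral[OF pq(1)] by (simp add: cutoff_def)
qed

lemma cutoff_eq_0: "q \<le> t \<Longrightarrow> cutoff p q t = 0"
  by (cases "q = t") (auto simp: cutoff_def)

lemma cutoff'_eq_0: "t \<le> p \<or> q \<le> t \<Longrightarrow> cutoff' p q t = 0"
  by (auto simp: cutoff'_def flat_def)

lemma cutoff'_le_0: "p < q \<Longrightarrow> cutoff' p q t \<le> 0"
  using bump_integral[of p q] by (simp add: cutoff'_def flat_def)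

lemma cutoff'_less_0: "p < t \<Longrightarrow> t < q \<Longrightarrow> cutoff' p q t < 0"
  using bump_integral[of p q] by (simp add: cutoff'_def flat_def)

lemma has_real_derivative_cutoff:
  assumes "p < q"
  shows "(cutoff p q has_real_derivative cutoff' p q t) (at t)"
proof -
  let ?b = "\<lambda>t. flat 0 (t - p) * flat 0 (q - t)" and ?I = "integral {p..q} (\<lambda>t. flat 0 (t - p) * flat 0 (q - t))"
  \<comment> \<open>The interval from \<open>a\<close> to \<open>b\<close> contains \<open>p\<close>
    and \<open>q\<close>, and \<open>t\<close> in its interior, so that near \<open>t\<close> the
    tail integral is a constant minus an integral with fixed lower limit.\<close>
  define a where "a = min p t - 1"
  define b where "b = max q t + 1"
  have c: "continuous_on S ?b" for S
    by (rule continuous_on_subset[OF smooth_on_imp_continuous_on[OF smooth_on_bump]]) auto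
  have "((\<lambda>u. integral {a..u} ?b) has_real_derivative ?b t) (at t within {a..b})"
    by (rule integral_has_real_derivative[OF c]) (auto simp: a_def b_def)
  then have "((\<lambda>u. integral {a..u} ?b) has_real_derivative ?b t) (at t within {a<..<b})"
    by (rule DERIV_subset) auto
  then have *: "((\<lambda>u. integral {a..u} ?b) has_real_derivative ?b t) (at t)"
    by (subst (asm) at_within_open) (auto simp: a_def b_def)
  have "((\<lambda>u. (integral {a..b} ?b - integral {a..u} ?b) / ?I) has_real_derivative cutoff' p q t) (at t)"
    using bump_integral[OF assms] unfolding cutoff'_def by (auto intro!: derivative_eq_intros *)
  then show ?thesis
  proof (rule has_field_derivative_transform_within_open[of _ _ _ "{a<..<b}"])
    fix u assume u: "u \<in> {a<..<b}"
    have i: "?b integrable_on {x..y}" for x y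
      by (intro integrable_continuous_real c)
    have "integral {a..u} ?b + integral {u..b} ?b = integral {a..b} ?b"
      using u i by (intro Henstock_Kurzweil_Integration.integral_combine) auto
    moreover have "integral {u..b} ?b = integral {u..q} ?b"
    proof (cases "u \<le> q")
      case True
      have "integral {u..q} ?b + integral {q..b} ?b = integral {u..b} ?b"
        using True i by (intro Henstock_Kurzweil_Integration.integral_combine) (auto simp: b_def)
      moreover have "integral {q..b} ?b = integral {q..b} (\<lambda>_. 0)"
        by (rule Henstock_Kurzweil_Integration.integral_cong) (auto simp: flat_def)
      ultimately show ?thesis by simp
    next
      case False
      have "integral {u..b} ?b = integral {u..b} (\<lambda>_. 0)"
        by (rule Henstock_Kurzweil_Integration.integral_cong) (use False in \<open>auto simp: flat_def\<close>)
      then show ?thesis using False by simp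
    qed
    ultimately have "integral {u..q} ?b = integral {a..b} ?b - integral {a..u} ?b" by linarith
    then show "(integral {a..b} ?b - integral {a..u} ?b) / ?I = cutoff p q u"
      unfolding cutoff_def by simp
  qed (auto simp: a_def b_def)
qed

lemma smooth_on_cutoff': "smooth_on UNIV (cutoff' p q)"
proof -
  have "smooth_on UNIV (\<lambda>t. - inverse (integral {p..q} (\<lambda>t. flat 0 (t - p) * flat 0 (q - t))) *
      (flat 0 (t - p) * flat 0 (q - t)))"
    by (intro smooth_on_mult smooth_on_const smooth_on_bump open_UNIV)
  then show ?thesis by (simp add: cutoff'_def[abs_def] divide_inverse mult_ac)
qed

lemma smooth_on_cutoff:
  assumes "p < q"
  shows "smooth_on UNIV (cutoff p q)"
proof (rule smooth_on_coinduct[OF open_UNIV, of _ "insert (cutoff p q) (Collect (smooth_on UNIV))"])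
  let ?S = "insert (cutoff p q) (Collect (smooth_on UNIV))"
  show "f differentiable (at x)" if "f \<in> ?S" for f x
    using that has_real_derivative_cutoff[OF assms] real_differentiable_def smooth_on_imp_differentiable
    by blast
  fix f v assume f: "f \<in> ?S"
  show "\<exists>g\<in>?S. \<forall>x\<in>UNIV. frechet_derivative f (at x) v = g x"
  proof (cases "smooth_on UNIV f")
    case True
    then show ?thesis
      by (intro bexI[of _ "\<lambda>x. frechet_derivative f (at x) v"]) (auto intro: smooth_on_frechet_derivative)
  next
    case False
    then have "f = cutoff p q" using f by simp
    then show ?thesis
      using frechet_derivative_real[OF has_real_derivative_cutoff[OF assms]]
      by (intro bexI[of _ "\<lambda>t. v * cutoff' p q t"])
        (auto intro!: smooth_on_mult smooth_on_const smooth_on_cutoff')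
  qed
qed auto


section \<open>Integrals of compactly supported functions\<close>

lemma integrable_lborel_compact_support:
  fixes F :: "'a::euclidean_space \<Rightarrow> 'b::{banach, second_countable_topology}"
  assumes "continuous_on UNIV F" "compact K" "\<And>x. x \<notin> K \<Longrightarrow> F x = 0"
  shows "integrable lborel F"
proof -
  have "integrable lborel (\<lambda>x. indicator K x *\<^sub>R F x)"
    by (rule borel_integrable_compact[OF assms(2) continuous_on_subset[OF assms(1)]]) simp
  also have "(\<lambda>x. indicator K x *\<^sub>R F x) = F"
    using assms(3) by (auto simp: indicator_def)
  finally show ?thesis .
qed

lemma norm_integral_lborel_le:
  fixes F :: "'a::euclidean_space \<Rightarrow> 'b::{banach, second_countable_topology}"
  assumes "continuous_on UNIV F" "compact K" "\<And>x. x \<notin> K \<Longrightarrow> F x = 0"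
    and "\<And>x. x \<in> K \<Longrightarrow> norm (F x) \<le> M"
  shows "norm (integral\<^sup>L lborel F) \<le> M * measure lborel K"
proof -
  have "norm (integral\<^sup>L lborel F) \<le> (\<integral>x. M * indicator K x \<partial>lborel)"
  proof (rule Bochner_Integration.integral_norm_bound_integral)
    show "integrable lborel F" by (rule integrable_lborel_compact_support) fact+
    show "integrable lborel (\<lambda>x. M * indicator K x)"
      using emeasure_compact_finite[OF assms(2)] assms(2)
      by (intro integrable_mult_right integrable_real_indicator) (auto intro: borel_compact)
  qed (use assms in \<open>auto simp: indicator_def\<close>)
  then show ?thesis by simp
qed

lemma integral_lborel_pos:
  fixes F :: "'a::euclidean_space \<Rightarrow> real"
  assumes "continuous_on UNIV F" "compact K" "\<And>x. x \<notin> K \<Longrightarrow> F x = 0"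
    and "\<And>x. F x \<ge> 0" "F x0 > 0"
  shows "integral\<^sup>L lborel F > 0"
proof -
  have int: "integrable lborel F"
    by (rule integrable_lborel_compact_support) fact+
  have "integral\<^sup>L lborel F \<noteq> 0"
  proof
    assume "integral\<^sup>L lborel F = 0"
    then have "AE x in lborel. F x = 0"
      using integral_nonneg_eq_0_iff_AE[OF int] assms by simp
    \<comment> \<open>The zero set is closed and of full measure, hence everything.\<close>
    then have "AE x in lebesgue. x \<in> {x. F x = 0}"
      using AE_completion by auto
    moreover have "closed {x. F x = 0}"
      by (intro closed_Collect_eq assms continuous_on_const)
    ultimately have "x0 \<in> {x. F x = 0}"
      by (intro mem_closed_if_AE_lebesgue)
    with assms show False by simp
  qed
  moreover have "integral\<^sup>L lborel F \<ge> 0" using assms by simp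
  ultimately show ?thesis by simp
qed

lemma integral_lborel_translate:
  fixes F :: "'a::euclidean_space \<Rightarrow> 'b::{banach, second_countable_topology}"
  assumes "continuous_on UNIV F"
  shows "(\<integral>x. F (c + x) \<partial>lborel) = integral\<^sup>L lborel F"
proof -
  have "integral\<^sup>L lborel F = integral\<^sup>L (distr lborel borel ((+) c)) F"
    by (simp add: lborel_distr_plus)
  also have "\<dots> = (\<integral>x. F (c + x) \<partial>lborel)"
    using assms by (intro integral_distr) (auto intro: borel_measurable_continuous_onI)
  finally show ?thesis by simp
qed

lemma frechet_derivative_eq_0:
  assumes "closed K" "\<And>x. x \<notin> K \<Longrightarrow> F x = 0" "x \<notin> K"
  shows "frechet_derivative F (at x) v = 0"
  using frechet_derivative_cong_open[of "- K" x F "\<lambda>_. 0"] assms by (simp add: open_Compl)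

text \<open>By translation invariance, the difference quotients have integral zero.\<close>

lemma integral_frechet_derivative_eq_0:
  fixes F :: "'a::euclidean_space \<Rightarrow> 'b::euclidean_space"
  assumes diff: "\<And>x. F differentiable (at x)"
    and cont: "continuous_on UNIV (\<lambda>x. frechet_derivative F (at x) e)"
    and K: "compact K" "\<And>x. x \<notin> K \<Longrightarrow> F x = 0"
  shows "(\<integral>x. frechet_derivative F (at x) e \<partial>lborel) = 0"
proof -
  let ?D = "\<lambda>x. frechet_derivative F (at x) e"
  have contF: "continuous_on UNIV F"
    by (meson continuous_at_imp_continuous_on differentiable_imp_continuous_within diff)
  have "bounded (?D ` K)"
    by (intro compact_imp_bounded compact_continuous_image K continuous_on_subset[OF cont]) auto
  then obtain M where M: "norm (?D x) \<le> M" if "x \<in> K" for x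
    unfolding bounded_iff by blast
  define B where "B = max M 0"
  have B: "norm (?D x) \<le> B" for x
    using M[of x] frechet_derivative_eq_0[where F=F and x=x and v=e, OF compact_imp_closed[OF K(1)] K(2)]
    by (cases "x \<in> K") (auto simp: B_def)
  have der: "((\<lambda>t. F (t *\<^sub>R e + x)) has_vector_derivative ?D (t *\<^sub>R e + x)) (at t within S)" for t x S
  proof -
    have "((\<lambda>t. F (t *\<^sub>R e + x)) has_derivative
        (\<lambda>h. frechet_derivative F (at (t *\<^sub>R e + x)) (h *\<^sub>R e))) (at t within S)"
      by (rule has_derivative_compose[OF _ iffD1[OF frechet_derivative_works diff]])
        (auto intro!: derivative_eq_intros)
    then show ?thesis
      by (simp add: has_vector_derivative_def linear_scale[OF linear_frechet_derivative[OF diff]])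
  qed
  define s where "s n x = real (Suc n) *\<^sub>R (F (inverse (real (Suc n)) *\<^sub>R e + x) - F x)" for n x
  \<comment> \<open>\<open>K\<close> swept along \<open>- e\<close>. It contains the supports of all
    difference quotients \<open>s n\<close>, whose step is at most 1, and so carries an integrable
    dominating function.\<close>
  define K' where "K' = (\<lambda>(t, x). x - t *\<^sub>R e) ` ({0..1::real} \<times> K)"
  have K': "compact K'"
    unfolding K'_def
    by (intro compact_continuous_image compact_Times K compact_Icc)
      (auto simp: case_prod_unfold intro!: continuous_intros)
  have contS: "continuous_on UNIV (s n)" for n
    unfolding s_def by (intro continuous_intros continuous_on_compose2[OF contF]) auto
  have "(\<lambda>n. integral\<^sup>L lborel (s n)) \<longlonglongrightarrow> integral\<^sup>L lborel ?D"
  proof (rule integral_dominated_convergence[where w="\<lambda>x. B * indicator K' x"])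
    show "?D \<in> borel_measurable lborel"
      using cont by (simp add: borel_measurable_continuous_onI)
    show "s n \<in> borel_measurable lborel" for n
      using contS by (simp add: borel_measurable_continuous_onI)
    show "integrable lborel (\<lambda>x. B * indicator K' x)"
      using emeasure_compact_finite[OF K'] K'
      by (intro integrable_mult_right integrable_real_indicator) (auto intro: borel_compact)
    show "AE x in lborel. (\<lambda>n. s n x) \<longlonglongrightarrow> ?D x"
    proof (rule AE_I2)
      fix x
      have "((\<lambda>h. inverse h *\<^sub>R (F (h *\<^sub>R e + x) - F x)) \<longlongrightarrow> ?D x) (at 0)"
      proof -
        have "((\<lambda>h. norm (F (h *\<^sub>R e + x) - F x - h *\<^sub>R ?D x) / norm h) \<longlongrightarrow> 0) (at 0)"
          using der[of x 0 UNIV] by (simp add: has_vector_derivative_def has_derivative_at)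
        then have "((\<lambda>h. norm (inverse h *\<^sub>R (F (h *\<^sub>R e + x) - F x) - ?D x)) \<longlongrightarrow> 0) (at 0)"
        proof (rule Lim_transform_eventually)
          have "norm (F (h *\<^sub>R e + x) - F x - h *\<^sub>R ?D x) / norm h
              = norm (inverse h *\<^sub>R (F (h *\<^sub>R e + x) - F x) - ?D x)" if "h \<noteq> 0" for h
          proof -
            have "inverse h *\<^sub>R (F (h *\<^sub>R e + x) - F x) - ?D x
                = inverse h *\<^sub>R (F (h *\<^sub>R e + x) - F x - h *\<^sub>R ?D x)"
              using that by (simp add: scaleR_diff_right)
            then show ?thesis by (simp add: divide_inverse)
          qed
          then show "\<forall>\<^sub>F h in at 0. norm (F (h *\<^sub>R e + x) - F x - h *\<^sub>R ?D x) / norm h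
              = norm (inverse h *\<^sub>R (F (h *\<^sub>R e + x) - F x) - ?D x)"
            by (auto simp: eventually_at_filter)
        qed
        then show ?thesis using tendsto_norm_zero_iff LIM_zero_cancel by blast
      qed
      moreover have "filterlim (\<lambda>n. inverse (real (Suc n))) (at 0) sequentially"
        using LIMSEQ_inverse_real_of_nat by (auto simp: filterlim_at)
      ultimately have "(\<lambda>n. inverse (inverse (real (Suc n))) *\<^sub>R (F (inverse (real (Suc n)) *\<^sub>R e + x) - F x))
          \<longlonglongrightarrow> ?D x"
        by (rule filterlim_compose)
      then show "(\<lambda>n. s n x) \<longlonglongrightarrow> ?D x" by (simp add: s_def)
    qed
    show "AE x in lborel. norm (s n x) \<le> B * indicator K' x" for n
    proof (rule AE_I2)
      fix x
      let ?t = "inverse (real (Suc n))"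
      have t: "0 \<le> ?t" "?t \<le> 1" by (auto simp: field_simps)
      show "norm (s n x) \<le> B * indicator K' x"
      proof (cases "x \<in> K'")
        case True
        have "norm (F (?t *\<^sub>R e + x) - F (0 *\<^sub>R e + x)) \<le> B * norm (?t - 0)"
        proof (rule differentiable_bound[of UNIV])
          show "((\<lambda>t. F (t *\<^sub>R e + x)) has_derivative (\<lambda>h. h *\<^sub>R ?D (t *\<^sub>R e + x))) (at t within UNIV)" for t
            using der[of x t UNIV] by (simp add: has_vector_derivative_def)
          show "onorm (\<lambda>h. h *\<^sub>R ?D (t *\<^sub>R e + x)) \<le> B" for t :: real
            by (rule onorm_le) (use B mult_left_mono[OF B abs_ge_zero] in \<open>auto simp: mult.commute[of B]\<close>)
        qed auto
        then have "norm (s n x) \<le> real (Suc n) * (B * ?t)"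
          using t unfolding s_def norm_scaleR by (intro mult_mono) auto
        moreover have "real (Suc n) * (B * ?t) = B" by simp
        ultimately show ?thesis using True by (simp del: of_nat_Suc)
      next
        case False
        have "x \<notin> K"
          using False unfolding K'_def by (force intro!: image_eqI[of _ _ "(0, x)"])
        moreover have "?t *\<^sub>R e + x \<notin> K"
          using False t unfolding K'_def by (force intro!: image_eqI[of _ _ "(?t, ?t *\<^sub>R e + x)"])
        ultimately show ?thesis using K(2) False by (simp add: s_def)
      qed
    qed
  qed
  moreover have "(\<lambda>n. integral\<^sup>L lborel (s n)) = (\<lambda>n. 0)"
  proof -
    have i: "integrable lborel F" by (rule integrable_lborel_compact_support[OF contF K])
    have "integrable lborel (\<lambda>x. F (c + x))" for c
    proof (rule integrable_lborel_compact_support)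
      show "continuous_on UNIV (\<lambda>x. F (c + x))"
        by (intro continuous_on_compose2[OF contF] continuous_intros) auto
      show "compact ((\<lambda>x. x - c) ` K)"
        by (intro compact_continuous_image K continuous_intros)
      show "F (c + x) = 0" if "x \<notin> (\<lambda>x. x - c) ` K" for x
        using that by (intro K(2)) (force intro!: image_eqI[of _ _ "c + x"])
    qed
    then show ?thesis
      unfolding s_def using integral_lborel_translate[OF contF] i by simp
  qed
  ultimately show ?thesis by (simp add: LIMSEQ_const_iff)
qed


section \<open>Geometric sequences of smooth functions\<close>

text \<open>Families that are polynomial in the index \<open>N\<close> with coefficients smooth in
  the variable. The factor \<open>N\<close> is the one produced by differentiating an
  \<open>N\<close>-th power.\<close>

inductive_set poly_families ::
    "'a::real_normed_vector set \<Rightarrow> (nat \<Rightarrow> 'a \<Rightarrow> 'b::real_normed_field) set"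
  for U where
  one: "(\<lambda>N x. 1) \<in> poly_families U"
| smooth_mult: "smooth_on U Q \<Longrightarrow> P \<in> poly_families U \<Longrightarrow> (\<lambda>N x. Q x * P N x) \<in> poly_families U"
| nat_mult: "P \<in> poly_families U \<Longrightarrow> (\<lambda>N x. of_nat N * P N x) \<in> poly_families U"
| add: "P \<in> poly_families U \<Longrightarrow> P' \<in> poly_families U \<Longrightarrow> (\<lambda>N x. P N x + P' N x) \<in> poly_families U"

lemma smooth_on_poly_families:
  assumes "open U" "P \<in> poly_families U"
  shows "smooth_on U (P N)"
  using assms(2)
  by (induction arbitrary: N rule: poly_families.induct)
    (auto intro!: smooth_on_mult smooth_on_add assms(1))

lemma frechet_derivative_add:
  assumes "f differentiable (at x)" "g differentiable (at x)"
  shows "frechet_derivative (\<lambda>x. f x + g x) (at x) v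
    = frechet_derivative f (at x) v + frechet_derivative g (at x) v"
  using frechet_derivative_at[OF has_derivative_add[OF assms[unfolded frechet_derivative_works]]]
  by metis

lemma frechet_derivative_mult:
  fixes f g :: "'a::real_normed_vector \<Rightarrow> 'b::real_normed_algebra"
  assumes "f differentiable (at x)" "g differentiable (at x)"
  shows "frechet_derivative (\<lambda>x. f x * g x) (at x) v
    = f x * frechet_derivative g (at x) v + frechet_derivative f (at x) v * g x"
  using frechet_derivative_at[OF has_derivative_mult[OF assms[unfolded frechet_derivative_works]]]
  by metis

lemma poly_families_derivative:
  assumes U: "open U" and "P \<in> poly_families U"
  shows "\<exists>P'\<in>poly_families U. \<forall>N. \<forall>x\<in>U. frechet_derivative (P N) (at x) v = P' N x"
  using assms(2)
proof (induction rule: poly_families.induct)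
  case one
  show ?case
    by (rule bexI[OF _ poly_families.smooth_mult[OF smooth_on_const[OF U] poly_families.one, of 0]]) simp
next
  case (smooth_mult Q P)
  then obtain P' where P': "P' \<in> poly_families U"
    "\<forall>N. \<forall>x\<in>U. frechet_derivative (P N) (at x) v = P' N x" by blast
  show ?case
  proof (rule bexI)
    show "(\<lambda>N x. Q x * P' N x + frechet_derivative Q (at x) v * P N x) \<in> poly_families U"
      by (intro poly_families.add poly_families.smooth_mult smooth_on_frechet_derivative smooth_mult P')
    show "\<forall>N. \<forall>x\<in>U. frechet_derivative (\<lambda>x. Q x * P N x) (at x) v =
        Q x * P' N x + frechet_derivative Q (at x) v * P N x"
      using P' smooth_on_imp_differentiable[OF smooth_mult(1)]
        smooth_on_imp_differentiable[OF smooth_on_poly_families[OF U smooth_mult(2)]]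
      by (simp add: frechet_derivative_mult)
  qed
next
  case (nat_mult P)
  then obtain P' where P': "P' \<in> poly_families U"
    "\<forall>N. \<forall>x\<in>U. frechet_derivative (P N) (at x) v = P' N x" by blast
  show ?case
    by (rule bexI[OF _ poly_families.nat_mult[OF P'(1)]])
      (use P' smooth_on_imp_differentiable[OF smooth_on_poly_families[OF U nat_mult(1)]]
       in \<open>simp add: frechet_derivative_mult\<close>)
next
  case (add P Q)
  then obtain P' Q' where P': "P' \<in> poly_families U"
      "\<forall>N. \<forall>x\<in>U. frechet_derivative (P N) (at x) v = P' N x"
    and Q': "Q' \<in> poly_families U"
      "\<forall>N. \<forall>x\<in>U. frechet_derivative (Q N) (at x) v = Q' N x" by blast
  show ?case
    by (rule bexI[OF _ poly_families.add[OF P'(1) Q'(1)]])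
      (use P' Q' smooth_on_imp_differentiable[OF smooth_on_poly_families[OF U add(1)]]
         smooth_on_imp_differentiable[OF smooth_on_poly_families[OF U add(2)]]
       in \<open>simp add: frechet_derivative_add\<close>)
qed

lemma poly_families_bound:
  assumes "open U" "compact K" "K \<subseteq> U" "P \<in> poly_families U"
  shows "\<exists>C m. \<forall>N. \<forall>x\<in>K. norm (P N x) \<le> C * (real N + 1) ^ m"
  using assms(4)
proof (induction rule: poly_families.induct)
  case one
  show ?case by (rule exI[of _ 1], rule exI[of _ 0]) simp
next
  case (smooth_mult Q P)
  then obtain C m where C: "\<And>N x. x \<in> K \<Longrightarrow> norm (P N x) \<le> C * (real N + 1) ^ m" by blast
  have "bounded (Q ` K)"
    by (intro compact_imp_bounded compact_continuous_image assms
        continuous_on_subset[OF smooth_on_imp_continuous_on[OF smooth_mult(1)]])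
  then obtain D where D: "\<And>x. x \<in> K \<Longrightarrow> norm (Q x) \<le> D" unfolding bounded_iff by blast
  have "norm (Q x * P N x) \<le> D * C * (real N + 1) ^ m" if "x \<in> K" for N x
    using mult_mono[OF D[OF that] C[OF that, of N]] order_trans[OF norm_ge_zero D[OF that]]
    by (simp add: norm_mult mult.assoc)
  then show ?case by blast
next
  case (nat_mult P)
  then obtain C m where C: "\<And>N x. x \<in> K \<Longrightarrow> norm (P N x) \<le> C * (real N + 1) ^ m" by blast
  have "norm (of_nat N * P N x) \<le> C * (real N + 1) ^ Suc m" if "x \<in> K" for N x
    using mult_mono[OF _ C[OF that, of N], of "real N" "real N + 1"] by (simp add: norm_mult mult_ac)
  then show ?case by blast
next
  case (add P Q)
  then obtain C m D n where C: "\<And>N x. x \<in> K \<Longrightarrow> norm (P N x) \<le> C * (real N + 1) ^ m"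
    and D: "\<And>N x. x \<in> K \<Longrightarrow> norm (Q N x) \<le> D * (real N + 1) ^ n" by blast
  have "norm (P N x + Q N x) \<le> (\<bar>C\<bar> + \<bar>D\<bar>) * (real N + 1) ^ (m + n)" if "x \<in> K" for N x
  proof -
    have "C * (real N + 1) ^ m \<le> \<bar>C\<bar> * (real N + 1) ^ (m + n)"
      by (intro mult_mono power_increasing) auto
    moreover have "D * (real N + 1) ^ n \<le> \<bar>D\<bar> * (real N + 1) ^ (m + n)"
      by (intro mult_mono power_increasing) auto
    ultimately show ?thesis
      using norm_triangle_ineq[of "P N x" "Q N x"] C[OF that, of N] D[OF that, of N]
      by (simp add: distrib_right)
  qed
  then show ?case by blast
qed

text \<open>Every derivative of \<open>Q \<theta>\<^sup>N\<close> is \<open>\<theta>\<^sup>N\<close> times a polynomial in \<open>N\<close> with smooth coefficients.\<close>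

lemma uniform_limit_iter_deriv_geometric:
  fixes Q \<theta> :: "'a::real_normed_vector \<Rightarrow> 'b::real_normed_field"
  assumes U: "open U" and Q: "smooth_on U Q" and \<theta>: "smooth_on U \<theta>"
    and nz: "\<And>x. x \<in> U \<Longrightarrow> \<theta> x \<noteq> 0"
    and K: "compact K" "K \<subseteq> U" and less: "\<And>x. x \<in> K \<Longrightarrow> norm (\<theta> x) < 1"
  shows "uniform_limit K (\<lambda>N. iter_deriv vs (\<lambda>x. Q x * \<theta> x ^ N)) (\<lambda>_. 0) sequentially"
proof -
  have "\<exists>P\<in>poly_families U. \<forall>N. \<forall>x\<in>U. iter_deriv vs (\<lambda>x. Q x * \<theta> x ^ N) x = P N x * \<theta> x ^ N"
  proof (induction vs)
    case Nil
    show ?case by (rule bexI[OF _ poly_families.smooth_mult[OF Q poly_families.one]]) simp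
  next
    case (Cons v vs)
    then obtain P where P: "P \<in> poly_families U"
      "\<And>N x. x \<in> U \<Longrightarrow> iter_deriv vs (\<lambda>x. Q x * \<theta> x ^ N) x = P N x * \<theta> x ^ N" by blast
    obtain P' where P': "P' \<in> poly_families U"
      "\<And>N x. x \<in> U \<Longrightarrow> frechet_derivative (P N) (at x) v = P' N x"
      using poly_families_derivative[OF U P(1)] by blast
    \<comment> \<open>The derivative of the product, divided by the \<open>N\<close>-th power of
      \<theta>. Here N \<theta>^(N-1) is rewritten as N \<theta>^(-1) \<theta>^N, which uses that
      \<theta> has no zero; for \<open>N = 0\<close> both sides vanish because of the factor
      \<open>N\<close>.\<close>
    let ?R = "\<lambda>N x. (frechet_derivative \<theta> (at x) v * inverse (\<theta> x)) * (of_nat N * P N x) + P' N x"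
    show ?case
    proof (rule bexI)
      show "?R \<in> poly_families U"
        by (intro poly_families.add poly_families.smooth_mult poly_families.nat_mult P P'
            smooth_on_mult U smooth_on_frechet_derivative \<theta> smooth_on_inverse nz)
      show "\<forall>N. \<forall>x\<in>U. iter_deriv (v # vs) (\<lambda>x. Q x * \<theta> x ^ N) x = ?R N x * \<theta> x ^ N"
      proof (intro allI ballI)
        fix N x assume x: "x \<in> U"
        have "frechet_derivative (\<lambda>x. \<theta> x ^ N) (at x) v
            = of_nat N * frechet_derivative \<theta> (at x) v * \<theta> x ^ (N - 1)"
          using frechet_derivative_at[OF has_derivative_power[OF smooth_on_has_derivative[OF \<theta> x], of N]]
          by metis
        also have "\<dots> = of_nat N * frechet_derivative \<theta> (at x) v * inverse (\<theta> x) * \<theta> x ^ N"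
          using nz[OF x] by (cases N) auto
        finally have "frechet_derivative (\<lambda>x. P N x * \<theta> x ^ N) (at x) v = ?R N x * \<theta> x ^ N"
          using P'(2)[OF x]
          using frechet_derivative_mult[OF smooth_on_imp_differentiable[OF smooth_on_poly_families[OF U P(1)] x]
              smooth_on_imp_differentiable[OF smooth_on_power[OF U \<theta>] x], of N N v]
          by (simp add: algebra_simps)
        moreover have "iter_deriv (v # vs) (\<lambda>x. Q x * \<theta> x ^ N) x
            = frechet_derivative (\<lambda>x. P N x * \<theta> x ^ N) (at x) v"
          using frechet_derivative_cong_open[OF U x, of "iter_deriv vs (\<lambda>x. Q x * \<theta> x ^ N)"
              "\<lambda>x. P N x * \<theta> x ^ N"] P(2) by simp
        ultimately show "iter_deriv (v # vs) (\<lambda>x. Q x * \<theta> x ^ N) x = ?R N x * \<theta> x ^ N" by simp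
      qed
    qed
  qed
  then obtain P where P: "P \<in> poly_families U"
    "\<And>N x. x \<in> U \<Longrightarrow> iter_deriv vs (\<lambda>x. Q x * \<theta> x ^ N) x = P N x * \<theta> x ^ N" by blast
  obtain C m where C: "\<And>N x. x \<in> K \<Longrightarrow> norm (P N x) \<le> C * (real N + 1) ^ m"
    using poly_families_bound[OF U K P(1)] by blast
  \<comment> \<open>The norm of \<theta> attains its maximum on \<open>K\<close>, hence a uniform
    ratio below 1, which beats the polynomial growth in \<open>N\<close>.\<close>
  obtain r where r: "0 < r" "r < 1" "\<And>x. x \<in> K \<Longrightarrow> norm (\<theta> x) \<le> r"
  proof (cases "K = {}")
    case True then show ?thesis using that[of "1/2"] by auto
  next
    case False
    have "continuous_on K (\<lambda>x. norm (\<theta> x))"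
      by (intro continuous_intros continuous_on_subset[OF smooth_on_imp_continuous_on[OF \<theta>] K(2)])
    then obtain y where y: "y \<in> K" "\<And>x. x \<in> K \<Longrightarrow> norm (\<theta> x) \<le> norm (\<theta> y)"
      using continuous_attains_sup[OF K(1) False] by blast
    then show ?thesis using that[of "norm (\<theta> y)"] less nz K by auto
  qed
  have lim: "(\<lambda>N. C * (real N + 1) ^ m * r ^ N) \<longlonglongrightarrow> 0"
    using r(1,2) by real_asymp
  show ?thesis
  proof (rule uniform_limitI)
    fix e :: real assume "e > 0"
    have "\<forall>\<^sub>F N in sequentially. C * (real N + 1) ^ m * r ^ N < e"
      using order_tendstoD(2)[OF lim \<open>e > 0\<close>] .
    then show "\<forall>\<^sub>F N in sequentially. \<forall>x\<in>K. dist (iter_deriv vs (\<lambda>x. Q x * \<theta> x ^ N) x) 0 < e"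
    proof eventually_elim
      case (elim N)
      show ?case
      proof
        fix x assume x: "x \<in> K"
        have "norm (P N x * \<theta> x ^ N) \<le> C * (real N + 1) ^ m * r ^ N"
          unfolding norm_mult norm_power
          by (intro mult_mono C power_mono r x order_trans[OF norm_ge_zero C[OF x]]) auto
        with elim show "dist (iter_deriv vs (\<lambda>x. Q x * \<theta> x ^ N) x) 0 < e"
          using P(2) x K by (auto simp: subset_iff)
      qed
    qed
  qed
qed

lemma iter_deriv_add:
  assumes U: "open U" and "smooth_on U f" "smooth_on U g" "x \<in> U"
  shows "iter_deriv vs (\<lambda>x. f x + g x) x = iter_deriv vs f x + iter_deriv vs g x"
  using assms(4)
proof (induction vs arbitrary: x)
  case (Cons v vs)
  then show ?case
    using frechet_derivative_cong_open[OF U Cons.prems, of "iter_deriv vs (\<lambda>x. f x + g x)"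
        "\<lambda>x. iter_deriv vs f x + iter_deriv vs g x"] assms(2,3)
    by (simp add: frechet_derivative_add smooth_on_def)
qed auto

lemma iter_deriv_uminus:
  assumes U: "open U" and "smooth_on U f" "x \<in> U"
  shows "iter_deriv vs (\<lambda>x. - f x) x = - iter_deriv vs f x"
  using assms(3)
proof (induction vs arbitrary: x)
  case (Cons v vs)
  have "frechet_derivative (\<lambda>x. - iter_deriv vs f x) (at x) v = - frechet_derivative (iter_deriv vs f) (at x) v"
    using frechet_derivative_at[OF has_derivative_minus[OF
      smooth_on_has_derivative[OF smooth_on_iter_deriv[OF assms(2)] Cons.prems]]] by metis
  then show ?case
    using frechet_derivative_cong_open[OF U Cons.prems, of "iter_deriv vs (\<lambda>x. - f x)"
        "\<lambda>x. - iter_deriv vs f x"] Cons.IH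
    by simp
qed auto

lemma iter_deriv_diff:
  fixes f g :: "'a::real_normed_vector \<Rightarrow> 'b::real_normed_algebra_1"
  assumes U: "open U" and "smooth_on U f" "smooth_on U g" "x \<in> U"
  shows "iter_deriv vs (\<lambda>x. f x - g x) x = iter_deriv vs f x - iter_deriv vs g x"
  using iter_deriv_add[OF U assms(2) smooth_on_uminus[OF U assms(3)] assms(4), of vs]
    iter_deriv_uminus[OF U assms(3,4), of vs] by simp

lemma iter_deriv_zero [simp]: "iter_deriv vs (\<lambda>x. 0) = (\<lambda>x. 0)"
  by (induction vs) auto

text \<open>Only the part of \<open>K\<close> in the support \<open>C\<close> matters, where the error term is \<open>Q \<theta>\<^sup>N\<close>.\<close>

lemma uniform_limit_iter_deriv_geometric_error:
  fixes f :: "'a::real_normed_vector \<Rightarrow> 'b::real_normed_field"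
  assumes \<Omega>: "open \<Omega>" and f: "smooth_on \<Omega> f" "\<And>N. smooth_on \<Omega> (F N)"
    and C: "closed C" "\<And>N x. x \<in> \<Omega> \<Longrightarrow> x \<notin> C \<Longrightarrow> F N x = f x"
    and U: "open U" "C \<inter> \<Omega> \<subseteq> U" "U \<subseteq> \<Omega>" "smooth_on U Q" "smooth_on U \<theta>"
    and \<theta>: "\<And>x. x \<in> U \<Longrightarrow> \<theta> x \<noteq> 0" "\<And>x. x \<in> U \<Longrightarrow> norm (\<theta> x) < 1"
    and err: "\<And>N x. x \<in> U \<Longrightarrow> F N x - f x = Q x * \<theta> x ^ N"
    and K: "compact K" "K \<subseteq> \<Omega>"
  shows "uniform_limit K (\<lambda>N. iter_deriv vs (F N)) (iter_deriv vs f) sequentially"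
proof -
  have "uniform_limit (K \<inter> C) (\<lambda>N. iter_deriv vs (\<lambda>x. Q x * \<theta> x ^ N)) (\<lambda>_. 0) sequentially"
    by (rule uniform_limit_iter_deriv_geometric[OF U(1,4,5)])
      (use U \<theta> K C(1) compact_Int_closed in auto)
  then show ?thesis
    unfolding uniform_limit_iff
  proof (intro allI impI)
    fix e :: real
    assume lim: "\<forall>e>0. \<forall>\<^sub>F N in sequentially. \<forall>x\<in>K \<inter> C. dist (iter_deriv vs (\<lambda>x. Q x * \<theta> x ^ N) x) 0 < e"
      and "e > 0"
    then have "\<forall>\<^sub>F N in sequentially. \<forall>x\<in>K \<inter> C. dist (iter_deriv vs (\<lambda>x. Q x * \<theta> x ^ N) x) 0 < e"
      by blast
    then show "\<forall>\<^sub>F N in sequentially. \<forall>x\<in>K. dist (iter_deriv vs (F N) x) (iter_deriv vs f x) < e"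
    proof eventually_elim
      case (elim N)
      show ?case
      proof
        fix x assume x: "x \<in> K"
        show "dist (iter_deriv vs (F N) x) (iter_deriv vs f x) < e"
        proof (cases "x \<in> C")
          case True
          then have xU: "x \<in> U" using x K U by blast
          have "iter_deriv vs (\<lambda>x. Q x * \<theta> x ^ N) x = iter_deriv vs (\<lambda>x. F N x - f x) x"
            by (rule iter_deriv_cong_open[OF U(1) _ xU]) (use err in simp)
          also have "\<dots> = iter_deriv vs (F N) x - iter_deriv vs f x"
            by (rule iter_deriv_diff[OF \<Omega>]) (use f x K in auto)
          finally have "dist (iter_deriv vs (F N) x) (iter_deriv vs f x)
              = dist (iter_deriv vs (\<lambda>x. Q x * \<theta> x ^ N) x) 0" by (simp add: dist_norm)
          then show ?thesis using elim True x by auto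
        next
          case False
          have "iter_deriv vs (F N) x = iter_deriv vs f x"
            by (rule iter_deriv_cong_open[of "\<Omega> - C"]) (use \<Omega> C x K False in auto)
          then show ?thesis using \<open>e > 0\<close> by simp
        qed
      qed
    qed
  qed
qed


section \<open>Convergence in the spaces of forms\<close>

lemma limitin_topology_generated_by:
  assumes "x \<in> topspace (topology_generated_by S)"
    and "\<And>B. B \<in> S \<Longrightarrow> x \<in> B \<Longrightarrow> \<forall>\<^sub>F n in F. X n \<in> B"
  shows "limitin (topology_generated_by S) X x F"
  unfolding limitin_def
proof (intro conjI allI impI assms(1), elim conjE)
  fix U assume "openin (topology_generated_by S) U" "x \<in> U"
  then have "generate_topology_on S U" "x \<in> U"
    by (simp_all add: openin_topology_generated_by_iff)
  then show "\<forall>\<^sub>F n in F. X n \<in> U"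
  proof (induction rule: generate_topology_on.induct)
    case (Int a b)
    then show ?case by (auto intro: eventually_conj)
  next
    case (UN K)
    then obtain k where "k \<in> K" "x \<in> k" "\<forall>\<^sub>F n in F. X n \<in> k" by blast
    then show ?case by (auto elim: eventually_mono)
  qed (use assms in auto)
qed

lemma smooth_forms_lincomb:
  assumes "open \<Omega>" "f \<in> smooth_forms \<Omega> p q" "g \<in> smooth_forms \<Omega> p q"
  shows "(\<lambda>I J z. a * f I J z + b * g I J z) \<in> smooth_forms \<Omega> p q"
  using assms(2,3) unfolding smooth_forms_def
  by (auto intro!: smooth_on_add smooth_on_mult smooth_on_const assms(1))

lemma test_forms_lincomb:
  assumes "open \<Omega>" "f \<in> test_forms \<Omega> p q" "g \<in> test_forms \<Omega> p q"
  shows "(\<lambda>I J z. a * f I J z + b * g I J z) \<in> test_forms \<Omega> p q"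
proof -
  obtain K L where K: "compact K" "K \<subseteq> \<Omega>" "f \<in> forms_vanishing_off K"
    and L: "compact L" "L \<subseteq> \<Omega>" "g \<in> forms_vanishing_off L"
    using assms unfolding test_forms_def by blast
  have "compact (K \<union> L)" "K \<union> L \<subseteq> \<Omega>" using K L by auto
  moreover have "(\<lambda>I J z. a * f I J z + b * g I J z) \<in> forms_vanishing_off (K \<union> L)"
    using K L by (auto simp: forms_vanishing_off_def)
  ultimately show ?thesis
    using smooth_forms_lincomb[OF assms(1), of f p q g a b] assms(2,3) unfolding test_forms_def by blast
qed

lemma form_diff_eq: "f - g = (\<lambda>I J z. 1 * f I J z + (-1) * g I J z)"
  for f g :: "'n form"
  by (simp add: fun_eq_iff)

lemma form_add_eq: "f + g = (\<lambda>I J z. 1 * f I J z + 1 * g I J z)"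
  for f g :: "'n form"
  by (simp add: fun_eq_iff)

lemma zero_in_smooth_forms: "open \<Omega> \<Longrightarrow> 0 \<in> smooth_forms \<Omega> p q"
  unfolding smooth_forms_def by (auto simp: zero_fun_def)

lemma zero_in_test_forms: "open \<Omega> \<Longrightarrow> 0 \<in> test_forms \<Omega> p q"
  using zero_in_smooth_forms[of \<Omega> p q] unfolding test_forms_def forms_vanishing_off_def
  by (auto intro!: exI[of _ "{}"])

lemma topspace_test_forms_topology:
  assumes "open \<Omega>"
  shows "topspace (test_forms_topology \<Omega> p q) = test_forms \<Omega> p q"
proof
  show "topspace (test_forms_topology \<Omega> p q) \<subseteq> test_forms \<Omega> p q"
    unfolding test_forms_topology_def topology_generated_by_topspace
    using test_forms_lincomb[OF assms, where a=1 and b=1]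
    by (auto simp: form_add_eq subset_iff)
  have "openin (test_forms_topology \<Omega> p q) ((\<lambda>g. 0 + g) ` test_forms \<Omega> p q)"
    unfolding test_forms_topology_def
  proof (rule topology_generated_by_Basis, intro CollectI exI conjI allI impI, rule refl)
    show "absolutely_convex (test_forms \<Omega> p q)"
      unfolding absolutely_convex_def using test_forms_lincomb[OF assms] by blast
    fix K :: "(complex ^ 'a) set" assume K: "compact K \<and> K \<subseteq> \<Omega>"
    have "test_forms \<Omega> p q \<inter> forms_vanishing_off K
        = topspace (subtopology (smooth_forms_topology \<Omega> p q) (forms_vanishing_off K))"
      using K by (auto simp: test_forms_def topspace_smooth_forms_topology)
    then show "openin (subtopology (smooth_forms_topology \<Omega> p q) (forms_vanishing_off K))
        (test_forms \<Omega> p q \<inter> forms_vanishing_off K)"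
      by (metis openin_topspace)
  qed (use zero_in_test_forms[OF assms] in auto)
  then show "test_forms \<Omega> p q \<subseteq> topspace (test_forms_topology \<Omega> p q)"
    using openin_subset by fastforce
qed

lemma limitin_smooth_forms_topology:
  fixes f :: "'n::finite form"
  assumes "open \<Omega>" and f: "f \<in> smooth_forms \<Omega> p q" and F: "\<And>N. F N \<in> smooth_forms \<Omega> p q"
    and lim: "\<And>I J vs K. compact K \<Longrightarrow> K \<subseteq> \<Omega> \<Longrightarrow>
      uniform_limit K (\<lambda>N. iter_deriv vs (F N I J)) (iter_deriv vs (f I J)) sequentially"
  shows "limitin (smooth_forms_topology \<Omega> p q) F f sequentially"
  unfolding smooth_forms_topology_def
proof (rule limitin_topology_generated_by, fold smooth_forms_topology_def)
  show "f \<in> topspace (smooth_forms_topology \<Omega> p q)"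
    by (simp add: topspace_smooth_forms_topology f)
  fix B
  assume "B \<in> {{g \<in> smooth_forms \<Omega> p q.
        \<forall>z\<in>K. norm (iter_deriv vs (g I J) z - iter_deriv vs (f I J) z) < \<epsilon>}
      | f I J vs K \<epsilon>. f \<in> smooth_forms \<Omega> p q \<and> compact K \<and> K \<subseteq> \<Omega> \<and> \<epsilon> > 0}" and "f \<in> B"
  then obtain h I J vs K \<epsilon> where
    B: "B = {g \<in> smooth_forms \<Omega> p q. \<forall>z\<in>K. norm (iter_deriv vs (g I J) z - iter_deriv vs (h I J) z) < \<epsilon>}"
    and h: "h \<in> smooth_forms \<Omega> p q" and K: "compact K" "K \<subseteq> \<Omega>"
    by blast
  have cont: "continuous_on K (iter_deriv vs (g I J))" if "g \<in> smooth_forms \<Omega> p q" for g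
    using that by (intro continuous_on_subset[OF _ K(2)] smooth_on_imp_continuous_on smooth_on_iter_deriv)
      (auto simp: smooth_forms_def)
  have less: "norm (iter_deriv vs (f I J) z - iter_deriv vs (h I J) z) < \<epsilon>" if "z \<in> K" for z
    using \<open>f \<in> B\<close> that by (simp add: B)
  show "\<forall>\<^sub>F N in sequentially. F N \<in> B"
  proof (cases "K = {}")
    case True then show ?thesis using F by (simp add: B)
  next
    case False
    have "continuous_on K (\<lambda>z. norm (iter_deriv vs (f I J) z - iter_deriv vs (h I J) z))"
      by (intro continuous_intros cont f h)
    then obtain y where y: "y \<in> K" "\<And>z. z \<in> K \<Longrightarrow>
        norm (iter_deriv vs (f I J) z - iter_deriv vs (h I J) z)
        \<le> norm (iter_deriv vs (f I J) y - iter_deriv vs (h I J) y)"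
      using continuous_attains_sup[OF K(1) False] by blast
    \<comment> \<open>A subbasic set containing \<open>f\<close> may be centred at another form
      \<open>h\<close>. By compactness of \<open>K\<close> the distance to the centre attains a
      maximum below \<open>\<epsilon>\<close>; \<open>\<delta>\<close> is the slack that
      remains.\<close>
    define \<delta> where "\<delta> = \<epsilon> - norm (iter_deriv vs (f I J) y - iter_deriv vs (h I J) y)"
    have "\<delta> > 0" using less[OF y(1)] by (simp add: \<delta>_def)
    then have "\<forall>\<^sub>F N in sequentially. \<forall>z\<in>K. dist (iter_deriv vs (F N I J) z) (iter_deriv vs (f I J) z) < \<delta>"
      using lim[OF K] by (simp add: uniform_limit_iff)
    then show ?thesis
    proof eventually_elim
      case (elim N)
      have "norm (iter_deriv vs (F N I J) z - iter_deriv vs (h I J) z) < \<epsilon>" if "z \<in> K" for z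
      proof -
        have "norm (iter_deriv vs (F N I J) z - iter_deriv vs (f I J) z) < \<delta>"
          using elim that by (simp add: dist_norm)
        then show ?thesis
          using y(2)[OF that] norm_diff_triangle_ineq[of "iter_deriv vs (F N I J) z" "iter_deriv vs (f I J) z"
              "iter_deriv vs (f I J) z" "iter_deriv vs (h I J) z"]
          by (simp add: \<delta>_def)
      qed
      then show ?case using F by (simp add: B)
    qed
  qed
qed

text \<open>A basic set around \<open>f\<close> has the form \<open>h + W\<close>, so the point of
  \<open>W\<close> to look at is w = f - h. The sequence w + (F N - f) converges to it and keeps its
  support in one compact set, on which the trace of \<open>W\<close> is open.\<close>

lemma limitin_test_forms_topology:
  fixes f :: "'n::finite form"
  assumes \<Omega>: "open \<Omega>" and f: "f \<in> smooth_forms \<Omega> p q" and F: "\<And>N. F N \<in> smooth_forms \<Omega> p q"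
    and L: "compact L" "L \<subseteq> \<Omega>" "f \<in> forms_vanishing_off L" "\<And>N. F N \<in> forms_vanishing_off L"
    and lim: "\<And>I J vs K. compact K \<Longrightarrow> K \<subseteq> \<Omega> \<Longrightarrow>
      uniform_limit K (\<lambda>N. iter_deriv vs (F N I J)) (iter_deriv vs (f I J)) sequentially"
  shows "limitin (test_forms_topology \<Omega> p q) F f sequentially"
  unfolding test_forms_topology_def
proof (rule limitin_topology_generated_by, fold test_forms_topology_def)
  show "f \<in> topspace (test_forms_topology \<Omega> p q)"
    using f L by (auto simp: topspace_test_forms_topology[OF \<Omega>] test_forms_def)
  fix B
  assume "B \<in> {(\<lambda>g. f + g) ` W | f W. f \<in> test_forms \<Omega> p q \<and> W \<subseteq> test_forms \<Omega> p q \<and> absolutely_convex W \<and>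
      (\<forall>K. compact K \<and> K \<subseteq> \<Omega> \<longrightarrow>
        openin (subtopology (smooth_forms_topology \<Omega> p q) (forms_vanishing_off K))
               (W \<inter> forms_vanishing_off K))}" and "f \<in> B"
  then obtain h W where B: "B = (\<lambda>g. h + g) ` W" and W: "W \<subseteq> test_forms \<Omega> p q"
    and op: "\<forall>K. compact K \<and> K \<subseteq> \<Omega> \<longrightarrow>
        openin (subtopology (smooth_forms_topology \<Omega> p q) (forms_vanishing_off K)) (W \<inter> forms_vanishing_off K)"
    by (elim CollectE exE conjE) (rule that)
  obtain w where w: "w \<in> W" "f = h + w" using \<open>f \<in> B\<close> B by blast
  from w W obtain K1 where K1: "compact K1" "K1 \<subseteq> \<Omega>" "w \<in> forms_vanishing_off K1"
    and ws: "w \<in> smooth_forms \<Omega> p q"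
    unfolding test_forms_def by blast
  let ?K = "K1 \<union> L"
  have K: "compact ?K" "?K \<subseteq> \<Omega>" using K1 L by auto
  obtain U where U: "openin (smooth_forms_topology \<Omega> p q) U"
    "W \<inter> forms_vanishing_off ?K = U \<inter> forms_vanishing_off ?K"
    using op K unfolding openin_subtopology by meson
  have wK: "w \<in> forms_vanishing_off ?K" using K1 by (auto simp: forms_vanishing_off_def)
  define G where "G N = (\<lambda>I J z. w I J z + (F N I J z - f I J z))" for N
  have G: "G N \<in> smooth_forms \<Omega> p q" for N
    using smooth_forms_lincomb[OF \<Omega> ws smooth_forms_lincomb[OF \<Omega> F[of N] f, of 1 "-1"], of 1 1]
    by (simp add: G_def)
  have "limitin (smooth_forms_topology \<Omega> p q) G w sequentially"
  proof (rule limitin_smooth_forms_topology[OF \<Omega> ws G])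
    fix I J vs K assume K: "compact K" "K \<subseteq> \<Omega>"
    have sm: "smooth_on \<Omega> (g I J)" if "g \<in> smooth_forms \<Omega> p q" for g
      using that by (simp add: smooth_forms_def)
    have "iter_deriv vs (G N I J) z = iter_deriv vs (w I J) z + (iter_deriv vs (F N I J) z - iter_deriv vs (f I J) z)"
      if "z \<in> K" for N z
    proof -
      have "z \<in> \<Omega>" using that K by blast
      then show ?thesis
        unfolding G_def
        by (simp add: iter_deriv_add[OF \<Omega>] iter_deriv_diff[OF \<Omega>] smooth_on_diff[OF \<Omega>] sm ws F f)
    qed
    then show "uniform_limit K (\<lambda>N. iter_deriv vs (G N I J)) (iter_deriv vs (w I J)) sequentially"
      using lim[OF K, of vs I J] by (simp add: uniform_limit_iff dist_norm)
  qed
  moreover have "w \<in> U" using w wK U by blast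
  ultimately have "\<forall>\<^sub>F N in sequentially. G N \<in> U"
    using U(1) by (simp add: limitin_def)
  then show "\<forall>\<^sub>F N in sequentially. F N \<in> B"
  proof eventually_elim
    case (elim N)
    have "G N \<in> forms_vanishing_off ?K"
      using wK L unfolding G_def forms_vanishing_off_def by auto
    then have "G N \<in> W" using elim U by blast
    moreover have "F N = h + G N" using w by (simp add: G_def fun_eq_iff)
    ultimately show ?case unfolding B by blast
  qed
qed

text \<open>Every \<open>F n\<close> lies in the zero class, so a constant sequence converges both
  to the zero class and to the class of \<open>g\<close>, and these differ because \<open>g\<close>
  is not in \<open>B\<close>.\<close>

lemma not_Hausdorff_cohomology_space:
  assumes B: "0 \<in> B" "\<And>f g. f \<in> B \<Longrightarrow> g \<in> B \<Longrightarrow> f - g \<in> B"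
    and z: "0 \<in> topspace X" "dbar \<Omega> 0 = 0"
    and g: "dbar \<Omega> g = 0" "g \<notin> B"
    and F: "\<And>n. F n \<in> B" "\<And>n. F n \<in> topspace X" "\<And>n. dbar \<Omega> (F n) = 0"
    and lim: "limitin X F g sequentially"
  shows "\<not> Hausdorff_space (cohomology_space \<Omega> X B)"
proof
  assume H: "Hausdorff_space (cohomology_space \<Omega> X B)"
  define Z where "Z = {f \<in> topspace X. dbar \<Omega> f = 0}"
  define r where "r = {(f, g). f \<in> Z \<and> g \<in> Z \<and> f - g \<in> B}"
  have top: "topspace (subtopology X Z) = Z" unfolding Z_def by auto
  have neg: "- f \<in> B" if "f \<in> B" for f
    using B(2)[OF B(1) that] by simp
  have plus: "f + g \<in> B" if "f \<in> B" "g \<in> B" for f g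
    using B(2)[OF that(1) neg[OF that(2)]] by simp
  have eq: "equiv (topspace (subtopology X Z)) r"
    unfolding top
  proof (rule equivI)
    show "r \<subseteq> Z \<times> Z" by (auto simp: r_def)
    show "refl_on Z r" using B(1) by (auto simp: refl_on_def r_def)
    show "sym r"
      using neg by (auto simp: sym_def r_def) (metis minus_diff_eq)
    show "trans r"
    proof (rule transI)
      fix x y w assume "(x, y) \<in> r" "(y, w) \<in> r"
      then show "(x, w) \<in> r" using plus[of "x - y" "y - w"] by (auto simp: r_def)
    qed
  qed
  let ?q = "\<lambda>x. r `` {x}"
  have cs: "cohomology_space \<Omega> X B = quotient_topology (subtopology X Z) r"
    unfolding cohomology_space_def Z_def r_def Let_def by simp
  have FZ: "F n \<in> Z" and gZ: "g \<in> Z" and zZ: "0 \<in> Z" for n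
    using F z g limitin_topspace[OF lim] by (auto simp: Z_def)
  have "limitin (subtopology X Z) F g sequentially"
    using lim FZ gZ by (simp add: limitin_subtopology)
  then have "limitin (cohomology_space \<Omega> X B) (?q \<circ> F) (?q g) sequentially"
    unfolding cs
    by (rule continuous_map_limit[OF quotient_imp_continuous_map[OF quotient_map_quotient_topology[OF eq]]])
  moreover have "?q (F n) = ?q 0" for n
    using F(1)[of n] FZ zZ by (intro equiv_class_eq[OF eq]) (simp add: r_def)
  ultimately have "limitin (cohomology_space \<Omega> X B) (\<lambda>n. ?q 0) (?q g) sequentially"
    by (simp add: o_def)
  moreover have "limitin (cohomology_space \<Omega> X B) (\<lambda>n. ?q 0) (?q 0) sequentially"
    using zZ top unfolding cs
    by (simp add: limitin_const topspace_quotient_topology[OF eq] quotientI)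
  ultimately have "?q g = ?q 0"
    using limitin_Hausdorff_unique[OF _ _ _ H] trivial_limit_sequentially by blast
  then have "(g, 0) \<in> r"
    using eq_equiv_class[OF _ eq] zZ top by blast
  with g show False by (simp add: r_def)
qed

section \<open>Calculus of the Cauchy-Riemann operators\<close>

text \<open>Differentiability is carried along with the value, as in \<open>has_derivative\<close>,
  because the sum and product rules for the total function \<open>d_zbar\<close> ask for it.\<close>

definition has_dzbar :: "'n::finite \<Rightarrow> (complex ^ 'n \<Rightarrow> complex) \<Rightarrow> complex \<Rightarrow> complex ^ 'n \<Rightarrow> bool" where
  "has_dzbar j f D x \<longleftrightarrow> f differentiable (at x) \<and> d_zbar j f x = D"

lemma d_zbar_eq:
  assumes "(f has_derivative f') (at x)"
  shows "d_zbar j f x = (f' (axis j 1) + \<i> * f' (axis j \<i>)) / 2"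
  using frechet_derivative_at[OF assms] by (simp add: d_zbar_def)

lemma has_dzbarI:
  assumes "(f has_derivative f') (at x)" "(f' (axis j 1) + \<i> * f' (axis j \<i>)) / 2 = D"
  shows "has_dzbar j f D x"
  using assms(1) d_zbar_eq[OF assms(1), of j, unfolded assms(2)]
  unfolding has_dzbar_def differentiable_def by blast

lemma has_dzbar_eq_rhs: "has_dzbar j f D x \<Longrightarrow> D = E \<Longrightarrow> has_dzbar j f E x"
  by simp

lemma has_dzbar_const: "has_dzbar j (\<lambda>x. c) 0 x"
  by (rule has_dzbarI[OF has_derivative_const]) simp

lemma has_dzbar_add:
  assumes "has_dzbar j f D x" "has_dzbar j g E x"
  shows "has_dzbar j (\<lambda>x. f x + g x) (D + E) x"
  using assms unfolding has_dzbar_def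
  by (auto simp: d_zbar_def frechet_derivative_add algebra_simps add_divide_distrib)

lemma has_dzbar_mult:
  assumes "has_dzbar j f D x" "has_dzbar j g E x"
  shows "has_dzbar j (\<lambda>x. f x * g x) (D * g x + f x * E) x"
  using assms unfolding has_dzbar_def
  by (auto simp: d_zbar_def frechet_derivative_mult add_divide_distrib algebra_simps)

lemma has_dzbar_uminus: "has_dzbar j f D x \<Longrightarrow> has_dzbar j (\<lambda>x. - f x) (- D) x"
  using has_dzbar_mult[OF has_dzbar_const[of j "-1" x], of f D] by simp

lemma has_dzbar_diff:
  assumes "has_dzbar j f D x" "has_dzbar j g E x"
  shows "has_dzbar j (\<lambda>x. f x - g x) (D - E) x"
  using has_dzbar_add[OF assms(1) has_dzbar_uminus[OF assms(2)]] by simp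

lemma has_dzbar_cong_open:
  assumes "open U" "x \<in> U" "\<And>y. y \<in> U \<Longrightarrow> f y = g y" "has_dzbar j f D x"
  shows "has_dzbar j g D x"
  using assms(4) differentiable_cong_open[OF assms(1-3)] frechet_derivative_cong_open[OF assms(1-3)]
  unfolding has_dzbar_def d_zbar_def by simp

text \<open>The derivative is multiplication by a complex number, and h' + i (i h') = 0.\<close>

lemma has_dzbar_holomorphic:
  assumes "(h has_field_derivative h') (at (x $ i))"
  shows "has_dzbar j (\<lambda>x. h (x $ i)) 0 x"
proof (rule has_dzbarI)
  show "((\<lambda>x. h (x $ i)) has_derivative (\<lambda>v. h' * v $ i)) (at x)"
    by (rule has_derivative_compose[where g=h and f="\<lambda>x. x $ i" and x=x, OF _ assms[unfolded has_field_derivative_def]])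
      (rule bounded_linear_imp_has_derivative[OF bounded_linear_vec_nth])
qed (auto simp: axis_def mult.commute[of h'] simp flip: mult.assoc)

lemma has_derivative_norm_component:
  "((\<lambda>x::complex ^ 'n::finite. (norm (x $ i))\<^sup>2) has_derivative
    (\<lambda>v. 2 * (Re (x $ i) * Re (v $ i) + Im (x $ i) * Im (v $ i)))) (at x)"
proof -
  have "((\<lambda>x::complex ^ 'n. (Re (x $ i))\<^sup>2 + (Im (x $ i))\<^sup>2) has_derivative
      (\<lambda>v. 2 * (Re (x $ i) * Re (v $ i) + Im (x $ i) * Im (v $ i)))) (at x)"
    by (rule derivative_eq_intros bounded_linear_imp_has_derivative[OF bounded_linear_vec_nth] refl)+
      (simp add: algebra_simps)
  then show ?thesis by (simp add: cmod_power2)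
qed

text \<open>The derivative of |z|^2 with respect to the conjugate of z is z. Radial functions are
  written in the squared norm because it is smooth at 0.\<close>

lemma has_dzbar_compose_norm:
  assumes "(\<phi> has_real_derivative \<phi>') (at ((norm (x $ i))\<^sup>2))"
  shows "has_dzbar j (\<lambda>x. of_real (\<phi> ((norm (x $ i))\<^sup>2))) (if i = j then of_real \<phi>' * x $ i else 0) x"
proof (rule has_dzbarI)
  show "((\<lambda>x. complex_of_real (\<phi> ((norm (x $ i))\<^sup>2))) has_derivative
      (\<lambda>v. of_real (\<phi>' * (2 * (Re (x $ i) * Re (v $ i) + Im (x $ i) * Im (v $ i)))))) (at x)"
    by (intro has_derivative_of_real has_derivative_compose[OF has_derivative_norm_component
        assms[unfolded has_field_derivative_def]])
qed (auto simp: axis_def complex_eq_iff)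

lemma smooth_on_component:
  "open U \<Longrightarrow> smooth_on U (\<lambda>x::complex ^ 'n::finite. x $ i)"
  by (rule smooth_on_bounded_linear[OF _ bounded_linear_vec_nth])

lemma smooth_on_norm_component:
  assumes "open U"
  shows "smooth_on U (\<lambda>x::complex ^ 'n::finite. (norm (x $ i))\<^sup>2)"
proof -
  have "smooth_on U (\<lambda>x::complex ^ 'n. (Re (x $ i))\<^sup>2 + (Im (x $ i))\<^sup>2)"
    by (intro smooth_on_add smooth_on_power assms smooth_on_bounded_linear
        bounded_linear_compose[OF bounded_linear_Re bounded_linear_vec_nth]
        bounded_linear_compose[OF bounded_linear_Im bounded_linear_vec_nth])
  then show ?thesis by (simp add: cmod_power2)
qed

lemma smooth_on_compose_norm:
  "open U \<Longrightarrow> smooth_on UNIV \<phi> \<Longrightarrow> smooth_on U (\<lambda>x::complex ^ 'n::finite. complex_of_real (\<phi> ((norm (x $ i))\<^sup>2)))"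
  by (rule smooth_on_compose_real[OF _ _ smooth_on_norm_component])

lemma smooth_on_d_zbar:
  assumes "open U" "smooth_on U f"
  shows "smooth_on U (d_zbar j f)"
proof -
  have "smooth_on U (\<lambda>z. 1 / 2 * (frechet_derivative f (at z) (axis j 1) + \<i> * frechet_derivative f (at z) (axis j \<i>)))"
    by (intro smooth_on_mult smooth_on_add smooth_on_const assms smooth_on_frechet_derivative)
  then show ?thesis by (simp add: d_zbar_def[abs_def])
qed

lemma smooth_on_has_dzbar: "smooth_on U f \<Longrightarrow> x \<in> U \<Longrightarrow> has_dzbar j f (d_zbar j f x) x"
  by (simp add: has_dzbar_def smooth_on_imp_differentiable)

lemma d_zbar_zero [simp]: "d_zbar j (\<lambda>z. 0) = (\<lambda>z. 0)"
  by (simp add: d_zbar_def fun_eq_iff)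

lemma dbar_zero: "dbar \<Omega> 0 = 0"
  by (simp add: dbar_def fun_eq_iff zero_fun_def)

lemma dbar_diff:
  assumes "f \<in> smooth_forms \<Omega> p q" "g \<in> smooth_forms \<Omega> p q"
  shows "dbar \<Omega> (f - g) = dbar \<Omega> f - dbar \<Omega> g"
proof -
  have "d_zbar j ((f - g) I J) z = d_zbar j (f I J) z - d_zbar j (g I J) z" if "z \<in> \<Omega>" for I J z j
  proof -
    have "has_dzbar j (\<lambda>z. f I J z - g I J z) (d_zbar j (f I J) z - d_zbar j (g I J) z) z"
      by (intro has_dzbar_diff smooth_on_has_dzbar[OF _ that]) (use assms in \<open>auto simp: smooth_forms_def\<close>)
    moreover have "(f - g) I J = (\<lambda>z. f I J z - g I J z)" by (simp add: fun_eq_iff)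
    ultimately show ?thesis unfolding has_dzbar_def by simp
  qed
  then show ?thesis
    by (simp add: dbar_def fun_eq_iff sum_subtractf right_diff_distrib)
qed

text \<open>\<open>F\<close> is smooth on \<open>\<Omega>\<close> and, being zero there, on the
  complement of \<open>K\<close>. These two open sets cover the space, so integration over the whole
  space produces no boundary term.\<close>

lemma integral_d_zbar_eq_0:
  fixes F :: "complex ^ 'n::finite \<Rightarrow> complex"
  assumes "open \<Omega>" "smooth_on \<Omega> F" and K: "compact K" "K \<subseteq> \<Omega>" "\<And>x. x \<notin> K \<Longrightarrow> F x = 0"
  shows "smooth_on UNIV F" "(\<integral>x. frechet_derivative F (at x) v \<partial>lborel) = 0"
    "(\<integral>x. d_zbar j F x \<partial>lborel) = 0"
proof -
  have "smooth_on (- K) F"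
    by (rule smooth_on_cong[of _ "\<lambda>x. 0"])
      (use K compact_imp_closed[OF K(1)] in \<open>auto simp: open_Compl\<close>)
  then have "smooth_on (\<Omega> \<union> - K) F" using assms by (intro smooth_on_Un)
  moreover have "\<Omega> \<union> - K = UNIV" using K by blast
  ultimately show sm: "smooth_on UNIV F" by simp
  have cont: "continuous_on UNIV (\<lambda>x. frechet_derivative F (at x) v)" for v
    by (intro smooth_on_imp_continuous_on smooth_on_frechet_derivative sm)
  show int: "(\<integral>x. frechet_derivative F (at x) v \<partial>lborel) = 0" for v
    by (rule integral_frechet_derivative_eq_0[OF _ cont K(1,3)])
      (auto intro: smooth_on_imp_differentiable[OF sm])
  have i: "integrable lborel (\<lambda>x. frechet_derivative F (at x) v)" for v
    by (rule integrable_lborel_compact_support[OF cont K(1)])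
      (rule frechet_derivative_eq_0[OF compact_imp_closed[OF K(1)] K(3)])
  show "(\<integral>x. d_zbar j F x \<partial>lborel) = 0"
    unfolding d_zbar_def using i int by simp
qed


section \<open>The closed Hartogs triangle and forms in two variables\<close>

text \<open>In the index type the numeral 2 is the residue 0, so the second coordinate comes first
  in the order. As \<open>dbar\<close> takes wedge products in increasing order, this decides the
  signs in \<open>dbar_UNIV\<close>.\<close>

lemma two_less_one: "(2::2) < 1"
  by (simp add: less_bit0_def bit0.Rep_1 bit0.Rep_numeral)

lemma UNIV_2: "(UNIV :: 2 set) = {1, 2}"
  using exhaust_2 by auto

lemma card_eq_2_iff: "card (J :: 2 set) = 2 \<longleftrightarrow> J = UNIV"
  using card_eq_UNIV_imp_eq_UNIV[of J] by auto

lemma norm_complex2: "norm x = sqrt ((norm (x $ 1))\<^sup>2 + (norm (x $ 2))\<^sup>2)" for x :: "complex ^ 2"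
  by (simp add: norm_vec_def L2_set_def UNIV_2)

lemma closure_hartogs_triangle:
  "closure hartogs_triangle = {x. norm (x $ 1) \<le> norm (x $ 2) \<and> norm (x $ 2) \<le> 1}"
proof
  have "closed {x :: complex ^ 2. norm (x $ 1) \<le> norm (x $ 2) \<and> norm (x $ 2) \<le> 1}"
    by (intro closed_Collect_conj closed_Collect_le continuous_intros)
  then show "closure hartogs_triangle \<subseteq> {x. norm (x $ 1) \<le> norm (x $ 2) \<and> norm (x $ 2) \<le> 1}"
    by (intro closure_minimal) (auto simp: hartogs_triangle_def)
  show "{x. norm (x $ 1) \<le> norm (x $ 2) \<and> norm (x $ 2) \<le> 1} \<subseteq> closure hartogs_triangle"
  proof
    fix x :: "complex ^ 2"
    assume "x \<in> {x. norm (x $ 1) \<le> norm (x $ 2) \<and> norm (x $ 2) \<le> 1}"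
    then have x: "norm (x $ 1) \<le> norm (x $ 2)" "norm (x $ 2) \<le> 1" by auto
    define t where "t n = 1 - inverse (real (Suc n))" for n
    have t: "t \<longlonglongrightarrow> 1"
      unfolding t_def using tendsto_diff[OF tendsto_const[of 1] LIMSEQ_inverse_real_of_nat] by simp
    have t01: "0 < t (Suc n)" "t (Suc n) < 1" for n
      by (auto simp: t_def field_simps)
    \<comment> \<open>Scaling by t^2 and t makes both inequalities strict if the second coordinate
      is nonzero; otherwise the point is 0 and is approached along the second axis. The index is
      shifted because t 0 = 0.\<close>
    define y where "y n = (if x $ 2 = 0 then vector [0, of_real (1 - t (Suc n))]
        else vector [of_real ((t (Suc n))\<^sup>2) * x $ 1, of_real (t (Suc n)) * x $ 2] :: complex ^ 2)" for n
    have ts: "(\<lambda>n. t (Suc n)) \<longlonglongrightarrow> 1" using t by (rule LIMSEQ_Suc)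
    have "y n \<in> hartogs_triangle" for n
    proof (cases "x $ 2 = 0")
      case True
      then show ?thesis using t01[of n] by (simp add: y_def hartogs_triangle_def norm_of_real del: of_real_diff)
    next
      case False
      have "(t (Suc n))\<^sup>2 * norm (x $ 1) \<le> (t (Suc n))\<^sup>2 * norm (x $ 2)"
        by (intro mult_left_mono x) simp
      also have "\<dots> < t (Suc n) * norm (x $ 2)"
        using t01[of n] False by (simp add: power2_eq_square)
      finally have "(t (Suc n))\<^sup>2 * norm (x $ 1) < t (Suc n) * norm (x $ 2)" .
      moreover have "t (Suc n) * norm (x $ 2) < 1"
        using t01[of n] mult_left_mono[OF x(2), of "t (Suc n)"] by linarith
      ultimately show ?thesis
        using False t01[of n] by (simp add: y_def hartogs_triangle_def norm_mult norm_power)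
    qed
    moreover have "y \<longlonglongrightarrow> x"
    proof (rule vec_tendstoI)
      have "(\<lambda>n. y n $ 1) \<longlonglongrightarrow> x $ 1"
      proof (cases "x $ 2 = 0")
        case True then show ?thesis using x by (simp add: y_def)
      next
        case False
        have "(\<lambda>n. of_real ((t (Suc n))\<^sup>2) * x $ 1) \<longlonglongrightarrow> of_real (1\<^sup>2) * x $ 1"
          by (intro tendsto_intros ts)
        then show ?thesis using False by (simp add: y_def)
      qed
      moreover have "(\<lambda>n. y n $ 2) \<longlonglongrightarrow> x $ 2"
      proof (cases "x $ 2 = 0")
        case True
        have "(\<lambda>n. complex_of_real (1 - t (Suc n))) \<longlonglongrightarrow> of_real (1 - 1)"
          by (intro tendsto_intros ts)
        then show ?thesis using True by (simp add: y_def)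
      next
        case False
        have "(\<lambda>n. of_real (t (Suc n)) * x $ 2) \<longlonglongrightarrow> of_real 1 * x $ 2"
          by (intro tendsto_intros ts)
        then show ?thesis using False by (simp add: y_def)
      qed
      ultimately show "(\<lambda>n. y n $ i) \<longlonglongrightarrow> x $ i" for i
        using exhaust_2[of i] by auto
    qed
    ultimately show "x \<in> closure hartogs_triangle"
      unfolding closure_sequential by blast
  qed
qed

text \<open>On the distinguished boundary of the bidisc, which lies in the closure of the triangle,
  the distance to \<open>c\<close> is as large as anywhere on the closed bidisc.\<close>

lemma polydisc_subset_ball:
  fixes c :: "complex ^ 2"
  assumes "closure hartogs_triangle \<subseteq> ball c R"
  obtains q where "q > 1" "{x. (norm (x $ 1))\<^sup>2 \<le> q \<and> (norm (x $ 2))\<^sup>2 \<le> q} \<subseteq> ball c R"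
proof -
  \<comment> \<open>The point of the unit circle farthest from \<open>u\<close>, opposite to it; for
    u = 0 any point will do.\<close>
  define \<zeta> where "\<zeta> u = (if u = 0 then 1 else - sgn u)" for u :: complex
  have \<zeta>: "norm (\<zeta> u) = 1" "norm (\<zeta> u - u) = 1 + norm u" for u
  proof -
    show "norm (\<zeta> u) = 1" by (simp add: \<zeta>_def norm_sgn)
    show "norm (\<zeta> u - u) = 1 + norm u"
    proof (cases "u = 0")
      case False
      have "\<zeta> u - u = - (sgn u * of_real (1 + norm u))"
        using False by (simp add: \<zeta>_def sgn_eq field_simps)
      then show ?thesis using False by (simp add: norm_mult norm_sgn del: of_real_add)
    qed (simp add: \<zeta>_def)
  qed
  \<comment> \<open>The largest distance from \<open>c\<close> to a point of the closed polydisc of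
    radius \<open>s\<close>. At s = 1 it is attained on the closed triangle and hence less than
    \<open>R\<close>; continuity leaves room for some s > 1.\<close>
  define f where "f s = sqrt ((s + norm (c $ 1))\<^sup>2 + (s + norm (c $ 2))\<^sup>2)" for s
  have "vector [\<zeta> (c $ 1), \<zeta> (c $ 2)] \<in> closure hartogs_triangle"
    unfolding closure_hartogs_triangle by (simp add: \<zeta>)
  with assms have "dist (vector [\<zeta> (c $ 1), \<zeta> (c $ 2)]) c < R"
    by (auto simp: dist_commute)
  then have "f 1 < R"
    by (simp add: dist_norm norm_complex2 \<zeta> f_def)
  moreover have "(f \<longlongrightarrow> f 1) (at_right 1)"
    unfolding f_def by (intro tendsto_intros)
  ultimately have "\<forall>\<^sub>F s in at_right 1. f s < R" by (simp add: order_tendstoD)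
  moreover have "\<forall>\<^sub>F s in at_right (1::real). 1 < s" by (rule eventually_at_right_less)
  ultimately have "\<forall>\<^sub>F s in at_right 1. 1 < s \<and> f s < R" by eventually_elim auto
  then obtain s where s: "1 < s" "f s < R"
    using eventually_happens' trivial_limit_at_right_real by blast
  show ?thesis
  proof (rule that[of "s\<^sup>2"])
    show "s\<^sup>2 > 1" using s by (simp add: one_less_power)
    show "{x. (norm (x $ 1))\<^sup>2 \<le> s\<^sup>2 \<and> (norm (x $ 2))\<^sup>2 \<le> s\<^sup>2} \<subseteq> ball c R"
    proof
      fix x :: "complex ^ 2"
      assume "x \<in> {x. (norm (x $ 1))\<^sup>2 \<le> s\<^sup>2 \<and> (norm (x $ 2))\<^sup>2 \<le> s\<^sup>2}"
      then have x: "norm (x $ 1) \<le> s" "norm (x $ 2) \<le> s"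
        using s by (auto simp: power2_le_iff_abs_le)
      have "norm (x $ i - c $ i) \<le> s + norm (c $ i)" if "norm (x $ i) \<le> s" for i
        using norm_triangle_ineq4[of "x $ i" "c $ i"] that by linarith
      with x have "norm (x - c) \<le> f s"
        unfolding norm_complex2 f_def by (intro real_sqrt_le_mono add_mono power_mono) auto
      then show "x \<in> ball c R" using s by (simp add: dist_norm norm_minus_commute)
    qed
  qed
qed

section \<open>Forms in two variables\<close>

definition single_form :: "'n set \<Rightarrow> 'n set \<Rightarrow> (complex ^ 'n \<Rightarrow> complex) \<Rightarrow> 'n form" where
  "single_form I0 J0 g = (\<lambda>I J x. if I = I0 \<and> J = J0 then g x else 0)"

lemma single_form_simps:
  "single_form I0 J0 g I0 J0 = g" "I \<noteq> I0 \<or> J \<noteq> J0 \<Longrightarrow> single_form I0 J0 g I J = (\<lambda>x. 0)"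
  by (auto simp: single_form_def fun_eq_iff)

lemma smooth_on_single_form:
  assumes "open \<Omega>" "smooth_on \<Omega> g"
  shows "smooth_on \<Omega> (single_form I0 J0 g I J)"
proof (cases "I = I0 \<and> J = J0")
  case True
  then show ?thesis using assms(2) by (simp add: single_form_simps)
next
  case False
  then show ?thesis using assms(1) by (simp add: single_form_simps smooth_on_const)
qed

lemma single_form_in_smooth_forms:
  assumes "open \<Omega>" "smooth_on \<Omega> g" "\<And>x. x \<notin> \<Omega> \<Longrightarrow> g x = 0" "card I0 = p" "card J0 = q"
  shows "single_form I0 J0 g \<in> smooth_forms \<Omega> p q"
  unfolding smooth_forms_def
  using smooth_on_single_form[OF assms(1,2)] assms(3-5) by (auto simp: single_form_def)

lemma dbar_eq_0:
  assumes "f \<in> smooth_forms \<Omega> p q" "card I \<noteq> p \<or> card J \<noteq> Suc q"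
  shows "dbar \<Omega> f I J x = 0"
proof -
  have "f I (J - {j}) = (\<lambda>x. 0)" if "j \<in> J" for j
  proof -
    have "card J = Suc (card (J - {j}))"
      using card_Suc_Diff1[OF finite that] by simp
    then have "card I \<noteq> p \<or> card (J - {j}) \<noteq> q" using assms(2) by auto
    then show ?thesis using assms(1) by (auto simp: smooth_forms_def fun_eq_iff)
  qed
  then show ?thesis by (simp add: dbar_def)
qed

lemma dbar_UNIV:
  fixes f :: "2 form"
  shows "dbar \<Omega> f {} UNIV x = (if x \<in> \<Omega> then d_zbar 2 (f {} {1}) x - d_zbar 1 (f {} {2}) x else 0)"
proof -
  have "{k. (k = 1 \<or> k = 2) \<and> k < (1::2)} = {2}" "{k. (k = 1 \<or> k = 2) \<and> k < (2::2)} = {}"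
    using two_less_one by auto
  moreover have "{1, 2} - {1::2} = {2}" "{1, 2} - {2::2} = {1}" by auto
  ultimately show ?thesis unfolding dbar_def UNIV_2 by (simp del: Collect_empty_eq)
qed

lemma dbar_singleton:
  fixes f :: "2 form"
  shows "dbar \<Omega> f UNIV {j} x = (if x \<in> \<Omega> then d_zbar j (f UNIV {}) x else 0)"
proof -
  have "{k. k = j \<and> k < j} = {}" by auto
  then show ?thesis by (simp add: dbar_def del: Collect_empty_eq)
qed

lemma dbar_closed_top:
  fixes f :: "2 form"
  assumes "f \<in> smooth_forms \<Omega> p 2"
  shows "dbar \<Omega> f = 0"
proof -
  have "dbar \<Omega> f I J x = 0" for I J x
  proof (rule dbar_eq_0[OF assms])
    show "card I \<noteq> p \<or> card J \<noteq> Suc 2" using card_mono[of UNIV J] by auto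
  qed
  then show ?thesis by (simp add: fun_eq_iff)
qed

text \<open>Stokes' formula for the form \<open>a dw\<^sub>1 + b dw\<^sub>2\<close>.\<close>

lemma dbar_pairing:
  fixes a b H :: "complex ^ 2 \<Rightarrow> complex"
  assumes \<Omega>: "open \<Omega>" and sm: "smooth_on \<Omega> a" "smooth_on \<Omega> b" "smooth_on \<Omega> H"
    and K: "compact K" "K \<subseteq> \<Omega>" "\<And>x. x \<notin> K \<Longrightarrow> a x = 0" "\<And>x. x \<notin> K \<Longrightarrow> b x = 0"
  shows "(\<integral>x. (d_zbar 2 a x - d_zbar 1 b x) * H x \<partial>lborel)
    = - (\<integral>x. a x * d_zbar 2 H x - b x * d_zbar 1 H x \<partial>lborel)"
proof -
  have z: "d_zbar j u x = 0" if "\<And>x. x \<notin> K \<Longrightarrow> u x = 0" "x \<notin> K" for u j x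
    unfolding d_zbar_def using frechet_derivative_eq_0[OF compact_imp_closed[OF K(1)] that(1) that(2)]
    by simp
  have int: "integrable lborel F" if "smooth_on \<Omega> F" "\<And>x. x \<notin> K \<Longrightarrow> F x = 0" for F :: "complex ^ 2 \<Rightarrow> complex"
    by (rule integrable_lborel_compact_support[OF smooth_on_imp_continuous_on[OF
          integral_d_zbar_eq_0(1)[OF \<Omega> that(1) K(1,2) that(2)]] K(1) that(2)])
  have parts: "(\<integral>x. d_zbar j u x * H x + u x * d_zbar j H x \<partial>lborel) = 0"
    if "smooth_on \<Omega> u" "\<And>x. x \<notin> K \<Longrightarrow> u x = 0" for u j
  proof -
    have eq: "d_zbar j (\<lambda>x. u x * H x) x = d_zbar j u x * H x + u x * d_zbar j H x" for x
    proof (cases "x \<in> \<Omega>")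
      case True
      then show ?thesis
        using has_dzbar_mult[OF smooth_on_has_dzbar[OF that(1)] smooth_on_has_dzbar[OF sm(3)]]
        unfolding has_dzbar_def by blast
    next
      \<comment> \<open>Nothing is known about \<open>H\<close> here, but \<open>x\<close> lies in
        the open complement of \<open>K\<close>, where the product is identically 0.\<close>
      case False
      then have "x \<notin> K" using K by blast
      then show ?thesis using z[of "\<lambda>x. u x * H x"] z[OF that(2)] that(2) by simp
    qed
    have "(\<integral>x. d_zbar j (\<lambda>x. u x * H x) x \<partial>lborel) = 0"
      by (rule integral_d_zbar_eq_0(3)[OF \<Omega> smooth_on_mult[OF \<Omega> that(1) sm(3)] K(1,2)])
        (simp add: that(2))
    then show ?thesis unfolding eq .
  qed
  have i: "integrable lborel (\<lambda>x. d_zbar j u x * H x)" "integrable lborel (\<lambda>x. u x * d_zbar j H x)"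
    if "smooth_on \<Omega> u" "\<And>x. x \<notin> K \<Longrightarrow> u x = 0" for u j
    by (rule int, intro smooth_on_mult smooth_on_d_zbar \<Omega> that sm, simp add: z[OF that(2)] that(2))+
  show ?thesis
    using parts[OF sm(1) K(3), of 2] parts[OF sm(2) K(4), of 1]
      i[OF sm(1) K(3), of 2] i[OF sm(2) K(4), of 1]
    by (simp add: left_diff_distrib algebra_simps add_eq_0_iff)
qed


section \<open>Moments\<close>

text \<open>Since \<open>H\<close> is holomorphic in the first variable, only the coefficient
  \<open>a\<close> survives on the right, and the growth estimates can look at \<open>a\<close>
  alone.\<close>

lemma dbar_pairing_coeff:
  fixes a b H :: "complex ^ 2 \<Rightarrow> complex"
  assumes \<Omega>: "open \<Omega>" and sm: "smooth_on \<Omega> a" "smooth_on \<Omega> b" "smooth_on \<Omega> H"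
    and K: "compact K" "K \<subseteq> \<Omega>" "\<And>x. x \<notin> K \<Longrightarrow> a x = 0" "\<And>x. x \<notin> K \<Longrightarrow> b x = 0"
    and G: "\<And>x. x \<in> \<Omega> \<Longrightarrow> d_zbar 2 a x - d_zbar 1 b x = G x" "\<And>x. x \<notin> \<Omega> \<Longrightarrow> G x = 0"
    and h: "\<And>x. x \<in> \<Omega> \<Longrightarrow> d_zbar 1 H x = 0" "\<And>x. x \<in> \<Omega> \<Longrightarrow> d_zbar 2 H x = h x"
  shows "(\<integral>x. G x * H x \<partial>lborel) = - (\<integral>x. a x * h x \<partial>lborel)"
proof -
  have e1: "(d_zbar 2 a x - d_zbar 1 b x) * H x = G x * H x" for x
  proof (cases "x \<in> \<Omega>")
    case False
    then have x: "x \<notin> K" using K by blast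
    have "d_zbar 2 a x = 0" "d_zbar 1 b x = 0"
      unfolding d_zbar_def
      using frechet_derivative_eq_0[where F=a, OF compact_imp_closed[OF K(1)] K(3) x]
        frechet_derivative_eq_0[where F=b, OF compact_imp_closed[OF K(1)] K(4) x] by simp_all
    then show ?thesis using G(2)[OF False] by simp
  qed (simp add: G)
  have e2: "a x * d_zbar 2 H x - b x * d_zbar 1 H x = a x * h x" for x
  proof (cases "x \<in> \<Omega>")
    case False
    then have "x \<notin> K" using K(2) by blast
    then show ?thesis using K by simp
  qed (simp add: h)
  show ?thesis using dbar_pairing[OF \<Omega> sm K] unfolding e1 e2 .
qed

lemma integrable_smooth_compact_support:
  fixes F :: "complex ^ 'n::finite \<Rightarrow> complex"
  assumes "open \<Omega>" "smooth_on \<Omega> F" "compact K" "K \<subseteq> \<Omega>" "\<And>x. x \<notin> K \<Longrightarrow> F x = 0"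
  shows "integrable lborel F"
  using integrable_lborel_compact_support[OF smooth_on_imp_continuous_on[OF
      integral_d_zbar_eq_0(1)[OF assms]] assms(3,5)] .

text \<open>This serves two purposes: with the number of summands as exponent it gives convergence
  of integrals, with the index of the dual family as exponent it gives the growth estimates.\<close>

lemma integral_geometric_bound:
  fixes F :: "nat \<Rightarrow> complex ^ 'n::finite \<Rightarrow> complex"
  assumes "open \<Omega>" "\<And>k. smooth_on \<Omega> (F k)" and K: "compact K" "K \<subseteq> \<Omega>" "\<And>k x. x \<notin> K \<Longrightarrow> F k x = 0"
    and A: "continuous_on K A" and "\<rho> \<ge> 0"
    and le: "\<And>k x. x \<in> K \<Longrightarrow> norm (F k x) \<le> norm (A x) * \<rho> ^ k"
  shows "\<exists>C. \<forall>k. norm (integral\<^sup>L lborel (F k)) \<le> C * \<rho> ^ k"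
proof -
  have "bounded (A ` K)" by (intro compact_imp_bounded compact_continuous_image A K)
  then obtain M where M: "\<And>x. x \<in> K \<Longrightarrow> norm (A x) \<le> M" unfolding bounded_iff by blast
  have "norm (integral\<^sup>L lborel (F k)) \<le> M * \<rho> ^ k * measure lborel K" for k
  proof (rule norm_integral_lborel_le[OF smooth_on_imp_continuous_on K(1,3)])
    show "smooth_on UNIV (F k)" by (rule integral_d_zbar_eq_0(1)[OF assms(1,2) K(1,2,3)])
    show "norm (F k x) \<le> M * \<rho> ^ k" if "x \<in> K" for x
      using le[OF that, of k] mult_right_mono[OF M[OF that], of "\<rho> ^ k"] \<open>\<rho> \<ge> 0\<close> by simp
  qed
  then show ?thesis
    by (intro exI[of _ "M * measure lborel K"]) (simp add: mult_ac)
qed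

text \<open>By biorthogonality the integrals of partial sums no longer change once
  \<open>N > j\<close>. Passing to the limit under the integral then means that a fixed difference
  is bounded by a null sequence.\<close>

lemma eq_if_geometric_bound:
  fixes u w :: "'a::real_normed_vector"
  assumes "\<And>N. N > j \<Longrightarrow> norm (u - w) \<le> C * \<rho> ^ N" "0 \<le> \<rho>" "\<rho> < 1"
  shows "u = w"
proof -
  have "(\<lambda>N. C * \<rho> ^ N) \<longlonglongrightarrow> C * 0"
    by (intro tendsto_mult tendsto_const LIMSEQ_power_zero) (use assms in auto)
  moreover have "\<forall>\<^sub>F N in sequentially. norm (u - w) \<le> C * \<rho> ^ N"
    by (rule eventually_mono[OF eventually_gt_at_top[of j] assms(1)])
  ultimately have "norm (u - w) \<le> C * 0"
    by (intro tendsto_lowerbound) auto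
  then show ?thesis by simp
qed

lemma geometric_growth_contradiction:
  fixes \<alpha> \<beta> :: real
  assumes "\<And>k. norm (of_real \<alpha> ^ k * u :: complex) \<le> C * \<beta> ^ k" "0 < \<beta>" "\<beta> < \<alpha>" "u \<noteq> 0"
  shows False
proof -
  obtain k where k: "C / norm u < (\<alpha> / \<beta>) ^ k"
    using real_arch_pow[of "\<alpha> / \<beta>"] assms by auto
  then have "C * \<beta> ^ k < \<alpha> ^ k * norm u"
    using assms by (simp add: power_divide field_simps)
  with assms(1)[of k] assms(2,3) show False by (simp add: norm_mult norm_power)
qed

lemma compact_polydisc: "compact {x :: complex ^ 2. (norm (x $ 1))\<^sup>2 \<le> a \<and> (norm (x $ 2))\<^sup>2 \<le> b}"
  unfolding compact_eq_bounded_closed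
proof
  show "bounded {x :: complex ^ 2. (norm (x $ 1))\<^sup>2 \<le> a \<and> (norm (x $ 2))\<^sup>2 \<le> b}"
    unfolding bounded_iff
    by (intro exI[of _ "sqrt (a + b)"]) (auto simp: norm_complex2 intro!: real_sqrt_le_mono)
  show "closed {x :: complex ^ 2. (norm (x $ 1))\<^sup>2 \<le> a \<and> (norm (x $ 2))\<^sup>2 \<le> b}"
    by (intro closed_Collect_conj closed_Collect_le continuous_intros)
qed

section \<open>Radial cutoffs and the weight on the shell\<close>

definition radial :: "(real \<Rightarrow> real) \<Rightarrow> 2 \<Rightarrow> complex ^ 2 \<Rightarrow> complex" where
  "radial \<phi> i x = of_real (\<phi> ((norm (x $ i))\<^sup>2))"

lemma smooth_on_radial: "open U \<Longrightarrow> smooth_on UNIV \<phi> \<Longrightarrow> smooth_on U (radial \<phi> i)"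
  unfolding radial_def[abs_def] by (rule smooth_on_compose_norm)

lemma smooth_on_radial_cutoff: "open U \<Longrightarrow> p < q \<Longrightarrow> smooth_on U (radial (cutoff p q) i)"
  by (intro smooth_on_radial smooth_on_cutoff)

lemma smooth_on_radial_cutoff': "open U \<Longrightarrow> smooth_on U (radial (cutoff' p q) i)"
  by (intro smooth_on_radial smooth_on_cutoff')

lemma has_dzbar_radial_cutoff:
  "p < q \<Longrightarrow> has_dzbar i (radial (cutoff p q) i) (radial (cutoff' p q) i x * x $ i) x"
  unfolding radial_def[abs_def]
  using has_dzbar_compose_norm[where i=i and j=i, OF has_real_derivative_cutoff, of p q x] by simp

lemma has_dzbar_radial_other:
  assumes "smooth_on UNIV \<phi>" "i \<noteq> j"
  shows "has_dzbar j (radial \<phi> i) 0 x"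
proof -
  let ?t = "(norm (x $ i))\<^sup>2"
  have "(\<phi> has_real_derivative (frechet_derivative \<phi> (at ?t) 1)) (at ?t)"
    unfolding has_field_derivative_def
  proof (rule has_derivative_eq_rhs[OF smooth_on_has_derivative[OF assms(1) UNIV_I]])
    show "frechet_derivative \<phi> (at ?t) = (*) (frechet_derivative \<phi> (at ?t) 1)"
    proof
      fix v :: real
      show "frechet_derivative \<phi> (at ?t) v = frechet_derivative \<phi> (at ?t) 1 * v"
        using linear_scale[OF linear_frechet_derivative[OF smooth_on_imp_differentiable[OF assms(1) UNIV_I]], of ?t v 1]
        by (simp add: mult.commute)
    qed
  qed
  from has_dzbar_compose_norm[OF this, of j] show ?thesis
    unfolding radial_def[abs_def] using assms(2) by simp
qed

text \<open>Near \<open>x $ 2 = 0\<close> the first factor vanishes, so \<open>\<sigma>\<close> is a smooth substitute for \<open>\<rho> / w\<close>, where \<open>\<rho>\<close> is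
  the cutoff function: both have the same derivative with respect to the conjugate of \<open>w\<close>.\<close>

definition \<sigma> :: "complex ^ 2 \<Rightarrow> complex" where
  "\<sigma> x = (radial (cutoff (1/64) (1/16)) 2 x - 1) * inverse (x $ 2)"

lemma open_norm_gt: "open {x :: complex ^ 2. (norm (x $ i))\<^sup>2 > a}"
  by (intro open_Collect_less continuous_intros)

lemma open_norm_lt: "open {x :: complex ^ 2. (norm (x $ i))\<^sup>2 < a}"
  by (intro open_Collect_less continuous_intros)

lemma open_component_neq: "open {x :: complex ^ 2. x $ i \<noteq> a}"
  by (intro open_Collect_neq continuous_intros)

lemma sigma_near_0: "(norm (x $ 2))\<^sup>2 < 1/64 \<Longrightarrow> \<sigma> x = 0"
  by (simp add: \<sigma>_def radial_def cutoff_eq_1)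

lemma smooth_on_sigma: "smooth_on UNIV \<sigma>"
proof -
  let ?U = "{x :: complex ^ 2. x $ 2 \<noteq> 0}" and ?V = "{x :: complex ^ 2. (norm (x $ 2))\<^sup>2 < 1/64}"
  have "smooth_on ?U \<sigma>"
    unfolding \<sigma>_def[abs_def]
    by (intro smooth_on_mult smooth_on_diff smooth_on_const smooth_on_inverse smooth_on_component
        smooth_on_radial_cutoff open_component_neq) auto
  moreover have "smooth_on ?V \<sigma>"
    by (rule smooth_on_cong[of ?V "\<lambda>x. 0"], rule open_norm_lt, simp add: sigma_near_0, rule smooth_on_const, rule open_norm_lt)
  ultimately have "smooth_on (?U \<union> ?V) \<sigma>" by (rule smooth_on_Un)
  moreover have "?U \<union> ?V = UNIV" by auto
  ultimately show ?thesis by simp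
qed

text \<open>At w = 0 the inverse takes its default value 0, and the cutoff is 1 there, so both sides
  vanish. The identity matches the terms of \<open>primitive1\<close> and \<open>primitive2\<close>
  in which the outer cutoffs are differentiated.\<close>

lemma mult_sigma: "x $ 2 * \<sigma> x = radial (cutoff (1/64) (1/16)) 2 x - 1"
  by (cases "x $ 2 = 0") (auto simp: \<sigma>_def radial_def cutoff_eq_1)

lemma has_dzbar_sigma:
  "has_dzbar 2 \<sigma> (radial (cutoff' (1/64) (1/16)) 2 x) x"
proof (cases "(norm (x $ 2))\<^sup>2 < 1/64")
  case True
  have "has_dzbar 2 \<sigma> 0 x"
    by (rule has_dzbar_cong_open[OF open_norm_lt[of 2 "1/64"] _ _ has_dzbar_const[of _ 0]])
      (use True in \<open>auto simp: sigma_near_0\<close>)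
  then show ?thesis using True by (simp add: radial_def cutoff'_eq_0)
next
  case False
  then have nz: "x $ 2 \<noteq> 0" by auto
  have "has_dzbar 2 \<sigma> ((radial (cutoff' (1/64) (1/16)) 2 x * x $ 2 - 0) * inverse (x $ 2)
      + (radial (cutoff (1/64) (1/16)) 2 x - 1) * 0) x"
    unfolding \<sigma>_def[abs_def]
    by (intro has_dzbar_mult has_dzbar_diff has_dzbar_const has_dzbar_radial_cutoff
        has_dzbar_holomorphic[OF DERIV_inverse[OF nz]]) simp
  then show ?thesis using nz by (simp add: mult.assoc)
qed

text \<open>The product of the factors a and b of the overview. Both are derivatives of cutoffs, so
  that the weight arises by differentiating one. As 1/16 < 1/9, its support has |w| < |z| and avoids
  the closed triangle.\<close>

definition shell_weight :: "complex ^ 2 \<Rightarrow> complex" where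
  "shell_weight x = radial (cutoff' (1/9) (1/4)) 1 x * radial (cutoff' (1/64) (1/16)) 2 x"

definition shell :: "(complex ^ 2) set" where
  "shell = {x. (norm (x $ 1))\<^sup>2 \<in> {1/9..1/4} \<and> (norm (x $ 2))\<^sup>2 \<in> {1/64..1/16}}"

lemma compact_shell: "compact shell"
proof -
  have eq: "shell = {x. (norm (x $ 1))\<^sup>2 \<le> 1/4 \<and> (norm (x $ 2))\<^sup>2 \<le> 1/16} \<inter>
      {x. 1/9 \<le> (norm (x $ 1))\<^sup>2 \<and> 1/64 \<le> (norm (x $ 2))\<^sup>2}"
    by (auto simp: shell_def)
  have "closed {x :: complex ^ 2. 1/9 \<le> (norm (x $ 1))\<^sup>2 \<and> 1/64 \<le> (norm (x $ 2))\<^sup>2}"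
    by (intro closed_Collect_conj closed_Collect_le continuous_intros)
  then show ?thesis unfolding eq by (rule compact_Int_closed[OF compact_polydisc])
qed

lemma shell_weight_eq_0: "x \<notin> shell \<Longrightarrow> shell_weight x = 0"
  by (auto simp: shell_def shell_weight_def radial_def cutoff'_eq_0)

lemma shell_nz: "x \<in> shell \<Longrightarrow> x $ 1 \<noteq> 0"
  by (auto simp: shell_def)

lemma smooth_on_shell_weight: "open U \<Longrightarrow> smooth_on U shell_weight"
  unfolding shell_weight_def[abs_def] by (intro smooth_on_mult smooth_on_radial_cutoff')

lemma smooth_on_inverse_power:
  "open U \<Longrightarrow> (\<And>x. x \<in> U \<Longrightarrow> x $ 1 \<noteq> 0) \<Longrightarrow> smooth_on U (\<lambda>x::complex ^ 2. inverse (x $ 1) ^ k)"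
  by (intro smooth_on_power smooth_on_inverse smooth_on_component)

lemma frechet_derivative_eqI: "(f has_derivative f') (at x) \<Longrightarrow> f' v = y \<Longrightarrow> frechet_derivative f (at x) v = y"
  using frechet_derivative_at by metis

text \<open>For \<open>j \<noteq> k\<close>, the integrand is an eigenfunction for the nonzero eigenvalue \<open>i (j - k)\<close> of the
  generator of rotations in the first variable, a vector field of divergence zero.\<close>

lemma moment:
  "(\<integral>x. shell_weight x * x $ 1 ^ j * inverse (x $ 1) ^ k \<partial>lborel) = (if j = k then integral\<^sup>L lborel shell_weight else 0)"
proof (cases "j = k")
  case True
  have "shell_weight x * x $ 1 ^ j * inverse (x $ 1) ^ k = shell_weight x" for x
    using True shell_weight_eq_0[of x] shell_nz[of x]
    by (cases "x \<in> shell") (auto simp flip: power_mult_distrib)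
  then have "(\<lambda>x. shell_weight x * x $ 1 ^ j * inverse (x $ 1) ^ k) = shell_weight" by (rule ext)
  then show ?thesis using True by simp
next
  case False
  define F where "F x = shell_weight x * (x $ 1 ^ j * inverse (x $ 1) ^ k)" for x
  have F0: "F x = 0" if "x \<notin> shell" for x using shell_weight_eq_0[OF that] by (simp add: F_def)
  let ?U = "{x :: complex ^ 2. x $ 1 \<noteq> 0}"
  have smU: "smooth_on ?U F"
    unfolding F_def
    by (intro smooth_on_mult smooth_on_shell_weight smooth_on_power smooth_on_component
        smooth_on_inverse_power open_component_neq) auto
  have "shell \<subseteq> ?U" using shell_nz by auto
  note sm = integral_d_zbar_eq_0(1)[OF open_component_neq smU compact_shell this F0]
  define X where "X x = complex_of_real (Re (x $ 1))" for x :: "complex ^ 2"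
  define Y where "Y x = complex_of_real (Im (x $ 1))" for x :: "complex ^ 2"
  have blX: "bounded_linear X" and blY: "bounded_linear Y"
    unfolding X_def Y_def
    by (intro bounded_linear_compose[OF bounded_linear_of_real]
        bounded_linear_compose[OF bounded_linear_Re] bounded_linear_compose[OF bounded_linear_Im]
        bounded_linear_vec_nth)+
  have smX: "smooth_on UNIV X" and smY: "smooth_on UNIV Y"
    by (intro smooth_on_bounded_linear blX blY open_UNIV)+
  have smXF: "smooth_on UNIV (\<lambda>x. X x * F x)" and smYF: "smooth_on UNIV (\<lambda>x. Y x * F x)"
    using smooth_on_mult[OF open_UNIV smX sm] smooth_on_mult[OF open_UNIV smY sm] by auto
  have dX: "frechet_derivative X (at x) v = X v" and dY: "frechet_derivative Y (at x) v = Y v" for x v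
    by (rule frechet_derivative_eqI[OF bounded_linear_imp_has_derivative], fact, rule refl)+
  \<comment> \<open>Multiplying z by i gives the tangent direction of the circles around 0, so the
    radial factors are annihilated and z^(j-k) is multiplied by i (j - k).\<close>
  have rot: "frechet_derivative F (at x) (axis 1 (\<i> * x $ 1)) = \<i> * (of_nat j - of_nat k) * F x" for x
  proof (cases "x $ 1 = 0")
    case True
    then have "x \<notin> shell" using shell_nz by blast
    then show ?thesis
      using frechet_derivative_eq_0[where F=F, OF compact_imp_closed[OF compact_shell] F0] F0 by simp
  next
    case nz: False
    let ?v = "axis 1 (\<i> * x $ 1) :: complex ^ 2"
    have rad1: "((\<lambda>x. (norm (x $ 1))\<^sup>2) has_derivative
        (\<lambda>v. 2 * (Re (x $ 1) * Re (v $ 1) + Im (x $ 1) * Im (v $ 1)))) (at x)"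
      and rad2: "((\<lambda>x. (norm (x $ 2))\<^sup>2) has_derivative
        (\<lambda>v. 2 * (Re (x $ 2) * Re (v $ 2) + Im (x $ 2) * Im (v $ 2)))) (at x)"
      by (rule has_derivative_norm_component)+
    have d1: "frechet_derivative (radial (cutoff' (1/9) (1/4)) 1) (at x) ?v = 0"
      unfolding radial_def[abs_def]
      by (rule frechet_derivative_eqI[OF has_derivative_of_real[OF has_derivative_compose[OF rad1
          smooth_on_has_derivative[OF smooth_on_cutoff' UNIV_I]]]])
        (simp add: axis_def linear_0 linear_frechet_derivative
          smooth_on_imp_differentiable[OF smooth_on_cutoff' UNIV_I])
    have d2: "frechet_derivative (radial (cutoff' (1/64) (1/16)) 2) (at x) ?v = 0"
      unfolding radial_def[abs_def]
      by (rule frechet_derivative_eqI[OF has_derivative_of_real[OF has_derivative_compose[OF rad2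
          smooth_on_has_derivative[OF smooth_on_cutoff' UNIV_I]]]])
        (simp add: axis_def linear_0 linear_frechet_derivative
          smooth_on_imp_differentiable[OF smooth_on_cutoff' UNIV_I])
    have diff: "radial (cutoff' p q) i differentiable (at x)" for p q i
      by (rule smooth_on_imp_differentiable[OF smooth_on_radial_cutoff'[OF open_UNIV] UNIV_I])
    have dB: "frechet_derivative shell_weight (at x) ?v = 0"
      unfolding shell_weight_def[abs_def] using d1 d2 by (subst frechet_derivative_mult[OF diff diff]) simp
    have comp: "((\<lambda>x::complex ^ 2. x $ 1) has_derivative (\<lambda>v. v $ 1)) (at x)"
      by (rule bounded_linear_imp_has_derivative[OF bounded_linear_vec_nth])
    have pw: "z ^ n = z * z ^ (n - 1)" if "n \<noteq> 0" for z :: complex and n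
      using that by (cases n) auto
    have dP: "frechet_derivative (\<lambda>x. x $ 1 ^ j) (at x) ?v = \<i> * of_nat j * x $ 1 ^ j"
      by (rule frechet_derivative_eqI[OF has_derivative_power[OF comp]])
        (use pw[of j] in \<open>cases "j = 0"; simp add: axis_def\<close>)
    have dI: "frechet_derivative (\<lambda>x. inverse (x $ 1) ^ k) (at x) ?v = - \<i> * of_nat k * inverse (x $ 1) ^ k"
      by (rule frechet_derivative_eqI[OF has_derivative_power[OF Deriv.has_derivative_inverse[OF nz comp]]])
        (use pw[of k] nz in \<open>cases "k = 0"; simp add: axis_def\<close>)
    have smU1: "smooth_on ?U (\<lambda>x. x $ 1 ^ j)" and smU2: "smooth_on ?U (\<lambda>x. inverse (x $ 1) ^ k)"
      by (intro smooth_on_power smooth_on_component smooth_on_inverse_power open_component_neq; simp)+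
    have d: "(\<lambda>x. x $ 1 ^ j) differentiable (at x)" "(\<lambda>x. inverse (x $ 1) ^ k) differentiable (at x)"
        "(\<lambda>x. x $ 1 ^ j * inverse (x $ 1) ^ k) differentiable (at x)" "shell_weight differentiable (at x)"
      using smooth_on_imp_differentiable[OF smU1, of x] smooth_on_imp_differentiable[OF smU2, of x]
        smooth_on_imp_differentiable[OF smooth_on_mult[OF open_component_neq smU1 smU2], of x]
        smooth_on_imp_differentiable[OF smooth_on_shell_weight[OF open_UNIV], of x] nz by auto
    show ?thesis
      unfolding F_def[abs_def]
      using dB dP dI by (simp add: frechet_derivative_mult d algebra_simps)
  qed
  \<comment> \<open>The coefficients Re z and Im z of the rotation field do not depend on the
    variable that is differentiated next to them. Moved under the derivative, they exhibit the
    integrand as a difference of derivatives of compactly supported functions.\<close>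
  have eq: "frechet_derivative (\<lambda>x. X x * F x) (at x) (axis 1 \<i>)
      - frechet_derivative (\<lambda>x. Y x * F x) (at x) (axis 1 1) = \<i> * (of_nat j - of_nat k) * F x" for x
  proof -
    have dF: "F differentiable (at x)" "X differentiable (at x)" "Y differentiable (at x)"
      using sm smX smY smooth_on_imp_differentiable by blast+
    have lin: "linear (frechet_derivative F (at x))" by (rule linear_frechet_derivative[OF dF(1)])
    have "axis 1 (\<i> * x $ 1) = Re (x $ 1) *\<^sub>R axis 1 \<i> + (- Im (x $ 1)) *\<^sub>R (axis 1 1 :: complex ^ 2)"
      by (auto simp: vec_eq_iff axis_def complex_eq_iff)
    then have "\<i> * (of_nat j - of_nat k) * F x = Re (x $ 1) *\<^sub>R frechet_derivative F (at x) (axis 1 \<i>)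
        + (- Im (x $ 1)) *\<^sub>R frechet_derivative F (at x) (axis 1 1)"
      using rot[of x] linear_add[OF lin] linear_scale[OF lin] by metis
    moreover have "X (axis 1 \<i>) = 0" "Y (axis 1 1) = 0"
      by (simp_all add: X_def Y_def axis_def)
    ultimately show ?thesis
      unfolding frechet_derivative_mult[OF dF(2,1)] frechet_derivative_mult[OF dF(3,1)] dX dY
      by (simp add: X_def Y_def scaleR_conv_of_real)
  qed
  have int: "integrable lborel (\<lambda>x. frechet_derivative G (at x) v)"
      "(\<integral>x. frechet_derivative G (at x) v \<partial>lborel) = 0"
    if "smooth_on UNIV G" "\<And>x. x \<notin> shell \<Longrightarrow> G x = 0" for G :: "complex ^ 2 \<Rightarrow> complex" and v
  proof -
    show "integrable lborel (\<lambda>x. frechet_derivative G (at x) v)"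
      by (rule integrable_smooth_compact_support[OF open_UNIV smooth_on_frechet_derivative[OF that(1)] compact_shell])
        (use frechet_derivative_eq_0[where F=G, OF compact_imp_closed[OF compact_shell] that(2)] in auto)
    show "(\<integral>x. frechet_derivative G (at x) v \<partial>lborel) = 0"
      by (rule integral_d_zbar_eq_0(2)[OF open_UNIV that(1) compact_shell _ that(2)]) auto
  qed
  have XF0: "X x * F x = 0" and YF0: "Y x * F x = 0" if "x \<notin> shell" for x
    using F0[OF that] by simp_all
  have "(\<integral>x. \<i> * (of_nat j - of_nat k) * F x \<partial>lborel) = 0"
    unfolding eq[symmetric]
    using Bochner_Integration.integral_diff[OF int(1)[OF smXF XF0] int(1)[OF smYF YF0]]
      int(2)[OF smXF XF0] int(2)[OF smYF YF0] by simp
  then have "integral\<^sup>L lborel F = 0" using False by simp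
  then show ?thesis using False by (simp add: F_def[abs_def] mult.assoc)
qed

lemma integral_shell_weight_neq_0: "integral\<^sup>L lborel shell_weight \<noteq> 0"
proof -
  define f where "f x = cutoff' (1/9) (1/4) ((norm (x $ 1))\<^sup>2) * cutoff' (1/64) (1/16) ((norm (x $ 2))\<^sup>2)"
    for x :: "complex ^ 2"
  have shell_weight: "shell_weight = (\<lambda>x. of_real (f x))"
    by (simp add: fun_eq_iff f_def shell_weight_def radial_def)
  have cc: "continuous_on UNIV (cutoff' p q)" for p q
    by (rule smooth_on_imp_continuous_on[OF smooth_on_cutoff'])
  have "integral\<^sup>L lborel f > 0"
  proof (rule integral_lborel_pos[OF _ compact_shell])
    show "continuous_on UNIV f"
      unfolding f_def by (intro continuous_intros continuous_on_compose2[OF cc]) auto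
    show "f x = 0" if "x \<notin> shell" for x using shell_weight_eq_0[OF that] by (simp add: shell_weight)
    show "f x \<ge> 0" for x
      unfolding f_def by (intro mult_nonpos_nonpos cutoff'_le_0) auto
    \<comment> \<open>Here |z| = 2/5 lies between 1/3 and 1/2, and |w| = 1/5 between 1/8 and 1/4, so
      both cutoff derivatives are negative.\<close>
    show "f (vector [of_real (2/5), of_real (1/5)]) > 0"
      unfolding f_def
      by (intro mult_neg_neg cutoff'_less_0) (auto simp: norm_divide power_divide)
  qed
  then show ?thesis by (simp add: shell_weight)
qed


section \<open>Biorthogonal families\<close>

text \<open>The holomorphic factors P(z) of the construction. Smoothness is part of the predicate,
  so that it is checked directly for polynomials instead of being deduced from holomorphy.\<close>

definition admissible :: "(complex \<Rightarrow> complex) \<Rightarrow> bool" where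
  "admissible P \<longleftrightarrow> (\<forall>z. \<exists>d. (P has_field_derivative d) (at z)) \<and> smooth_on UNIV (\<lambda>x::complex ^ 2. P (x $ 1))"

lemma admissible_poly: "admissible (\<lambda>z. \<Sum>i<N. a i * z ^ i)"
  unfolding admissible_def
proof (intro conjI allI)
  show "\<exists>d. ((\<lambda>z. \<Sum>i<N. a i * z ^ i) has_field_derivative d) (at z)" for z
    by (rule exI, (rule derivative_eq_intros refl)+)
  show "smooth_on UNIV (\<lambda>x::complex ^ 2. \<Sum>i<N. a i * x $ 1 ^ i)"
    by (intro smooth_on_sum smooth_on_mult smooth_on_const smooth_on_power smooth_on_component open_UNIV)
qed

lemma admissible_monom: "admissible (\<lambda>z. z ^ j)"
proof -
  have "(\<lambda>z. \<Sum>i<Suc j. (if i = j then 1 else 0) * z ^ i) = (\<lambda>z::complex. z ^ j)"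
    by (auto simp: fun_eq_iff)
  then show ?thesis using admissible_poly[of "\<lambda>i. if i = j then 1 else 0" "Suc j"] by simp
qed

lemma has_dzbar_admissible: "admissible P \<Longrightarrow> has_dzbar j (\<lambda>x. P (x $ i)) 0 x"
  unfolding admissible_def using has_dzbar_holomorphic by blast

text \<open>What remains of \<open>primitive2\<close> after differentiation in the first variable:
  the factor z is the derivative of |z|^2 with respect to the conjugate, and the sign is that of
  \<open>d_zbar 1\<close> in \<open>dbar_UNIV\<close>.\<close>

definition top_coeff :: "(complex \<Rightarrow> complex) \<Rightarrow> complex ^ 2 \<Rightarrow> complex" where
  "top_coeff P x = - (shell_weight x * x $ 1 * P (x $ 1))"

text \<open>The function H_k of the overview. Its cutoff acts between |w| = 3/4 and |w| = 7/8.
  Staying below 1 makes it vanish near the points of the complement with z = 0, where the inverse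
  has its default value.\<close>

definition pole :: "nat \<Rightarrow> complex ^ 2 \<Rightarrow> complex" where
  "pole k x = inverse (x $ 1) ^ Suc k * radial (cutoff (9/16) (49/64)) 2 x"

definition dbar_pole :: "nat \<Rightarrow> complex ^ 2 \<Rightarrow> complex" where
  "dbar_pole k x = inverse (x $ 1) ^ Suc k * (radial (cutoff' (9/16) (49/64)) 2 x * x $ 2)"

lemma top_coeff_eq_0: "x \<notin> shell \<Longrightarrow> top_coeff P x = 0"
  by (simp add: top_coeff_def shell_weight_eq_0)

text \<open>On the shell |w| <= 1/4, where the cutoff of the pole is 1, and the factor z of the
  source cancels one order of the pole.\<close>

lemma top_coeff_mult_pole: "top_coeff P x * pole k x = - (shell_weight x * P (x $ 1) * inverse (x $ 1) ^ k)"
proof (cases "x \<in> shell")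
  case True
  then have "x $ 1 \<noteq> 0" "radial (cutoff (9/16) (49/64)) 2 x = 1"
    using shell_nz[OF True] by (auto simp: shell_def radial_def cutoff_eq_1)
  then show ?thesis by (simp add: top_coeff_def pole_def)
qed (simp add: top_coeff_def shell_weight_eq_0)

lemma integrable_shell:
  fixes F :: "complex ^ 2 \<Rightarrow> complex"
  assumes "open U" "smooth_on U F" "shell \<subseteq> U" "\<And>x. x \<notin> shell \<Longrightarrow> F x = 0"
  shows "integrable lborel F"
  by (rule integrable_smooth_compact_support[OF assms(1,2) compact_shell assms(3,4)])

lemma integrable_moment: "integrable lborel (\<lambda>x. shell_weight x * x $ 1 ^ j * inverse (x $ 1) ^ k)"
  by (rule integrable_shell[of "{x. x $ 1 \<noteq> 0}"])
    (auto intro!: smooth_on_mult smooth_on_shell_weight smooth_on_power smooth_on_component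
      smooth_on_inverse_power open_component_neq dest: shell_nz simp: shell_weight_eq_0)

lemma integral_top_coeff_poly_pole:
  "(\<integral>x. top_coeff (\<lambda>z. \<Sum>i<N. a i * z ^ i) x * pole k x \<partial>lborel)
    = - ((if k < N then a k else 0) * integral\<^sup>L lborel shell_weight)"
proof -
  have "(\<integral>x. top_coeff (\<lambda>z. \<Sum>i<N. a i * z ^ i) x * pole k x \<partial>lborel)
      = (\<integral>x. - (\<Sum>i<N. a i * (shell_weight x * x $ 1 ^ i * inverse (x $ 1) ^ k)) \<partial>lborel)"
    unfolding top_coeff_mult_pole
    by (intro Bochner_Integration.integral_cong) (auto simp: sum_distrib_left sum_distrib_right mult_ac)
  also have "\<dots> = - (\<Sum>i<N. a i * (\<integral>x. shell_weight x * x $ 1 ^ i * inverse (x $ 1) ^ k \<partial>lborel))"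
    using integrable_moment by (simp add: Bochner_Integration.integral_sum)
  also have "\<dots> = - (\<Sum>i<N. (if i = k then a k * integral\<^sup>L lborel shell_weight else 0))"
    unfolding moment by (intro arg_cong[where f=uminus] sum.cong) auto
  finally show ?thesis by simp
qed

lemma integral_top_coeff_monom_pole:
  "(\<integral>x. top_coeff (\<lambda>z. z ^ j) x * (\<Sum>k<N. b k * pole k x) \<partial>lborel)
    = - ((if j < N then b j else 0) * integral\<^sup>L lborel shell_weight)"
proof -
  have "(\<integral>x. top_coeff (\<lambda>z. z ^ j) x * (\<Sum>k<N. b k * pole k x) \<partial>lborel)
      = (\<integral>x. - (\<Sum>k<N. b k * (shell_weight x * x $ 1 ^ j * inverse (x $ 1) ^ k)) \<partial>lborel)"
  proof (intro Bochner_Integration.integral_cong refl)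
    fix x
    have "top_coeff (\<lambda>z. z ^ j) x * (\<Sum>k<N. b k * pole k x) = (\<Sum>k<N. b k * (top_coeff (\<lambda>z. z ^ j) x * pole k x))"
      by (simp add: sum_distrib_left mult_ac)
    then show "top_coeff (\<lambda>z. z ^ j) x * (\<Sum>k<N. b k * pole k x)
        = - (\<Sum>k<N. b k * (shell_weight x * x $ 1 ^ j * inverse (x $ 1) ^ k))"
      unfolding top_coeff_mult_pole by (simp add: sum_negf)
  qed
  also have "\<dots> = - (\<Sum>k<N. b k * (\<integral>x. shell_weight x * x $ 1 ^ j * inverse (x $ 1) ^ k \<partial>lborel))"
    using integrable_moment by (simp add: Bochner_Integration.integral_sum)
  also have "\<dots> = - (\<Sum>k<N. (if k = j then b j * integral\<^sup>L lborel shell_weight else 0))"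
    unfolding moment by (intro arg_cong[where f=uminus] sum.cong) auto
  finally show ?thesis by simp
qed

text \<open>The condition \<open>q > 1\<close> leaves room around the closed unit bidisc, inside the
  ball, in which the potential of the correcting exact form can be cut off.\<close>

locale hartogs_complement =
  fixes c :: "complex ^ 2" and R q :: real
  assumes q: "q > 1"
    and polydisc: "{x. (norm (x $ 1))\<^sup>2 \<le> q \<and> (norm (x $ 2))\<^sup>2 \<le> q} \<subseteq> ball c R"
begin

definition \<Omega> :: "(complex ^ 2) set" where
  "\<Omega> = ball c R - closure hartogs_triangle"

lemma open_Omega: "open \<Omega>"
  unfolding \<Omega>_def by (intro open_Diff open_ball closed_closure)

lemma Omega_cases:
  assumes "x \<in> \<Omega>"
  obtains "norm (x $ 2) < norm (x $ 1)" | "norm (x $ 2) > 1"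
  using assms unfolding \<Omega>_def closure_hartogs_triangle by force

lemma in_OmegaI:
  assumes "(norm (x $ 1))\<^sup>2 \<le> q" "(norm (x $ 2))\<^sup>2 \<le> q" "(norm (x $ 2))\<^sup>2 < (norm (x $ 1))\<^sup>2 \<or> (norm (x $ 2))\<^sup>2 > 1"
  shows "x \<in> \<Omega>"
proof -
  have "norm (x $ 2) < norm (x $ 1) \<or> norm (x $ 2) > 1"
    using assms(3) power_less_imp_less_base[of "norm (x $ 2)" 2 "norm (x $ 1)"]
      power_less_imp_less_base[of 1 2 "norm (x $ 2)"] by auto
  then show ?thesis
    using assms polydisc unfolding \<Omega>_def closure_hartogs_triangle by auto
qed

lemma shell_subset: "shell \<subseteq> \<Omega>"
proof
  fix x assume "x \<in> shell"
  with q show "x \<in> \<Omega>"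
    by (intro in_OmegaI) (auto simp: shell_def)
qed

text \<open>A point of \<open>\<Omega>\<close> with z = 0 cannot have |w| < |z|, so |w| > 1. The
  poles are visibly smooth on each of the two open sets.\<close>

lemma Omega_cover: "\<Omega> \<subseteq> {x. x $ 1 \<noteq> 0} \<union> {x. (norm (x $ 2))\<^sup>2 > 49/64}"
proof
  fix x assume "x \<in> \<Omega>"
  then show "x \<in> {x. x $ 1 \<noteq> 0} \<union> {x. (norm (x $ 2))\<^sup>2 > 49/64}"
  proof (cases rule: Omega_cases)
    case 2
    then have "(norm (x $ 2))\<^sup>2 > 1" by (simp add: one_less_power)
    then show ?thesis by simp
  qed auto
qed

lemma pole_eq_0: "(norm (x $ 2))\<^sup>2 > 49/64 \<Longrightarrow> pole k x = 0"
  "(norm (x $ 2))\<^sup>2 > 49/64 \<Longrightarrow> dbar_pole k x = 0"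
  by (simp_all add: pole_def dbar_pole_def radial_def cutoff_eq_0 cutoff'_eq_0)

lemma smooth_on_pole: "smooth_on \<Omega> (pole k)" and smooth_on_dbar_pole: "smooth_on \<Omega> (dbar_pole k)"
proof -
  have "smooth_on {x. x $ 1 \<noteq> 0} (pole k)" "smooth_on {x. x $ 1 \<noteq> 0} (dbar_pole k)"
    unfolding pole_def[abs_def] dbar_pole_def[abs_def]
    by (intro smooth_on_mult smooth_on_inverse_power smooth_on_radial_cutoff smooth_on_radial_cutoff'
        smooth_on_component open_component_neq; simp)+
  moreover have "smooth_on {x. (norm (x $ 2))\<^sup>2 > 49/64} (pole k)" "smooth_on {x. (norm (x $ 2))\<^sup>2 > 49/64} (dbar_pole k)"
    by (rule smooth_on_cong[OF open_norm_gt _ smooth_on_const[OF open_norm_gt, of _ _ 0]], simp add: pole_eq_0)+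
  ultimately have "smooth_on ({x. x $ 1 \<noteq> 0} \<union> {x. (norm (x $ 2))\<^sup>2 > 49/64}) (pole k)"
    "smooth_on ({x. x $ 1 \<noteq> 0} \<union> {x. (norm (x $ 2))\<^sup>2 > 49/64}) (dbar_pole k)"
    by (auto intro: smooth_on_Un)
  then show "smooth_on \<Omega> (pole k)" "smooth_on \<Omega> (dbar_pole k)"
    using Omega_cover smooth_on_subset by blast+
qed

lemma has_dzbar_pole:
  assumes "x \<in> \<Omega>"
  shows "has_dzbar 1 (pole k) 0 x" "has_dzbar 2 (pole k) (dbar_pole k x) x"
proof -
  have "has_dzbar 1 (pole k) 0 x \<and> has_dzbar 2 (pole k) (dbar_pole k x) x"
  proof (cases "x $ 1 = 0")
    case False
    have inv: "has_dzbar j (\<lambda>x. inverse (x $ 1) ^ Suc k) 0 x" for j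
      by (rule has_dzbar_holomorphic[OF DERIV_power[OF DERIV_inverse[OF False]]])
    have "has_dzbar 1 (pole k) (0 * radial (cutoff (9/16) (49/64)) 2 x + inverse (x $ 1) ^ Suc k * 0) x"
      unfolding pole_def[abs_def]
      by (intro has_dzbar_mult inv has_dzbar_radial_other smooth_on_cutoff) auto
    moreover have "has_dzbar 2 (pole k) (0 * radial (cutoff (9/16) (49/64)) 2 x + dbar_pole k x) x"
      unfolding pole_def[abs_def] dbar_pole_def
      by (intro has_dzbar_mult inv has_dzbar_radial_cutoff) auto
    ultimately show ?thesis by simp
  next
    case True
    then have x: "(norm (x $ 2))\<^sup>2 > 49/64" using assms Omega_cover by blast
    have "has_dzbar j (pole k) 0 x" for j
      by (rule has_dzbar_cong_open[OF open_norm_gt[of "49/64" 2] _ _ has_dzbar_const[of _ 0]])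
        (use x in \<open>simp_all add: pole_eq_0\<close>)
    then show ?thesis using x by (simp add: pole_eq_0)
  qed
  then show "has_dzbar 1 (pole k) 0 x" "has_dzbar 2 (pole k) (dbar_pole k x) x" by auto
qed

lemma d_zbar_pole: "x \<in> \<Omega> \<Longrightarrow> d_zbar 1 (pole k) x = 0" "x \<in> \<Omega> \<Longrightarrow> d_zbar 2 (pole k) x = dbar_pole k x"
  using has_dzbar_pole unfolding has_dzbar_def by auto

lemma norm_gt_if_annulus:
  assumes "x \<in> \<Omega>" "radial (cutoff' (9/16) (49/64)) 2 x \<noteq> 0"
  shows "norm (x $ 1) > 3/4"
proof -
  have "\<not> ((norm (x $ 2))\<^sup>2 \<le> 9/16 \<or> 49/64 \<le> (norm (x $ 2))\<^sup>2)"
    using assms(2) cutoff'_eq_0[of "(norm (x $ 2))\<^sup>2" "9/16" "49/64"] unfolding radial_def by force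
  moreover have "(3/4::real)\<^sup>2 = 9/16" by (simp add: power2_eq_square)
  ultimately have *: "(norm (x $ 2))\<^sup>2 > (3/4)\<^sup>2" "(norm (x $ 2))\<^sup>2 < 1" by linarith+
  then have **: "norm (x $ 2) > 3/4" "norm (x $ 2) < 1"
    using power_less_imp_less_base[of "3/4" 2 "norm (x $ 2)"] power_less_imp_less_base[of "norm (x $ 2)" 2 1]
    by auto
  from assms(1) show ?thesis
    by (cases rule: Omega_cases) (use ** in auto)
qed

section \<open>Compactly supported primitives of the sources\<close>

definition q_mid :: real where "q_mid = (1 + q) / 2"

lemma q_mid: "1 < q_mid" "q_mid < q" using q by (auto simp: q_mid_def)

text \<open>With \<open>\<rho>\<close>, \<open>\<chi>\<close> and \<open>\<kappa>\<close> the cutoff functions for \<open>(1/64, 1/16)\<close>, \<open>(1/9, 1/4)\<close> and \<open>(q_mid, q)\<close>, the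
  \<open>(0,1)\<close>-form with the coefficients below is \<open>\<chi>(|z|\<^sup>2) P(z) \<rho>'(|w|\<^sup>2)\<close> times the differential of the
  conjugate of \<open>w\<close>, minus the exact form with potential \<open>\<kappa>(|z|\<^sup>2) \<kappa>(|w|\<^sup>2) P(z) \<sigma>(w)\<close>, which cancels it
  near the closed triangle.\<close>

definition primitive1 :: "(complex \<Rightarrow> complex) \<Rightarrow> complex ^ 2 \<Rightarrow> complex" where
  "primitive1 P x = - ((radial (cutoff' q_mid q) 1 x * x $ 1 * P (x $ 1)) * (radial (cutoff q_mid q) 2 x * \<sigma> x))"

definition primitive2 :: "(complex \<Rightarrow> complex) \<Rightarrow> complex ^ 2 \<Rightarrow> complex" where
  "primitive2 P x = radial (cutoff (1/9) (1/4)) 1 x * P (x $ 1) * radial (cutoff' (1/64) (1/16)) 2 x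
    - radial (cutoff q_mid q) 1 x * P (x $ 1) *
      (radial (cutoff' q_mid q) 2 x * (radial (cutoff (1/64) (1/16)) 2 x - 1)
        + radial (cutoff q_mid q) 2 x * radial (cutoff' (1/64) (1/16)) 2 x)"

text \<open>The removed open set is a neighbourhood of the closed triangle, at whose points either
  |z| < 1/3 or |w| >= |z| >= 1/3 > 1/4. On it the two parts of the form cancel.\<close>

definition primitive_support :: "(complex ^ 2) set" where
  "primitive_support = {x. (norm (x $ 1))\<^sup>2 \<le> q \<and> (norm (x $ 2))\<^sup>2 \<le> q}
    - ({x. (norm (x $ 1))\<^sup>2 < q_mid} \<inter> {x. (norm (x $ 2))\<^sup>2 < q_mid} \<inter>
       ({x. (norm (x $ 1))\<^sup>2 < 1/9} \<union> {x. (norm (x $ 2))\<^sup>2 > 1/16}))"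

lemma compact_primitive_support: "compact primitive_support"
  unfolding primitive_support_def
  by (intro compact_diff compact_polydisc open_Int open_Un open_norm_lt open_norm_gt)

lemma primitive_support_subset: "primitive_support \<subseteq> \<Omega>"
proof
  fix x assume x: "x \<in> primitive_support"
  show "x \<in> \<Omega>"
    by (rule in_OmegaI) (use x q_mid in \<open>auto simp: primitive_support_def\<close>)
qed

lemma primitive_eq_0:
  assumes "x \<notin> primitive_support"
  shows "primitive1 P x = 0" "primitive2 P x = 0"
proof -
  let ?a = "(norm (x $ 1))\<^sup>2" and ?b = "(norm (x $ 2))\<^sup>2"
  consider "?a > q" | "?b > q" | "?a < q_mid" "?b < q_mid" "?a < 1/9 \<or> ?b > 1/16"
    using assms unfolding primitive_support_def by force
  then have "primitive1 P x = 0 \<and> primitive2 P x = 0"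
  proof cases
    case 1
    then show ?thesis using q by (simp add: primitive1_def primitive2_def radial_def cutoff_eq_0 cutoff'_eq_0)
  next
    case 2
    then show ?thesis using q by (simp add: primitive1_def primitive2_def radial_def cutoff_eq_0 cutoff'_eq_0)
  next
    case 3
    then have "primitive1 P x = 0" by (simp add: primitive1_def radial_def cutoff'_eq_0)
    \<comment> \<open>Both outer cutoffs are 1 here, so \<open>primitive2\<close> is (\<chi> - 1) P
      \<rho>', and one of the factors \<chi> - 1 and \<rho>' is zero.\<close>
    moreover have "radial (cutoff (1/9) (1/4)) 1 x = 1 \<or> radial (cutoff' (1/64) (1/16)) 2 x = 0"
      using 3 by (auto simp: radial_def cutoff_eq_1 cutoff'_eq_0)
    moreover have "radial (cutoff q_mid q) 1 x = 1" "radial (cutoff q_mid q) 2 x = 1" "radial (cutoff' q_mid q) 2 x = 0"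
      using 3 q_mid by (simp_all add: radial_def cutoff_eq_1 cutoff'_eq_0)
    ultimately show ?thesis by (auto simp: primitive2_def)
  qed
  then show "primitive1 P x = 0" "primitive2 P x = 0" by auto
qed

lemma smooth_on_primitive:
  assumes "admissible P"
  shows "smooth_on UNIV (primitive1 P)" "smooth_on UNIV (primitive2 P)"
proof -
  have P: "smooth_on UNIV (\<lambda>x::complex ^ 2. P (x $ 1))" using assms by (simp add: admissible_def)
  show "smooth_on UNIV (primitive1 P)"
    unfolding primitive1_def[abs_def]
    by (intro smooth_on_uminus smooth_on_mult smooth_on_radial_cutoff smooth_on_radial_cutoff' smooth_on_component
        smooth_on_sigma P open_UNIV q_mid)
  show "smooth_on UNIV (primitive2 P)"
    unfolding primitive2_def[abs_def]
    by (intro smooth_on_diff smooth_on_add smooth_on_mult smooth_on_radial_cutoff smooth_on_radial_cutoff'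
        smooth_on_const P open_UNIV q_mid) auto
qed

text \<open>The exact part must contribute nothing, and its mixed terms cancel in pairs: those with
  \<kappa>'(|w|^2) by \<open>mult_sigma\<close>, those with \<rho>' by
  \<open>has_dzbar_sigma\<close>.\<close>

lemma d_zbar_primitive:
  assumes "admissible P"
  shows "d_zbar 2 (primitive1 P) x - d_zbar 1 (primitive2 P) x = top_coeff P x"
proof -
  note P = has_dzbar_admissible[OF assms]
  have other: "has_dzbar 2 (radial (cutoff' s t) 1) 0 x" "has_dzbar 1 (radial (cutoff' s t) 2) 0 x" for s t
    by (intro has_dzbar_radial_other smooth_on_cutoff'; simp)+
  have other': "has_dzbar 1 (radial (cutoff s t) 2) 0 x" if "s < t" for s t
    by (intro has_dzbar_radial_other smooth_on_cutoff that; simp)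
  have comp: "has_dzbar 2 (\<lambda>x. x $ 1) 0 x"
    by (rule has_dzbar_holomorphic[OF DERIV_ident])
  have A: "has_dzbar 2 (\<lambda>x. radial (cutoff' q_mid q) 1 x * x $ 1 * P (x $ 1)) 0 x"
    by (rule has_dzbar_eq_rhs, (rule has_dzbar_mult other comp P)+, simp)
  have E: "has_dzbar 1 (\<lambda>x. radial (cutoff' q_mid q) 2 x * (radial (cutoff (1/64) (1/16)) 2 x - 1)
        + radial (cutoff q_mid q) 2 x * radial (cutoff' (1/64) (1/16)) 2 x) 0 x"
    by (rule has_dzbar_eq_rhs[OF has_dzbar_add[OF has_dzbar_mult[OF other(2)
        has_dzbar_diff[OF other' has_dzbar_const]] has_dzbar_mult[OF other' other(2)]]])
      (simp_all add: q_mid)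
  have 2: "has_dzbar 2 (primitive1 P) (- (0 * (radial (cutoff q_mid q) 2 x * \<sigma> x) + radial (cutoff' q_mid q) 1 x * x $ 1 * P (x $ 1) *
      (radial (cutoff' q_mid q) 2 x * x $ 2 * \<sigma> x + radial (cutoff q_mid q) 2 x * radial (cutoff' (1/64) (1/16)) 2 x))) x"
    unfolding primitive1_def[abs_def]
    by (rule has_dzbar_uminus has_dzbar_mult A has_dzbar_radial_cutoff has_dzbar_sigma q_mid)+
  have B: "has_dzbar 1 (\<lambda>x. radial (cutoff s t) 1 x * P (x $ 1)) (radial (cutoff' s t) 1 x * x $ 1 * P (x $ 1)) x"
    if "s < t" for s t
    using has_dzbar_mult[OF has_dzbar_radial_cutoff[OF that] P] by simp
  have 1: "has_dzbar 1 (primitive2 P)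
      ((radial (cutoff' (1/9) (1/4)) 1 x * x $ 1 * P (x $ 1) * radial (cutoff' (1/64) (1/16)) 2 x
          + radial (cutoff (1/9) (1/4)) 1 x * P (x $ 1) * 0)
       - (radial (cutoff' q_mid q) 1 x * x $ 1 * P (x $ 1) *
         (radial (cutoff' q_mid q) 2 x * (radial (cutoff (1/64) (1/16)) 2 x - 1)
           + radial (cutoff q_mid q) 2 x * radial (cutoff' (1/64) (1/16)) 2 x)
          + radial (cutoff q_mid q) 1 x * P (x $ 1) * 0)) x"
    unfolding primitive2_def[abs_def]
    by (intro has_dzbar_diff has_dzbar_mult[OF B other(2)] has_dzbar_mult[OF B E] q_mid) simp
  from 1 2 show ?thesis
    unfolding has_dzbar_def top_coeff_def shell_weight_def by (simp add: mult_ac flip: mult_sigma)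
qed

definition primitive_form :: "(complex \<Rightarrow> complex) \<Rightarrow> 2 form" where
  "primitive_form P = (\<lambda>I J x. if I = {} \<and> J = {1} then primitive1 P x else if I = {} \<and> J = {2} then primitive2 P x else 0)"

lemma primitive_form_in_test_forms:
  assumes "admissible P"
  shows "primitive_form P \<in> test_forms \<Omega> 0 1"
proof -
  have "smooth_on \<Omega> (primitive_form P I J)" for I J
  proof -
    consider "I = {}" "J = {1}" | "I = {}" "J = {2}" | "\<not> (I = {} \<and> J = {1})" "\<not> (I = {} \<and> J = {2})" by blast
    then show ?thesis
    proof cases
      case 3
      then have "primitive_form P I J = (\<lambda>x. 0)" by (auto simp: primitive_form_def fun_eq_iff)
      then show ?thesis by (simp add: smooth_on_const open_Omega)
    qed (use smooth_on_primitive[OF assms] smooth_on_subset in \<open>auto simp: primitive_form_def\<close>)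
  qed
  moreover have "primitive_form P I J z = 0" if "z \<notin> primitive_support" for I J z
    using primitive_eq_0[OF that] by (simp add: primitive_form_def)
  moreover have "primitive_form P I J z = 0" if "card I \<noteq> 0 \<or> card J \<noteq> 1" for I J z
    using that by (auto simp: primitive_form_def)
  ultimately show ?thesis
    using compact_primitive_support primitive_support_subset unfolding test_forms_def smooth_forms_def forms_vanishing_off_def by blast
qed

lemma dbar_primitive_form:
  assumes "admissible P"
  shows "dbar \<Omega> (primitive_form P) = single_form {} UNIV (top_coeff P)"
proof (intro ext)
  fix I J :: "2 set" and x
  show "dbar \<Omega> (primitive_form P) I J x = single_form {} UNIV (top_coeff P) I J x"
  proof (cases "I = {} \<and> J = UNIV")
    case True
    have "primitive_form P {} {1} = primitive1 P" "primitive_form P {} {2} = primitive2 P" by (auto simp: primitive_form_def fun_eq_iff)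
    moreover have "top_coeff P x = 0" if "x \<notin> \<Omega>"
      using that shell_subset top_coeff_eq_0 by blast
    ultimately show ?thesis
      using True d_zbar_primitive[OF assms] by (simp add: dbar_UNIV single_form_def)
  next
    case False
    have "dbar \<Omega> (primitive_form P) I J x = 0"
    proof (rule dbar_eq_0)
      show "primitive_form P \<in> smooth_forms \<Omega> 0 1"
        using primitive_form_in_test_forms[OF assms] by (simp add: test_forms_def)
      show "card I \<noteq> 0 \<or> card J \<noteq> Suc 1"
        using False card_eq_2_iff[of J] by (auto simp: numeral_2_eq_2)
    qed
    then show ?thesis using False by (auto simp: single_form_def)
  qed
qed

lemma dbar_test_image_diff:
  assumes "f \<in> dbar \<Omega> ` test_forms \<Omega> p q'" "g \<in> dbar \<Omega> ` test_forms \<Omega> p q'"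
  shows "f - g \<in> dbar \<Omega> ` test_forms \<Omega> p q'"
proof -
  obtain a b where ab: "f = dbar \<Omega> a" "g = dbar \<Omega> b" "a \<in> test_forms \<Omega> p q'" "b \<in> test_forms \<Omega> p q'"
    using assms by blast
  then have "dbar \<Omega> (a - b) = f - g"
    by (simp add: dbar_diff[of a \<Omega> p q' b] test_forms_def)
  moreover have "a - b \<in> test_forms \<Omega> p q'"
    unfolding form_diff_eq by (rule test_forms_lincomb[OF open_Omega ab(3,4)])
  ultimately show ?thesis by (metis imageI)
qed

lemma dbar_smooth_image_diff:
  assumes "f \<in> dbar \<Omega> ` smooth_forms \<Omega> p q'" "g \<in> dbar \<Omega> ` smooth_forms \<Omega> p q'"
  shows "f - g \<in> dbar \<Omega> ` smooth_forms \<Omega> p q'"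
proof -
  obtain a b where ab: "f = dbar \<Omega> a" "g = dbar \<Omega> b" "a \<in> smooth_forms \<Omega> p q'" "b \<in> smooth_forms \<Omega> p q'"
    using assms by blast
  then have "dbar \<Omega> (a - b) = f - g"
    by (simp add: dbar_diff[of a \<Omega> p q' b])
  moreover have "a - b \<in> smooth_forms \<Omega> p q'"
    unfolding form_diff_eq by (rule smooth_forms_lincomb[OF open_Omega ab(3,4)])
  ultimately show ?thesis by (metis imageI)
qed

end


section \<open>Compactly supported cohomology\<close>

lemma mult_eq_imp_eq_inverse: "a \<noteq> 0 \<Longrightarrow> a * s = b \<Longrightarrow> s = b * inverse a" for a :: "'a::field"
  by (auto simp: field_simps)

context hartogs_complement
begin

text \<open>The sum of the series with ratio 8/5. Its pole 5/8 lies beyond the radius 1/2 of the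
  shell, so the source stays smooth, but below 3/4, which is what the growth estimate
  detects.\<close>

definition cauchy_coeff :: "complex \<Rightarrow> complex" where
  "cauchy_coeff z = inverse (1 - of_real (8/5) * z)"

lemma cauchy_coeff_minus_poly:
  assumes "norm z < 5/8"
  shows "(\<Sum>i<N. of_real (8/5) ^ i * z ^ i) - cauchy_coeff z = - cauchy_coeff z * (of_real (8/5) * z) ^ N"
proof -
  let ?w = "of_real (8/5) * z"
  have "norm ?w < 1" using assms by (simp add: norm_mult)
  then have nz: "1 - ?w \<noteq> 0" by (metis eq_iff_diff_eq_0 norm_one less_irrefl)
  have "(1 - ?w) * (\<Sum>i<N. of_real (8/5) ^ i * z ^ i) = 1 - ?w ^ N"
    using one_diff_power_eq[of ?w N] by (simp only: power_mult_distrib)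
  then have "(\<Sum>i<N. of_real (8/5) ^ i * z ^ i) = (1 - ?w ^ N) * cauchy_coeff z"
    unfolding cauchy_coeff_def by (rule mult_eq_imp_eq_inverse[OF nz])
  then show ?thesis by (simp add: algebra_simps)
qed

lemma smooth_on_top_coeff_poly: "smooth_on U (top_coeff (\<lambda>z. \<Sum>i<N. a i * z ^ i))" if "open U"
  unfolding top_coeff_def[abs_def]
  by (intro smooth_on_uminus smooth_on_mult smooth_on_sum smooth_on_power smooth_on_const
      smooth_on_component smooth_on_shell_weight that)

lemma smooth_on_top_coeff_cauchy_coeff: "smooth_on UNIV (top_coeff cauchy_coeff)"
proof -
  \<comment> \<open>Since 1/4 < 25/64, the two sets cover the space; the first avoids the pole 5/8,
    and on the second the weight vanishes.\<close>
  let ?U = "{x :: complex ^ 2. (norm (x $ 1))\<^sup>2 < 25/64}" and ?V = "{x :: complex ^ 2. (norm (x $ 1))\<^sup>2 > 1/4}"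
  have nz: "1 - of_real (8/5) * x $ 1 \<noteq> (0::complex)" if "(norm (x $ 1))\<^sup>2 < 25/64" for x :: "complex ^ 2"
  proof
    assume "1 - of_real (8/5) * x $ 1 = (0::complex)"
    then have "x $ 1 = of_real (5/8)" by (simp add: field_simps)
    with that show False by (simp add: power2_eq_square norm_divide)
  qed
  have "smooth_on ?U (top_coeff cauchy_coeff)"
    unfolding top_coeff_def[abs_def] cauchy_coeff_def
    by (intro smooth_on_uminus smooth_on_mult smooth_on_inverse smooth_on_diff smooth_on_const
        smooth_on_component smooth_on_shell_weight open_norm_lt) (use nz in auto)
  moreover have "top_coeff cauchy_coeff x = 0" if "x \<in> ?V" for x
    using that by (intro top_coeff_eq_0) (auto simp: shell_def)
  then have "smooth_on ?V (top_coeff cauchy_coeff)"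
    by (intro smooth_on_cong[OF open_norm_gt _ smooth_on_const[OF open_norm_gt, of _ _ 0]]) simp
  ultimately have "smooth_on (?U \<union> ?V) (top_coeff cauchy_coeff)" by (rule smooth_on_Un)
  moreover have "?U \<union> ?V = UNIV" by auto
  ultimately show ?thesis by simp
qed

lemma norm_le_on_shell: "x \<in> shell \<Longrightarrow> norm (x $ 1) \<le> 1/2"
  using power2_le_imp_le[of "norm (x $ 1)" "1/2"] by (auto simp: shell_def power2_eq_square)

lemma top_coeff_poly_minus_cauchy_coeff:
  "top_coeff (\<lambda>z. \<Sum>i<N. of_real (8/5) ^ i * z ^ i) x - top_coeff cauchy_coeff x = - top_coeff cauchy_coeff x * (of_real (8/5) * x $ 1) ^ N"
proof (cases "x \<in> shell")
  case True
  then have "norm (x $ 1) < 5/8" using norm_le_on_shell by fastforce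
  note e = cauchy_coeff_minus_poly[OF this, of N]
  have "top_coeff (\<lambda>z. \<Sum>i<N. of_real (8/5) ^ i * z ^ i) x - top_coeff cauchy_coeff x
      = - (shell_weight x * x $ 1) * ((\<Sum>i<N. of_real (8/5) ^ i * x $ 1 ^ i) - cauchy_coeff (x $ 1))"
    unfolding top_coeff_def by (simp add: right_diff_distrib mult.assoc)
  then show ?thesis unfolding e top_coeff_def by (simp add: mult_ac)
qed (simp add: top_coeff_eq_0)

lemma integral_top_coeff_cauchy_coeff_pole:
  "(\<integral>x. top_coeff cauchy_coeff x * pole k x \<partial>lborel) = - (of_real (8/5) ^ k * integral\<^sup>L lborel shell_weight)"
proof -
  let ?P = "\<lambda>N z. \<Sum>i<N. of_real (8/5) ^ i * z ^ i :: complex"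
  have sm: "smooth_on \<Omega> (\<lambda>x. top_coeff (?P N) x * pole k x)" "smooth_on \<Omega> (\<lambda>x. top_coeff cauchy_coeff x * pole k x)" for N
    by (intro smooth_on_mult open_Omega smooth_on_top_coeff_poly smooth_on_pole
        smooth_on_subset[OF smooth_on_top_coeff_cauchy_coeff]; simp)+
  \<comment> \<open>The ratio 4/5 is 8/5 times the outer radius 1/2 of the shell.\<close>
  have "\<exists>C. \<forall>N. norm (\<integral>x. top_coeff (?P N) x * pole k x - top_coeff cauchy_coeff x * pole k x \<partial>lborel) \<le> C * (4/5) ^ N"
  proof (rule integral_geometric_bound[OF open_Omega _ compact_shell shell_subset])
    show "continuous_on shell (\<lambda>x. top_coeff cauchy_coeff x * pole k x)"
      by (rule continuous_on_subset[OF smooth_on_imp_continuous_on[OF sm(2)] shell_subset])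
    fix x :: "complex ^ 2" and N assume x: "x \<in> shell"
    have "top_coeff (?P N) x * pole k x - top_coeff cauchy_coeff x * pole k x = (top_coeff (?P N) x - top_coeff cauchy_coeff x) * pole k x"
      by (rule left_diff_distrib[symmetric])
    also have "\<dots> = - (top_coeff cauchy_coeff x * pole k x) * (of_real (8/5) * x $ 1) ^ N"
      unfolding top_coeff_poly_minus_cauchy_coeff by (simp only: mult_minus_left mult_minus_right mult_ac)
    finally have "top_coeff (?P N) x * pole k x - top_coeff cauchy_coeff x * pole k x
        = - (top_coeff cauchy_coeff x * pole k x) * (of_real (8/5) * x $ 1) ^ N" .
    moreover have "norm (of_real (8/5) * x $ 1) ^ N \<le> (4/5) ^ N"
      using norm_le_on_shell[OF x] by (intro power_mono) (auto simp: norm_mult)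
    ultimately show "norm (top_coeff (?P N) x * pole k x - top_coeff cauchy_coeff x * pole k x)
        \<le> norm (top_coeff cauchy_coeff x * pole k x) * (4/5) ^ N"
      by (simp only: norm_mult norm_minus_cancel norm_power) (intro mult_left_mono, auto)
  next
    show "smooth_on \<Omega> (\<lambda>x. top_coeff (?P N) x * pole k x - top_coeff cauchy_coeff x * pole k x)" for N
      by (intro smooth_on_diff open_Omega sm)
  qed (simp_all add: top_coeff_eq_0)
  then obtain C where C: "norm (\<integral>x. top_coeff (?P N) x * pole k x - top_coeff cauchy_coeff x * pole k x \<partial>lborel) \<le> C * (4/5) ^ N" for N
    by blast
  have "- (of_real (8/5) ^ k * integral\<^sup>L lborel shell_weight) = (\<integral>x. top_coeff cauchy_coeff x * pole k x \<partial>lborel)"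
  proof (rule eq_if_geometric_bound[where j=k and C=C and \<rho>="4/5"])
    fix N assume "k < N"
    have "(\<integral>x. top_coeff (?P N) x * pole k x - top_coeff cauchy_coeff x * pole k x \<partial>lborel)
        = - (of_real (8/5) ^ k * integral\<^sup>L lborel shell_weight) - (\<integral>x. top_coeff cauchy_coeff x * pole k x \<partial>lborel)"
    proof (subst Bochner_Integration.integral_diff)
      show "integrable lborel (\<lambda>x. top_coeff (?P N) x * pole k x)" "integrable lborel (\<lambda>x. top_coeff cauchy_coeff x * pole k x)"
        by (rule integrable_shell[OF open_Omega sm(1) shell_subset] integrable_shell[OF open_Omega sm(2) shell_subset];
            simp add: top_coeff_eq_0)+
      show "(\<integral>x. top_coeff (?P N) x * pole k x \<partial>lborel) - (\<integral>x. top_coeff cauchy_coeff x * pole k x \<partial>lborel)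
          = - (of_real (8/5) ^ k * integral\<^sup>L lborel shell_weight) - (\<integral>x. top_coeff cauchy_coeff x * pole k x \<partial>lborel)"
        using \<open>k < N\<close> unfolding integral_top_coeff_poly_pole by simp
    qed
    then show "norm (- (of_real (8/5) ^ k * integral\<^sup>L lborel shell_weight) - (\<integral>x. top_coeff cauchy_coeff x * pole k x \<partial>lborel)) \<le> C * (4/5) ^ N"
      using C[of N] by simp
  qed auto
  then show ?thesis by simp
qed

lemma cauchy_form_not_exact: "single_form {} UNIV (top_coeff cauchy_coeff) \<notin> dbar \<Omega> ` test_forms \<Omega> 0 1"
proof
  assume "single_form {} UNIV (top_coeff cauchy_coeff) \<in> dbar \<Omega> ` test_forms \<Omega> 0 1"
  then obtain v K where v: "single_form {} UNIV (top_coeff cauchy_coeff) = dbar \<Omega> v" "v \<in> smooth_forms \<Omega> 0 1"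
    and K: "compact K" "K \<subseteq> \<Omega>" "v \<in> forms_vanishing_off K"
    unfolding test_forms_def by blast
  have sm: "smooth_on \<Omega> (v {} J)" for J using v(2) by (simp add: smooth_forms_def)
  have v0: "v {} J x = 0" if "x \<notin> K" for J x using K(3) that by (simp add: forms_vanishing_off_def)
  have "d_zbar 2 (v {} {1}) x - d_zbar 1 (v {} {2}) x = top_coeff cauchy_coeff x" if "x \<in> \<Omega>" for x
    using fun_cong[OF fun_cong[OF fun_cong[OF v(1)]], of "{}" UNIV x] that
    by (simp add: dbar_UNIV single_form_def)
  moreover have "top_coeff cauchy_coeff x = 0" if "x \<notin> \<Omega>" for x
    using that shell_subset top_coeff_eq_0 by blast
  ultimately have pair: "(\<integral>x. top_coeff cauchy_coeff x * pole k x \<partial>lborel) = - (\<integral>x. v {} {1} x * dbar_pole k x \<partial>lborel)" for k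
    by (intro dbar_pairing_coeff[OF open_Omega sm sm smooth_on_pole K(1,2) v0 v0 _ _ d_zbar_pole])
  have "\<exists>C. \<forall>k. norm (\<integral>x. v {} {1} x * dbar_pole k x \<partial>lborel) \<le> C * (4/3) ^ k"
  \<comment> \<open>Where the derivative of the pole is nonzero on \<open>\<Omega>\<close>, |z| >
    3/4; hence the ratio 4/3. The additional factor 4/3 in \<open>A\<close> absorbs the exponent
    \<open>Suc k\<close>.\<close>
  proof (rule integral_geometric_bound[OF open_Omega _ K(1,2),
      where A="\<lambda>x. v {} {1} x * (radial (cutoff' (9/16) (49/64)) 2 x * x $ 2) * (4/3)"])
    show "smooth_on \<Omega> (\<lambda>x. v {} {1} x * dbar_pole k x)" for k
      by (intro smooth_on_mult open_Omega sm smooth_on_dbar_pole)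
    have "smooth_on \<Omega> (\<lambda>x. v {} {1} x * (radial (cutoff' (9/16) (49/64)) 2 x * x $ 2) * (4/3))"
      by (intro smooth_on_mult open_Omega sm smooth_on_radial_cutoff' smooth_on_component smooth_on_const)
    then show "continuous_on K (\<lambda>x. v {} {1} x * (radial (cutoff' (9/16) (49/64)) 2 x * x $ 2) * (4/3))"
      by (rule continuous_on_subset[OF smooth_on_imp_continuous_on K(2)])
    fix x and k :: nat assume x: "x \<in> K"
    let ?w = "v {} {1} x * (radial (cutoff' (9/16) (49/64)) 2 x * x $ 2)"
    have eq: "v {} {1} x * dbar_pole k x = ?w * inverse (x $ 1) ^ Suc k"
      by (simp add: dbar_pole_def mult_ac)
    have "norm (?w * inverse (x $ 1) ^ Suc k) \<le> norm ?w * (4/3) ^ Suc k"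
    proof (cases "radial (cutoff' (9/16) (49/64)) 2 x = 0")
      case False
      have "norm (x $ 1) > 3/4" using norm_gt_if_annulus[OF _ False] x K(2) by blast
      then have "norm (inverse (x $ 1)) \<le> 4/3"
        using le_imp_inverse_le[of "3/4" "norm (x $ 1)"] by (simp add: norm_inverse)
      then show ?thesis
        unfolding norm_mult[of ?w] norm_power by (intro mult_left_mono power_mono) auto
    qed simp
    then show "norm (v {} {1} x * dbar_pole k x) \<le> norm (?w * (4/3)) * (4/3) ^ k"
      unfolding eq by (simp add: norm_mult mult_ac)
  qed (simp_all add: v0)
  then obtain C where "norm (\<integral>x. v {} {1} x * dbar_pole k x \<partial>lborel) \<le> C * (4/3) ^ k" for k by blast
  then have "norm (of_real (8/5) ^ k * integral\<^sup>L lborel shell_weight) \<le> C * (4/3) ^ k" for k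
    using pair[of k] integral_top_coeff_cauchy_coeff_pole[of k] by simp
  then show False
    by (rule geometric_growth_contradiction) (use integral_shell_weight_neq_0 in auto)
qed

theorem not_Hausdorff_dolbeault_c: "\<not> Hausdorff_space (dolbeault_c \<Omega> 0 2)"
proof -
  have "dolbeault_c \<Omega> 0 2 = cohomology_space \<Omega> (test_forms_topology \<Omega> 0 2) (dbar \<Omega> ` test_forms \<Omega> 0 1)"
    by (simp add: dolbeault_c_def numeral_2_eq_2)
  moreover have "\<not> Hausdorff_space (cohomology_space \<Omega> (test_forms_topology \<Omega> 0 2) (dbar \<Omega> ` test_forms \<Omega> 0 1))"
  proof (rule not_Hausdorff_cohomology_space)
    let ?P = "\<lambda>N z. \<Sum>i<N. of_real (8/5) ^ i * z ^ i :: complex"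
    let ?g = "single_form {} UNIV (top_coeff cauchy_coeff) :: 2 form"
    let ?G = "\<lambda>N. single_form {} UNIV (top_coeff (?P N)) :: 2 form"
    have sg: "?g \<in> smooth_forms \<Omega> 0 2" and sG: "?G N \<in> smooth_forms \<Omega> 0 2" for N
      using shell_subset
      by (auto intro!: single_form_in_smooth_forms open_Omega smooth_on_top_coeff_poly top_coeff_eq_0
          smooth_on_subset[OF smooth_on_top_coeff_cauchy_coeff])
    have vg: "?g \<in> forms_vanishing_off shell" and vG: "?G N \<in> forms_vanishing_off shell" for N
      by (auto simp: forms_vanishing_off_def single_form_def top_coeff_eq_0)
    show "0 \<in> dbar \<Omega> ` test_forms \<Omega> 0 1"
      by (rule image_eqI[OF _ zero_in_test_forms[OF open_Omega]]) (simp add: dbar_zero)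
    show "f - g \<in> dbar \<Omega> ` test_forms \<Omega> 0 1"
      if "f \<in> dbar \<Omega> ` test_forms \<Omega> 0 1" "g \<in> dbar \<Omega> ` test_forms \<Omega> 0 1" for f g
      using that by (rule dbar_test_image_diff)
    show "0 \<in> topspace (test_forms_topology \<Omega> 0 2)"
      by (simp add: topspace_test_forms_topology open_Omega zero_in_test_forms)
    show "dbar \<Omega> 0 = 0" by (rule dbar_zero)
    show "dbar \<Omega> ?g = 0" by (rule dbar_closed_top[OF sg])
    show "?g \<notin> dbar \<Omega> ` test_forms \<Omega> 0 1" by (rule cauchy_form_not_exact)
    show "dbar \<Omega> (?G N) = 0" for N by (rule dbar_closed_top[OF sG])
    show "?G N \<in> dbar \<Omega> ` test_forms \<Omega> 0 1" for N
      using imageI[OF primitive_form_in_test_forms[OF admissible_poly[where N=N and a="\<lambda>i. of_real (8/5) ^ i"]], of "dbar \<Omega>"]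
      by (simp only: dbar_primitive_form[OF admissible_poly])
    show "?G N \<in> topspace (test_forms_topology \<Omega> 0 2)" for N
      unfolding topspace_test_forms_topology[OF open_Omega] test_forms_def
      using sG vG compact_shell shell_subset by blast
    show "limitin (test_forms_topology \<Omega> 0 2) ?G ?g sequentially"
    proof (rule limitin_test_forms_topology[OF open_Omega sg sG compact_shell shell_subset vg vG])
      fix I J :: "2 set" and vs and K :: "(complex ^ 2) set" assume K: "compact K" "K \<subseteq> \<Omega>"
      show "uniform_limit K (\<lambda>N. iter_deriv vs (?G N I J)) (iter_deriv vs (?g I J)) sequentially"
      proof (cases "I = {} \<and> J = UNIV")
        case True
        \<comment> \<open>The bound |z| < 5/8 holds around the shell and makes the ratio (8/5) z
          smaller than 1 in norm; z = 0 is excluded because the ratio must not vanish.\<close>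
        let ?U = "\<Omega> \<inter> {x. (norm (x $ 1))\<^sup>2 < 25/64} \<inter> {x. x $ 1 \<noteq> 0}"
        have "uniform_limit K (\<lambda>N. iter_deriv vs (top_coeff (?P N))) (iter_deriv vs (top_coeff cauchy_coeff)) sequentially"
        proof (rule uniform_limit_iter_deriv_geometric_error[where U="?U" and C=shell
              and Q="\<lambda>x. - top_coeff cauchy_coeff x" and \<theta>="\<lambda>x. of_real (8/5) * x $ 1", OF open_Omega])
          show "smooth_on \<Omega> (top_coeff cauchy_coeff)" "smooth_on ?U (\<lambda>x. - top_coeff cauchy_coeff x)"
            by (intro smooth_on_uminus smooth_on_subset[OF smooth_on_top_coeff_cauchy_coeff] subset_UNIV
                open_Int open_Omega open_norm_lt open_component_neq)+
          show "smooth_on \<Omega> (top_coeff (?P N))" for N by (rule smooth_on_top_coeff_poly[OF open_Omega])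
          show "closed shell" by (rule compact_imp_closed[OF compact_shell])
          show op: "open ?U" by (intro open_Int open_Omega open_norm_lt open_component_neq)
          show "smooth_on ?U (\<lambda>x. of_real (8/5) * x $ 1)"
            by (intro smooth_on_mult smooth_on_const smooth_on_component op)
          show "shell \<inter> \<Omega> \<subseteq> ?U" by (auto simp: shell_def)
          show "norm (of_real (8/5) * x $ 1) < 1" if "x \<in> ?U" for x
          proof -
            have "(norm (x $ 1))\<^sup>2 < (5/8)\<^sup>2" using that by (simp add: power2_eq_square)
            then have "norm (x $ 1) < 5/8" by (rule power_less_imp_less_base) simp
            then show ?thesis by (simp add: norm_mult)
          qed
        qed (use K top_coeff_poly_minus_cauchy_coeff in \<open>auto simp: top_coeff_eq_0\<close>)
        then show ?thesis using True by (simp add: single_form_simps)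
      next
        case False
        then show ?thesis by (simp add: single_form_simps uniform_limit_const)
      qed
    qed
  qed
  ultimately show ?thesis by simp
qed

end


section \<open>Smooth cohomology\<close>

lemma geometric_sum_inverse:
  fixes z s :: complex
  assumes "z \<noteq> 0" "z \<noteq> s"
  shows "(\<Sum>k<N. s ^ k * inverse z ^ Suc k) - inverse (z - s) = - inverse (z - s) * (s * inverse z) ^ N"
proof -
  let ?S = "\<Sum>k<N. s ^ k * inverse z ^ Suc k"
  have "?S = inverse z * (\<Sum>k<N. (s * inverse z) ^ k)"
    by (simp add: sum_distrib_left power_mult_distrib mult_ac)
  moreover have "(z - s) * inverse z = 1 - s * inverse z"
    using assms by (simp add: left_diff_distrib)
  ultimately have "(z - s) * ?S = (1 - s * inverse z) * (\<Sum>k<N. (s * inverse z) ^ k)"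
    by (metis mult.assoc)
  also have "\<dots> = 1 - (s * inverse z) ^ N" by (rule one_diff_power_eq[symmetric])
  finally have "?S = (1 - (s * inverse z) ^ N) * inverse (z - s)"
    by (intro mult_eq_imp_eq_inverse) (use assms in simp)
  then show ?thesis by (simp add: algebra_simps)
qed

context hartogs_complement
begin

text \<open>Formally the derivative of \<kappa>(|w|^2) / (z - 3/4). That function is singular on the
  part z = 3/4, |w| < 3/4 of \<open>\<Omega>\<close>, whereas its derivative lives on |z| > |w| >
  3/4 and is smooth; at z = 3/4 the default inverse is multiplied by 0.\<close>

definition limit_coeff :: "complex ^ 2 \<Rightarrow> complex" where
  "limit_coeff x = (if x \<in> \<Omega> then inverse (x $ 1 - of_real (3/4)) * (radial (cutoff' (9/16) (49/64)) 2 x * x $ 2) else 0)"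

definition pole_sum :: "nat \<Rightarrow> complex ^ 2 \<Rightarrow> complex" where
  "pole_sum N x = (\<Sum>k<N. of_real (3/4) ^ k * pole k x)"

definition dbar_pole_sum :: "nat \<Rightarrow> complex ^ 2 \<Rightarrow> complex" where
  "dbar_pole_sum N x = (\<Sum>k<N. of_real (3/4) ^ k * dbar_pole k x)"

definition annulus :: "(complex ^ 2) set" where
  "annulus = {x. 9/16 \<le> (norm (x $ 2))\<^sup>2 \<and> (norm (x $ 2))\<^sup>2 \<le> 49/64}"

lemma closed_annulus: "closed annulus"
  unfolding annulus_def by (intro closed_Collect_conj closed_Collect_le continuous_intros)

lemma not_annulus: "x \<notin> annulus \<Longrightarrow> radial (cutoff' (9/16) (49/64)) 2 x = 0"
  by (auto simp: annulus_def radial_def intro!: cutoff'_eq_0)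

text \<open>An open part of \<open>\<Omega>\<close> that contains its intersection with
  \<open>annulus\<close> and on which the ratio (3/4)/z has norm below 1.\<close>

definition outer_region :: "(complex ^ 2) set" where
  "outer_region = \<Omega> \<inter> {x. (norm (x $ 1))\<^sup>2 > 9/16}"

lemma open_outer_region: "open outer_region"
  unfolding outer_region_def by (intro open_Int open_Omega open_norm_gt)

lemma annulus_subset: "annulus \<inter> \<Omega> \<subseteq> outer_region"
proof
  fix x assume x: "x \<in> annulus \<inter> \<Omega>"
  then have "x \<in> \<Omega>" by blast
  then have "norm (x $ 2) < norm (x $ 1)"
  proof (cases rule: Omega_cases)
    case 2
    then have "(norm (x $ 2))\<^sup>2 > 1" by (simp add: one_less_power)
    with x show ?thesis by (simp add: annulus_def)
  qed
  then have "(norm (x $ 2))\<^sup>2 < (norm (x $ 1))\<^sup>2" by (intro power_strict_mono) auto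
  with x show "x \<in> outer_region" by (simp add: annulus_def outer_region_def)
qed

lemma outer_region_norm: "x \<in> outer_region \<Longrightarrow> norm (x $ 1) > 3/4"
  using power_less_imp_less_base[of "3/4" 2 "norm (x $ 1)"] by (auto simp: outer_region_def power2_eq_square)

lemma outer_region_neq: "x \<in> outer_region \<Longrightarrow> x $ 1 \<noteq> 0" "x \<in> outer_region \<Longrightarrow> x $ 1 \<noteq> of_real (3/4)"
proof -
  assume "x \<in> outer_region"
  then have "norm (x $ 1) > 3/4" by (rule outer_region_norm)
  moreover have "norm (of_real (3/4) :: complex) = 3/4" by (simp only: norm_of_real)
  ultimately show "x $ 1 \<noteq> 0" "x $ 1 \<noteq> of_real (3/4)"
    by (auto simp del: of_real_divide of_real_numeral)
qed

lemma Omega_eq_Un: "\<Omega> = outer_region \<union> (\<Omega> - annulus)"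
  using annulus_subset by (auto simp: outer_region_def)

lemma smooth_on_limit_coeff: "smooth_on \<Omega> limit_coeff"
proof -
  have "smooth_on outer_region (\<lambda>x. inverse (x $ 1 - of_real (3/4)) * (radial (cutoff' (9/16) (49/64)) 2 x * x $ 2))"
    by (intro smooth_on_mult smooth_on_inverse smooth_on_diff smooth_on_const smooth_on_component
        smooth_on_radial_cutoff' open_outer_region) (use outer_region_neq in auto)
  then have "smooth_on outer_region limit_coeff"
    by (rule smooth_on_cong[OF open_outer_region, rotated]) (auto simp: limit_coeff_def outer_region_def)
  moreover have op: "open (\<Omega> - annulus)" by (intro open_Diff open_Omega closed_annulus)
  have "smooth_on (\<Omega> - annulus) limit_coeff"
    by (rule smooth_on_cong[OF op _ smooth_on_const[OF op, of 0]]) (auto simp: limit_coeff_def not_annulus)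
  ultimately show ?thesis using smooth_on_Un Omega_eq_Un by metis
qed

lemma dbar_pole_sum_minus_limit_coeff:
  assumes "x \<in> outer_region"
  shows "dbar_pole_sum N x - limit_coeff x = - limit_coeff x * (of_real (3/4) * inverse (x $ 1)) ^ N"
proof -
  let ?w = "radial (cutoff' (9/16) (49/64)) 2 x * x $ 2" and ?s = "of_real (3/4) :: complex"
  have "dbar_pole_sum N x = (\<Sum>k<N. ?s ^ k * inverse (x $ 1) ^ Suc k) * ?w"
    unfolding dbar_pole_sum_def dbar_pole_def sum_distrib_right by (simp only: mult.assoc)
  moreover have "limit_coeff x = inverse (x $ 1 - ?s) * ?w"
    using assms by (simp add: limit_coeff_def outer_region_def)
  ultimately have "dbar_pole_sum N x - limit_coeff x = ((\<Sum>k<N. ?s ^ k * inverse (x $ 1) ^ Suc k) - inverse (x $ 1 - ?s)) * ?w"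
    by (simp only: left_diff_distrib)
  also have "\<dots> = - limit_coeff x * (?s * inverse (x $ 1)) ^ N"
    unfolding geometric_sum_inverse[OF outer_region_neq[OF assms]]
    using assms by (simp add: limit_coeff_def outer_region_def mult_ac)
  finally show ?thesis .
qed

lemma smooth_on_pole_sum: "smooth_on \<Omega> (pole_sum N)" and smooth_on_dbar_pole_sum: "smooth_on \<Omega> (dbar_pole_sum N)"
  unfolding pole_sum_def[abs_def] dbar_pole_sum_def[abs_def]
  by (intro smooth_on_sum smooth_on_mult smooth_on_const smooth_on_pole smooth_on_dbar_pole open_Omega)+

lemma has_dzbar_sum:
  assumes "\<And>i. i \<in> I \<Longrightarrow> has_dzbar j (f i) (D i) x"
  shows "has_dzbar j (\<lambda>x. \<Sum>i\<in>I. f i x) (\<Sum>i\<in>I. D i) x"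
  using assms by (induction I rule: infinite_finite_induct) (auto intro: has_dzbar_const has_dzbar_add)

lemma d_zbar_pole_sum: "x \<in> \<Omega> \<Longrightarrow> d_zbar 1 (pole_sum N) x = 0" "x \<in> \<Omega> \<Longrightarrow> d_zbar 2 (pole_sum N) x = dbar_pole_sum N x"
proof -
  assume x: "x \<in> \<Omega>"
  have "has_dzbar 1 (pole_sum N) (\<Sum>k<N. 0 * pole k x + of_real (3/4) ^ k * 0) x"
    "has_dzbar 2 (pole_sum N) (\<Sum>k<N. 0 * pole k x + of_real (3/4) ^ k * dbar_pole k x) x"
    unfolding pole_sum_def[abs_def]
    by (intro has_dzbar_sum has_dzbar_mult has_dzbar_const has_dzbar_pole x)+
  then show "d_zbar 1 (pole_sum N) x = 0" "d_zbar 2 (pole_sum N) x = dbar_pole_sum N x"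
    by (simp_all add: has_dzbar_def dbar_pole_sum_def)
qed

lemma has_dzbar_annulus:
  assumes "(\<phi> has_field_derivative d) (at (x $ 1))"
  shows "has_dzbar 1 (\<lambda>x. \<phi> (x $ 1) * (radial (cutoff' (9/16) (49/64)) 2 x * x $ 2)) 0 x"
proof -
  have "has_dzbar 1 (radial (cutoff' (9/16) (49/64)) 2) 0 x"
    by (intro has_dzbar_radial_other smooth_on_cutoff') simp
  moreover have "has_dzbar 1 (\<lambda>x. x $ 2) 0 x" by (rule has_dzbar_holomorphic[OF DERIV_ident])
  ultimately show ?thesis
    using has_dzbar_mult[OF has_dzbar_holomorphic[OF assms] has_dzbar_mult] by fastforce
qed

lemma d_zbar_1_limit_coeff:
  assumes "x \<in> \<Omega>"
  shows "d_zbar 1 limit_coeff x = 0"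
proof -
  have "has_dzbar 1 limit_coeff 0 x"
  proof (cases "x \<in> outer_region")
    case True
    have "((\<lambda>z. inverse (z - of_real (3/4))) has_field_derivative
        - inverse ((x $ 1 - of_real (3/4)) ^ 2)) (at (x $ 1))"
      by (rule derivative_eq_intros refl | use outer_region_neq(2)[OF True] in \<open>simp add: power2_eq_square\<close>)+
    from has_dzbar_annulus[OF this] show ?thesis
      by (rule has_dzbar_cong_open[OF open_outer_region True, rotated]) (auto simp: limit_coeff_def outer_region_def)
  next
    case False
    then have "x \<in> \<Omega> - annulus" using assms Omega_eq_Un by blast
    then show ?thesis
      by (intro has_dzbar_cong_open[OF _ _ _ has_dzbar_const[of _ 0], of "\<Omega> - annulus"])
        (auto simp: limit_coeff_def not_annulus intro: open_Diff open_Omega closed_annulus)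
  qed
  then show ?thesis by (simp add: has_dzbar_def)
qed

lemma d_zbar_1_dbar_pole_sum:
  assumes "x \<in> \<Omega>"
  shows "d_zbar 1 (dbar_pole_sum N) x = 0"
proof -
  have dbar_pole: "has_dzbar 1 (dbar_pole k) 0 x" for k
  proof (cases "x $ 1 = 0")
    case False
    show ?thesis
      unfolding dbar_pole_def[abs_def]
      by (rule has_dzbar_annulus[OF DERIV_power[OF DERIV_inverse[OF False]]])
  next
    case True
    then have x: "(norm (x $ 2))\<^sup>2 > 49/64" using assms Omega_cover by blast
    show ?thesis
      by (rule has_dzbar_cong_open[OF open_norm_gt[of "49/64" 2] _ _ has_dzbar_const[of _ 0]])
        (use x in \<open>simp_all add: pole_eq_0\<close>)
  qed
  have "has_dzbar 1 (dbar_pole_sum N) (\<Sum>k<N. 0 * dbar_pole k x + of_real (3/4) ^ k * 0) x"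
    unfolding dbar_pole_sum_def[abs_def] by (intro has_dzbar_sum has_dzbar_mult has_dzbar_const dbar_pole)
  then show ?thesis by (simp add: has_dzbar_def)
qed

text \<open>Forms must vanish outside \<open>\<Omega>\<close>, where the formulas for the poles
  still give values. Derivatives at points of the open set \<open>\<Omega>\<close> do not notice the
  truncation.\<close>

definition restrict_Omega :: "(complex ^ 2 \<Rightarrow> complex) \<Rightarrow> complex ^ 2 \<Rightarrow> complex" where
  "restrict_Omega f x = (if x \<in> \<Omega> then f x else 0)"

lemma restrict_Omega:
  "smooth_on \<Omega> f \<Longrightarrow> smooth_on \<Omega> (restrict_Omega f)" "x \<in> \<Omega> \<Longrightarrow> restrict_Omega f x = f x"
  "x \<notin> \<Omega> \<Longrightarrow> restrict_Omega f x = 0" "x \<in> \<Omega> \<Longrightarrow> d_zbar j (restrict_Omega f) x = d_zbar j f x"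
proof -
  show "x \<in> \<Omega> \<Longrightarrow> restrict_Omega f x = f x" "x \<notin> \<Omega> \<Longrightarrow> restrict_Omega f x = 0"
    by (simp_all add: restrict_Omega_def)
  show "smooth_on \<Omega> f \<Longrightarrow> smooth_on \<Omega> (restrict_Omega f)"
    by (rule smooth_on_cong[OF open_Omega, rotated]) (simp_all add: restrict_Omega_def)
  show "x \<in> \<Omega> \<Longrightarrow> d_zbar j (restrict_Omega f) x = d_zbar j f x"
    unfolding d_zbar_def
    using frechet_derivative_cong_open[OF open_Omega, of x "restrict_Omega f" f]
    by (simp add: restrict_Omega_def)
qed

text \<open>The form already contains the differential of the conjugate of the second variable, so
  closedness only asks that the coefficient be holomorphic in the first.\<close>

lemma single_form_21:
  assumes "smooth_on \<Omega> w" "\<And>x. x \<notin> \<Omega> \<Longrightarrow> w x = 0" "\<And>x. x \<in> \<Omega> \<Longrightarrow> d_zbar 1 w x = 0"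
  shows "single_form UNIV {2} w \<in> smooth_forms \<Omega> 2 1" "dbar \<Omega> (single_form UNIV {2} w) = 0"
proof -
  show sm: "single_form UNIV {2} w \<in> smooth_forms \<Omega> 2 1"
    using assms by (intro single_form_in_smooth_forms open_Omega) auto
  have "dbar \<Omega> (single_form UNIV {2} w) I J x = 0" for I J x
  proof (cases "I = UNIV \<and> J = UNIV")
    case True
    have sets: "UNIV - {1::2} = {2}" "UNIV - {2::2} = {1}" by (auto simp: UNIV_2)
    have forms: "single_form UNIV {2::2} w UNIV {2} = w" "single_form UNIV {2::2} w UNIV {1} = (\<lambda>x. 0)"
      by (auto simp: single_form_def fun_eq_iff)
    have "d_zbar j (single_form UNIV {2} w UNIV (UNIV - {j})) x = 0" if "x \<in> \<Omega>" for j
      using exhaust_2[of j] by (elim disjE) (simp_all only: sets forms assms(3)[OF that] d_zbar_zero)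
    then show ?thesis using True by (simp add: dbar_def)
  next
    case False
    then show ?thesis
      by (intro dbar_eq_0[OF sm]) (use card_eq_2_iff[of I] card_eq_2_iff[of J] in \<open>auto simp: numeral_2_eq_2\<close>)
  qed
  then show "dbar \<Omega> (single_form UNIV {2} w) = 0" by (simp add: fun_eq_iff)
qed

lemma pole_sum_form:
  shows "single_form UNIV {} (restrict_Omega (pole_sum N)) \<in> smooth_forms \<Omega> 2 0"
    and "dbar \<Omega> (single_form UNIV {} (restrict_Omega (pole_sum N))) = single_form UNIV {2} (restrict_Omega (dbar_pole_sum N))"
proof -
  let ?f = "single_form UNIV {} (restrict_Omega (pole_sum N)) :: 2 form"
  show sm: "?f \<in> smooth_forms \<Omega> 2 0"
    by (intro single_form_in_smooth_forms open_Omega restrict_Omega smooth_on_pole_sum) auto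
  show "dbar \<Omega> ?f = single_form UNIV {2} (restrict_Omega (dbar_pole_sum N))"
  proof (intro ext)
    fix I J :: "2 set" and x
    show "dbar \<Omega> ?f I J x = single_form UNIV {2} (restrict_Omega (dbar_pole_sum N)) I J x"
    proof (cases "I = UNIV \<and> (J = {1} \<or> J = {2})")
      case True
      then obtain j where j: "I = UNIV" "J = {j}" "j = 1 \<or> j = 2" by blast
      have "dbar \<Omega> ?f I J x = (if x \<in> \<Omega> then d_zbar j (restrict_Omega (pole_sum N)) x else 0)"
        unfolding j dbar_singleton single_form_simps(1) ..
      also have "\<dots> = single_form UNIV {2} (restrict_Omega (dbar_pole_sum N)) I J x"
        using j by (auto simp: single_form_def restrict_Omega d_zbar_pole_sum)
      finally show ?thesis .
    next
      case False
      have "card I \<noteq> 2 \<or> card J \<noteq> Suc 0"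
      proof (rule ccontr)
        assume "\<not> (card I \<noteq> 2 \<or> card J \<noteq> Suc 0)"
        then obtain j where "I = UNIV" "J = {j}" using card_eq_2_iff[of I] by (auto simp: card_1_singleton_iff)
        then show False using False exhaust_2[of j] by auto
      qed
      then have "dbar \<Omega> ?f I J x = 0" by (rule dbar_eq_0[OF sm])
      then show ?thesis using False by (auto simp: single_form_def)
    qed
  qed
qed

text \<open>Stokes' formula with \<open>pole_sum N\<close> evaluates the integrals against the
  partial sums. For \<open>N > j\<close> biorthogonality makes them independent of \<open>N\<close>,
  and the limit may be taken under the integral.\<close>

lemma integral_primitive1_limit_coeff: "(\<integral>x. primitive1 (\<lambda>z. z ^ j) x * limit_coeff x \<partial>lborel) = of_real (3/4) ^ j * integral\<^sup>L lborel shell_weight"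
proof -
  let ?v = "primitive1 (\<lambda>z. z ^ j)"
  have smv: "smooth_on \<Omega> ?v" "smooth_on \<Omega> (primitive2 (\<lambda>z. z ^ j))"
    using smooth_on_primitive[OF admissible_monom] smooth_on_subset by blast+
  have sm: "smooth_on \<Omega> (\<lambda>x. ?v x * dbar_pole_sum N x)" "smooth_on \<Omega> (\<lambda>x. ?v x * limit_coeff x)" for N
    by (intro smooth_on_mult open_Omega smv smooth_on_dbar_pole_sum smooth_on_limit_coeff)+
  have pair: "(\<integral>x. top_coeff (\<lambda>z. z ^ j) x * pole_sum N x \<partial>lborel) = - (\<integral>x. ?v x * dbar_pole_sum N x \<partial>lborel)" for N
    using shell_subset
    by (intro dbar_pairing_coeff[OF open_Omega smv smooth_on_pole_sum compact_primitive_support primitive_support_subset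
          primitive_eq_0 d_zbar_primitive[OF admissible_monom] _ d_zbar_pole_sum])
      (auto intro: top_coeff_eq_0)
  have "\<exists>C. \<forall>N. norm (\<integral>x. ?v x * dbar_pole_sum N x - ?v x * limit_coeff x \<partial>lborel) \<le> C * (3/4) ^ N"
  proof (rule integral_geometric_bound[OF open_Omega _ compact_primitive_support primitive_support_subset])
    show "continuous_on primitive_support (\<lambda>x. ?v x * limit_coeff x)"
      by (rule continuous_on_subset[OF smooth_on_imp_continuous_on[OF sm(2)] primitive_support_subset])
    fix x and N assume x: "x \<in> primitive_support"
    show "norm (?v x * dbar_pole_sum N x - ?v x * limit_coeff x) \<le> norm (?v x * limit_coeff x) * (3/4) ^ N"
    proof (cases "?v x = 0")
      case False
      \<comment> \<open>\<open>primitive1\<close> contains the derivative of the outer cutoff in the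
        first variable, so |z| > 1 where it is nonzero, and the series converges there with ratio at
        most 3/4.\<close>
      then have "radial (cutoff' q_mid q) 1 x \<noteq> 0" by (auto simp: primitive1_def)
      then have n: "(norm (x $ 1))\<^sup>2 > q_mid"
        using cutoff'_eq_0[of "(norm (x $ 1))\<^sup>2" q_mid q] by (auto simp: radial_def not_le[symmetric])
      then have "1\<^sup>2 < (norm (x $ 1))\<^sup>2" using q_mid by simp
      then have n1: "1 < norm (x $ 1)" by (rule power_less_imp_less_base) simp
      have "x \<in> outer_region" using x primitive_support_subset n q_mid by (auto simp: outer_region_def)
      then have "?v x * dbar_pole_sum N x - ?v x * limit_coeff x = ?v x * limit_coeff x * - ((of_real (3/4) * inverse (x $ 1)) ^ N)"
        using dbar_pole_sum_minus_limit_coeff[of x N] by (simp only: right_diff_distrib[symmetric]) (simp add: mult_ac)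
      moreover have "norm (of_real (3/4) * inverse (x $ 1)) ^ N \<le> (3/4) ^ N"
        using n1 le_imp_inverse_le[of 1 "norm (x $ 1)"]
        by (intro power_mono) (auto simp: norm_mult norm_inverse)
      ultimately show ?thesis
        by (simp only: norm_mult norm_minus_cancel norm_power) (intro mult_left_mono, auto)
    qed simp
  qed (auto intro!: smooth_on_diff open_Omega sm simp: primitive_eq_0)
  then obtain C where C: "norm (\<integral>x. ?v x * dbar_pole_sum N x - ?v x * limit_coeff x \<partial>lborel) \<le> C * (3/4) ^ N" for N
    by blast
  have "of_real (3/4) ^ j * integral\<^sup>L lborel shell_weight = (\<integral>x. ?v x * limit_coeff x \<partial>lborel)"
  proof (rule eq_if_geometric_bound[where j=j and C=C and \<rho>="3/4"])
    fix N assume "j < N"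
    then have "(\<integral>x. ?v x * dbar_pole_sum N x \<partial>lborel) = of_real (3/4) ^ j * integral\<^sup>L lborel shell_weight"
      using pair[of N] integral_top_coeff_monom_pole[where j=j and N=N and b="\<lambda>k. of_real (3/4) ^ k"] by (simp add: pole_sum_def)
    moreover have "(\<integral>x. ?v x * dbar_pole_sum N x - ?v x * limit_coeff x \<partial>lborel)
        = (\<integral>x. ?v x * dbar_pole_sum N x \<partial>lborel) - (\<integral>x. ?v x * limit_coeff x \<partial>lborel)"
      by (intro Bochner_Integration.integral_diff
          integrable_smooth_compact_support[OF open_Omega _ compact_primitive_support primitive_support_subset] sm) (auto simp: primitive_eq_0)
    ultimately show "norm (of_real (3/4) ^ j * integral\<^sup>L lborel shell_weight - (\<integral>x. ?v x * limit_coeff x \<partial>lborel)) \<le> C * (3/4) ^ N"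
      using C[of N] by simp
  qed auto
  then show ?thesis by simp
qed

lemma limit_form_not_exact: "single_form UNIV {2} limit_coeff \<notin> dbar \<Omega> ` smooth_forms \<Omega> 2 0"
proof
  assume "single_form UNIV {2} limit_coeff \<in> dbar \<Omega> ` smooth_forms \<Omega> 2 0"
  then obtain f where f: "single_form UNIV {2} limit_coeff = dbar \<Omega> f" "f \<in> smooth_forms \<Omega> 2 0" by blast
  let ?\<phi> = "f UNIV {}"
  have smv: "smooth_on \<Omega> (primitive1 (\<lambda>z. z ^ j))" "smooth_on \<Omega> (primitive2 (\<lambda>z. z ^ j))" for j
    using smooth_on_primitive[OF admissible_monom] smooth_on_subset by blast+
  have sm: "smooth_on \<Omega> ?\<phi>" using f(2) by (simp add: smooth_forms_def)
  have "d_zbar 1 ?\<phi> x = 0" "d_zbar 2 ?\<phi> x = limit_coeff x" if "x \<in> \<Omega>" for x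
    using fun_cong[OF fun_cong[OF fun_cong[OF f(1)]], of UNIV "{1}" x]
      fun_cong[OF fun_cong[OF fun_cong[OF f(1)]], of UNIV "{2}" x] that
    by (simp_all add: dbar_singleton single_form_def)
  then have pair: "(\<integral>x. top_coeff (\<lambda>z. z ^ j) x * ?\<phi> x \<partial>lborel) = - (\<integral>x. primitive1 (\<lambda>z. z ^ j) x * limit_coeff x \<partial>lborel)" for j
    using shell_subset
    by (intro dbar_pairing_coeff[OF open_Omega smv sm compact_primitive_support primitive_support_subset primitive_eq_0
          d_zbar_primitive[OF admissible_monom]])
      (auto intro: top_coeff_eq_0)
  have "\<exists>C. \<forall>j. norm (\<integral>x. top_coeff (\<lambda>z. z ^ j) x * ?\<phi> x \<partial>lborel) \<le> C * (1/2) ^ j"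
  \<comment> \<open>An arbitrary smooth \<phi> is bounded on the compact shell, whose outer radius
    1/2 is the ratio; the values 3/4 to the power \<open>j\<close> decay more slowly.\<close>
  proof (rule integral_geometric_bound[OF open_Omega _ compact_shell shell_subset, where A="\<lambda>x. shell_weight x * x $ 1 * ?\<phi> x"])
    have "smooth_on \<Omega> (\<lambda>x. shell_weight x * x $ 1 * ?\<phi> x)"
      by (intro smooth_on_mult open_Omega smooth_on_shell_weight smooth_on_component sm)
    then show "continuous_on shell (\<lambda>x. shell_weight x * x $ 1 * ?\<phi> x)"
      by (rule continuous_on_subset[OF smooth_on_imp_continuous_on shell_subset])
    show "smooth_on \<Omega> (\<lambda>x. top_coeff (\<lambda>z. z ^ j) x * ?\<phi> x)" for j
      unfolding top_coeff_def
      by (intro smooth_on_mult smooth_on_uminus smooth_on_power open_Omega smooth_on_shell_weight smooth_on_component sm)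
    fix x and j :: nat assume x: "x \<in> shell"
    have "norm (x $ 1) ^ j \<le> (1/2) ^ j" by (intro power_mono norm_le_on_shell x) auto
    then have "norm (shell_weight x * x $ 1 * ?\<phi> x) * norm (x $ 1) ^ j \<le> norm (shell_weight x * x $ 1 * ?\<phi> x) * (1/2) ^ j"
      by (intro mult_left_mono) auto
    then show "norm (top_coeff (\<lambda>z. z ^ j) x * ?\<phi> x) \<le> norm (shell_weight x * x $ 1 * ?\<phi> x) * (1/2) ^ j"
      by (simp add: top_coeff_def norm_mult norm_power mult_ac)
  qed (auto simp: top_coeff_eq_0)
  then obtain C where C: "norm (\<integral>x. top_coeff (\<lambda>z. z ^ j) x * ?\<phi> x \<partial>lborel) \<le> C * (1/2) ^ j" for j by blast
  have "norm (of_real (3/4) ^ j * integral\<^sup>L lborel shell_weight) \<le> C * (1/2) ^ j" for j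
    using C[of j] unfolding pair integral_primitive1_limit_coeff norm_minus_cancel .
  then show False
    by (rule geometric_growth_contradiction) (use integral_shell_weight_neq_0 in auto)
qed

theorem not_Hausdorff_dolbeault: "\<not> Hausdorff_space (dolbeault \<Omega> 2 1)"
proof -
  have "dolbeault \<Omega> 2 1 = cohomology_space \<Omega> (smooth_forms_topology \<Omega> 2 1) (dbar \<Omega> ` smooth_forms \<Omega> 2 0)"
    by (simp add: dolbeault_def)
  moreover have "\<not> Hausdorff_space (cohomology_space \<Omega> (smooth_forms_topology \<Omega> 2 1) (dbar \<Omega> ` smooth_forms \<Omega> 2 0))"
  proof (rule not_Hausdorff_cohomology_space)
    let ?u = "single_form UNIV {2} limit_coeff :: 2 form"
    let ?U = "\<lambda>N. single_form UNIV {2} (restrict_Omega (dbar_pole_sum N)) :: 2 form"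
    have u: "?u \<in> smooth_forms \<Omega> 2 1" "dbar \<Omega> ?u = 0"
      by (intro single_form_21 smooth_on_limit_coeff d_zbar_1_limit_coeff; simp add: limit_coeff_def)+
    have U: "?U N \<in> smooth_forms \<Omega> 2 1" "dbar \<Omega> (?U N) = 0" for N
      by (intro single_form_21 restrict_Omega smooth_on_dbar_pole_sum; simp add: restrict_Omega d_zbar_1_dbar_pole_sum)+
    show "0 \<in> dbar \<Omega> ` smooth_forms \<Omega> 2 0"
      by (rule image_eqI[OF _ zero_in_smooth_forms[OF open_Omega]]) (simp add: dbar_zero)
    show "f - g \<in> dbar \<Omega> ` smooth_forms \<Omega> 2 0"
      if "f \<in> dbar \<Omega> ` smooth_forms \<Omega> 2 0" "g \<in> dbar \<Omega> ` smooth_forms \<Omega> 2 0" for f g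
      using that by (rule dbar_smooth_image_diff)
    show "0 \<in> topspace (smooth_forms_topology \<Omega> 2 1)"
      by (simp add: topspace_smooth_forms_topology open_Omega zero_in_smooth_forms)
    show "dbar \<Omega> 0 = 0" by (rule dbar_zero)
    show "dbar \<Omega> ?u = 0" by (rule u)
    show "?u \<notin> dbar \<Omega> ` smooth_forms \<Omega> 2 0" by (rule limit_form_not_exact)
    show "dbar \<Omega> (?U N) = 0" for N by (rule U)
    show "?U N \<in> dbar \<Omega> ` smooth_forms \<Omega> 2 0" for N
      using imageI[OF pole_sum_form(1)[of N], of "dbar \<Omega>"] by (simp only: pole_sum_form(2))
    show "?U N \<in> topspace (smooth_forms_topology \<Omega> 2 1)" for N
      using U by (simp add: topspace_smooth_forms_topology)
    show "limitin (smooth_forms_topology \<Omega> 2 1) ?U ?u sequentially"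
    proof (rule limitin_smooth_forms_topology[OF open_Omega u(1) U(1)])
      fix I J :: "2 set" and vs and K :: "(complex ^ 2) set" assume K: "compact K" "K \<subseteq> \<Omega>"
      show "uniform_limit K (\<lambda>N. iter_deriv vs (?U N I J)) (iter_deriv vs (?u I J)) sequentially"
      proof (cases "I = UNIV \<and> J = {2}")
        case True
        have "uniform_limit K (\<lambda>N. iter_deriv vs (restrict_Omega (dbar_pole_sum N))) (iter_deriv vs limit_coeff) sequentially"
        proof (rule uniform_limit_iter_deriv_geometric_error[where U=outer_region and C=annulus
              and Q="\<lambda>x. - limit_coeff x" and \<theta>="\<lambda>x. of_real (3/4) * inverse (x $ 1)", OF open_Omega smooth_on_limit_coeff])
          show "smooth_on \<Omega> (restrict_Omega (dbar_pole_sum N))" for N by (intro restrict_Omega smooth_on_dbar_pole_sum)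
          show "smooth_on outer_region (\<lambda>x. - limit_coeff x)"
            by (intro smooth_on_uminus open_outer_region smooth_on_subset[OF smooth_on_limit_coeff]) (auto simp: outer_region_def)
          show "smooth_on outer_region (\<lambda>x. of_real (3/4) * inverse (x $ 1))"
            by (intro smooth_on_mult smooth_on_const smooth_on_inverse smooth_on_component open_outer_region outer_region_neq)
          show "norm (of_real (3/4) * inverse (x $ 1)) < 1" if "x \<in> outer_region" for x
            using outer_region_norm[OF that] less_imp_inverse_less[of "3/4" "norm (x $ 1)"]
            by (simp add: norm_mult norm_inverse)
          show "restrict_Omega (dbar_pole_sum N) x - limit_coeff x = - limit_coeff x * (of_real (3/4) * inverse (x $ 1)) ^ N"
            if "x \<in> outer_region" for N x
            using dbar_pole_sum_minus_limit_coeff[OF that, of N] that by (simp add: restrict_Omega_def outer_region_def)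
          show "restrict_Omega (dbar_pole_sum N) x = limit_coeff x" if "x \<in> \<Omega>" "x \<notin> annulus" for N x
            using that by (simp add: restrict_Omega_def limit_coeff_def dbar_pole_sum_def dbar_pole_def not_annulus)
          show "of_real (3/4) * inverse (x $ 1) \<noteq> (0::complex)" if "x \<in> outer_region" for x
            using outer_region_neq(1)[OF that] by simp
          show "outer_region \<subseteq> \<Omega>" by (auto simp: outer_region_def)
        qed (fact K closed_annulus open_outer_region annulus_subset)+
        then show ?thesis using True by (simp add: single_form_simps)
      next
        case False
        then show ?thesis by (simp add: single_form_simps uniform_limit_const)
      qed
    qed
  qed
  ultimately show ?thesis by simp
qed

end

theorem corollary4p6:
  fixes c :: "complex ^ 2" and R :: real
  assumes "R \<ge> 2"
    and "compact (closure hartogs_triangle)"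
    and "closure hartogs_triangle \<subseteq> ball c R"
  shows "\<not> Hausdorff_space (dolbeault_c (ball c R - closure hartogs_triangle) 0 2) \<and>
    \<not> Hausdorff_space (dolbeault (ball c R - closure hartogs_triangle) 2 1)"
proof -
  obtain q where q: "q > 1" "{x. (norm (x $ 1))\<^sup>2 \<le> q \<and> (norm (x $ 2))\<^sup>2 \<le> q} \<subseteq> ball c R"
    using polydisc_subset_ball[OF assms(3)] by blast
  then interpret hartogs_complement c R q by unfold_locales
  show ?thesis using not_Hausdorff_dolbeault_c not_Hausdorff_dolbeault by (simp add: \<Omega>_def)
qed

end
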